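(* Let $X$ be a non-empty set, let $C$ be an $X$-generated right cancellative monoid, and let $$\mathcal M=\mathrm{LAd}\langle X \mid w^+=w \text{ for all } w\in X^* \text{ such that } [w]_C=1\rangle .$$ Then $\mathrm{PT}(C;X)\cong\mathcal M$ (as $(2,1,0)$-algebras).
   Context: Left adequate monoids: for a monoid $M$, write $a\mathrel{\mathcal R^*}b$ if for all $x,y\in M$: $xa=ya\iff xb=yb$. $M$ is left adequate if every $\mathcal R^*$-class contains an idempotent and the idempotents of $M$ commute; $a^+$ denotes the unique idempotent in the $\mathcal R^*$-class of $a$. Left adequate monoids are regarded as algebras of signature $(2,1,0)$ (multiplication, $+$, identity) and form a quasivariety. $\mathrm{LAd}\langle X\mid R\rangle$ is the left adequate monoid presented by generators $X$ and relations $R$ within this quasivariety, i.e. the quotient of the free left adequate monoid on $X$ by the smallest $(2,1,0)$-congruence that contains $R$ and has left adequate quotient. An $X$-generated right cancellative monoid $C$ comes with a (not necessarily injective) map $X\to C$ whose image generates $C$; $[w]_C$ is the value in $C$ of a word $w\in X^*$. $X$-graphs: an $X$-graph $G$ is a finite directed graph (loops and parallel edges, even with equal labels, are allowed) with edges labelled by elements of $X$, with a start vertex $\alpha(G)$ and an end vertex $\omega(G)$ (possibly equal), such that every vertex is reachable by a directed path from $\alpha(G)$. Morphisms map vertices to vertices and edges to edges, preserving start vertex, end vertex, labels and incidence. $X$-graphs are considered up to isomorphism. An $X$-tree is an $X$-graph whose underlying undirected graph is a tree, with all edges oriented away from the start vertex. A retract of $G$ is an idempotent endomorphism of $G$ (or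 its image); $G$ is retracted if its only retract is the identity. Each $X$-graph $G$ has a retracted image under a retract, unique up to isomorphism, denoted $\overline G$. Idempath identification (with respect to $C$): an idempath in $G$ is a directed path whose label $w$ satisfies $[w]_C=1$. An idempath identification identifies the initial and terminal vertices of an idempath (no edges are deleted). A descendant of $G$ is any $X$-graph obtained from $G$ by finitely many successive idempath identifications. $G$ is idempath identified if every idempath in it is a closed path. $\widetilde G$ denotes the unique idempath identified descendant of $G$. Pretzel monoid: $G\times H$ is obtained from the disjoint union of $G$ and $H$ by identifying $\omega(G)$ with $\alpha(H)$, with start vertex $\alpha(G)$ and end vertex $\omega(H)$. $G^{(+)}$ is $G$ with end vertex moved to $\alpha(G)$. $\mathrm{FLAd}(X)$ is the set of isomorphism classes of retracted $X$-trees. $\mathrm{PT}(C;X):=\{\overline{\widetilde T}: T\in\mathrm{FLAd}(X)\}$, with operations $GH:=\overline{\widetilde{G\times H}}$, $G^+:=\overline{\widetilde{G^{(+)}}}$ and identity the single-vertex graph with no edges. *)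

theory Defs
  imports "Graph_Theory.Digraph_Component" "HOL-Algebra.Group"
begin

section \<open>Left adequate monoids and presentations\<close>

record 'a alg210 = "'a monoid" +
  plus_op :: "'a \<Rightarrow> 'a"

definition closed_alg :: "'a alg210 \<Rightarrow> bool" where
  "closed_alg A \<longleftrightarrow>
     \<one>\<^bsub>A\<^esub> \<in> carrier A \<and>
     (\<forall>a\<in>carrier A. plus_op A a \<in> carrier A) \<and>
     (\<forall>a\<in>carrier A. \<forall>b\<in>carrier A. a \<otimes>\<^bsub>A\<^esub> b \<in> carrier A)"

definition alg_isomorphic :: "'a alg210 \<Rightarrow> 'b alg210 \<Rightarrow> bool" where
  "alg_isomorphic A B \<longleftrightarrow> closed_alg A \<and> closed_alg B \<and>
     (\<exists>f\<in>iso A B. f \<one>\<^bsub>A\<^esub> = \<one>\<^bsub>B\<^esub> \<and> (\<forall>a\<in>carrier A. f (plus_op A a) = plus_op B (f a)))"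

definition Rstar :: "('a, 'b) monoid_scheme \<Rightarrow> 'a \<Rightarrow> 'a \<Rightarrow> bool" where
  "Rstar M a b \<longleftrightarrow>
     (\<forall>x\<in>carrier M. \<forall>y\<in>carrier M. x \<otimes>\<^bsub>M\<^esub> a = y \<otimes>\<^bsub>M\<^esub> a \<longleftrightarrow> x \<otimes>\<^bsub>M\<^esub> b = y \<otimes>\<^bsub>M\<^esub> b)"

definition idempotents :: "('a, 'b) monoid_scheme \<Rightarrow> 'a set" where
  "idempotents M = {e \<in> carrier M. e \<otimes>\<^bsub>M\<^esub> e = e}"

text \<open>
  Commuting idempotents make the idempotent in each class of \<^const>\<open>Rstar\<close> unique, so the last
  conjunct determines the unary operation on the carrier (and implies the second one).
\<close>
definition left_adequate :: "'a alg210 \<Rightarrow> bool" where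
  "left_adequate M \<longleftrightarrow> monoid M \<and>
     (\<forall>a\<in>carrier M. \<exists>e\<in>idempotents M. Rstar M a e) \<and>
     (\<forall>e\<in>idempotents M. \<forall>f\<in>idempotents M. e \<otimes>\<^bsub>M\<^esub> f = f \<otimes>\<^bsub>M\<^esub> e) \<and>
     (\<forall>a\<in>carrier M. plus_op M a \<in> idempotents M \<and> Rstar M a (plus_op M a))"

definition congruence :: "'a alg210 \<Rightarrow> 'a rel \<Rightarrow> bool" where
  "congruence A r \<longleftrightarrow> equiv (carrier A) r \<and>
     (\<forall>(a, a')\<in>r. \<forall>(b, b')\<in>r. (a \<otimes>\<^bsub>A\<^esub> b, a' \<otimes>\<^bsub>A\<^esub> b') \<in> r) \<and>
     (\<forall>(a, a')\<in>r. (plus_op A a, plus_op A a') \<in> r)"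

definition quotient_alg :: "'a alg210 \<Rightarrow> 'a rel \<Rightarrow> 'a set alg210" where
  "quotient_alg A r =
     \<lparr>carrier = carrier A // r,
      mult = (\<lambda>S T. \<Union>a\<in>S. \<Union>b\<in>T. r `` {a \<otimes>\<^bsub>A\<^esub> b}),
      one = r `` {\<one>\<^bsub>A\<^esub>},
      plus_op = (\<lambda>S. \<Union>a\<in>S. r `` {plus_op A a})\<rparr>"

text \<open>
  The smallest congruence containing \<open>R\<close> with left adequate quotient. It exists because left
  adequate monoids form a quasivariety; the universal relation is always one of the members of the
  intersected family.
\<close>
definition lad_congruence :: "'a alg210 \<Rightarrow> 'a rel \<Rightarrow> 'a rel" where
  "lad_congruence A R =
     \<Inter>{r. congruence A r \<and> R \<subseteq> r \<and> left_adequate (quotient_alg A r)}"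

datatype 'x lad_term =
    Gen 'x
  | Unit
  | Mul "'x lad_term" "'x lad_term"
  | Plus "'x lad_term"

definition term_alg :: "'x set \<Rightarrow> 'x lad_term alg210" where
  "term_alg X = \<lparr>carrier = {t. set_lad_term t \<subseteq> X}, mult = Mul, one = Unit, plus_op = Plus\<rparr>"

text \<open>
  The free left adequate monoid on \<open>X\<close>, as the free object of the quasivariety: the absolutely free
  (2,1,0)-algebra modulo the smallest congruence with left adequate quotient.
\<close>
definition free_lad :: "'x set \<Rightarrow> 'x lad_term set alg210" where
  "free_lad X = quotient_alg (term_alg X) (lad_congruence (term_alg X) {})"

definition free_gen :: "'x set \<Rightarrow> 'x \<Rightarrow> 'x lad_term set" where
  "free_gen X x = lad_congruence (term_alg X) {} `` {Gen x}"

definition LAd :: "'x set \<Rightarrow> 'x lad_term set rel \<Rightarrow> 'x lad_term set set alg210" where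
  "LAd X R = quotient_alg (free_lad X) (lad_congruence (free_lad X) R)"


section \<open>Generated right cancellative monoids\<close>

definition word_val :: "('a, 'b) monoid_scheme \<Rightarrow> ('x \<Rightarrow> 'a) \<Rightarrow> 'x list \<Rightarrow> 'a" where
  "word_val M f w = foldr (\<lambda>x m. f x \<otimes>\<^bsub>M\<^esub> m) w \<one>\<^bsub>M\<^esub>"

definition right_cancellative :: "('a, 'b) monoid_scheme \<Rightarrow> bool" where
  "right_cancellative M \<longleftrightarrow>
     (\<forall>a\<in>carrier M. \<forall>b\<in>carrier M. \<forall>c\<in>carrier M. a \<otimes>\<^bsub>M\<^esub> c = b \<otimes>\<^bsub>M\<^esub> c \<longrightarrow> a = b)"

definition generated_monoid :: "'x set \<Rightarrow> ('a, 'b) monoid_scheme \<Rightarrow> ('x \<Rightarrow> 'a) \<Rightarrow> bool" where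
  "generated_monoid X M f \<longleftrightarrow> monoid M \<and> f ` X \<subseteq> carrier M \<and>
     (\<lambda>H. submonoid H M) hull (f ` X) = carrier M"


section \<open>Labelled graphs\<close>

record ('v, 'e, 'x) xgraph =
  dg :: "('v, 'e) pre_digraph"
  label :: "'e \<Rightarrow> 'x"
  start :: 'v
  finish :: 'v

abbreviation "Verts G \<equiv> verts (dg G)"
abbreviation "Arcs G \<equiv> arcs (dg G)"

definition is_xgraph :: "'x set \<Rightarrow> ('v, 'e, 'x) xgraph \<Rightarrow> bool" where
  "is_xgraph X G \<longleftrightarrow> fin_digraph (dg G) \<and> label G ` Arcs G \<subseteq> X \<and>
     start G \<in> Verts G \<and> finish G \<in> Verts G \<and>
     (\<forall>v\<in>Verts G. reachable (dg G) (start G) v)"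

definition morphism ::
  "('v, 'e, 'x) xgraph \<Rightarrow> ('w, 'f, 'x) xgraph \<Rightarrow> ('v \<Rightarrow> 'w) \<Rightarrow> ('e \<Rightarrow> 'f) \<Rightarrow> bool" where
  "morphism G H f g \<longleftrightarrow>
     f ` Verts G \<subseteq> Verts H \<and> g ` Arcs G \<subseteq> Arcs H \<and>
     f (start G) = start H \<and> f (finish G) = finish H \<and>
     (\<forall>e\<in>Arcs G. label H (g e) = label G e \<and>
        tail (dg H) (g e) = f (tail (dg G) e) \<and> head (dg H) (g e) = f (head (dg G) e))"

definition xisomorphic :: "('v, 'e, 'x) xgraph \<Rightarrow> ('w, 'f, 'x) xgraph \<Rightarrow> bool" where
  "xisomorphic G H \<longleftrightarrow>
     (\<exists>f g. morphism G H f g \<and> bij_betw f (Verts G) (Verts H) \<and> bij_betw g (Arcs G) (Arcs H))"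

text \<open>
  Every finite graph is isomorphic to one whose vertices and edges are natural numbers, so an
  isomorphism class is represented by the set of those of its members.
\<close>
definition iso_class :: "('v, 'e, 'x) xgraph \<Rightarrow> (nat, nat, 'x) xgraph set" where
  "iso_class G = {H. xisomorphic G H}"

text \<open>
  The underlying undirected graph: each edge may be traversed in both directions, the flag being
  \<^const>\<open>True\<close> for a traversal from tail to head.
\<close>
definition undirected :: "('v, 'e) pre_digraph \<Rightarrow> ('v, 'e \<times> bool) pre_digraph" where
  "undirected D =
     \<lparr>verts = verts D, arcs = arcs D \<times> UNIV,
      tail = (\<lambda>(e, b). if b then tail D e else head D e),
      head = (\<lambda>(e, b). if b then head D e else tail D e)\<rparr>"

text \<open>
  A cycle of the undirected graph may not use an edge twice, which rules out going back and forth
  along an edge; loops and pairs of parallel or antiparallel edges are cycles. The last conjunct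
  says that all edges point away from the start vertex: simple undirected paths leaving it traverse
  their edges in the forward direction only.
\<close>
definition is_xtree :: "'x set \<Rightarrow> ('v, 'e, 'x) xgraph \<Rightarrow> bool" where
  "is_xtree X G \<longleftrightarrow> is_xgraph X G \<and>
     Digraph_Component.connected (dg G) \<and>
     \<not> (\<exists>p. pre_digraph.cycle (undirected (dg G)) p \<and> distinct (map fst p)) \<and>
     (\<forall>p v. pre_digraph.apath (undirected (dg G)) (start G) p v \<longrightarrow> list_all snd p)"


subsection \<open>Retracts\<close>

definition retract :: "('v, 'e, 'x) xgraph \<Rightarrow> ('v \<Rightarrow> 'v) \<Rightarrow> ('e \<Rightarrow> 'e) \<Rightarrow> bool" where
  "retract G f g \<longleftrightarrow> morphism G G f g \<and>
     (\<forall>v\<in>Verts G. f (f v) = f v) \<and> (\<forall>e\<in>Arcs G. g (g e) = g e)"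

definition image_graph ::
  "('v, 'e, 'x) xgraph \<Rightarrow> ('v \<Rightarrow> 'v) \<Rightarrow> ('e \<Rightarrow> 'e) \<Rightarrow> ('v, 'e, 'x) xgraph" where
  "image_graph G f g = G\<lparr>dg := (dg G)\<lparr>verts := f ` Verts G, arcs := g ` Arcs G\<rparr>\<rparr>"

definition retracted :: "('v, 'e, 'x) xgraph \<Rightarrow> bool" where
  "retracted G \<longleftrightarrow>
     (\<forall>f g. retract G f g \<longrightarrow> (\<forall>v\<in>Verts G. f v = v) \<and> (\<forall>e\<in>Arcs G. g e = e))"

text \<open>The retracted image of \<open>G\<close>; it is only unique up to isomorphism, so one is chosen.\<close>
definition core :: "('v, 'e, 'x) xgraph \<Rightarrow> ('v, 'e, 'x) xgraph" where
  "core G = (SOME H. \<exists>f g. retract G f g \<and> H = image_graph G f g \<and> retracted H)"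


subsection \<open>Idempath identification\<close>

text \<open>The merged vertex keeps the name \<open>u\<close>.\<close>
definition identify :: "'v \<Rightarrow> 'v \<Rightarrow> ('v, 'e, 'x) xgraph \<Rightarrow> ('v, 'e, 'x) xgraph" where
  "identify u v G = (let q = id(v := u) in
     \<lparr>dg = \<lparr>verts = q ` Verts G, arcs = Arcs G, tail = q \<circ> tail (dg G), head = q \<circ> head (dg G)\<rparr>,
      label = label G, start = q (start G), finish = q (finish G)\<rparr>)"

definition idempath ::
  "('c, 'd) monoid_scheme \<Rightarrow> ('x \<Rightarrow> 'c) \<Rightarrow> ('v, 'e, 'x) xgraph \<Rightarrow> 'v \<Rightarrow> 'e list \<Rightarrow> 'v \<Rightarrow> bool" where
  "idempath C \<gamma> G u p v \<longleftrightarrow>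
     pre_digraph.awalk (dg G) u p v \<and> word_val C \<gamma> (map (label G) p) = \<one>\<^bsub>C\<^esub>"

definition idempath_identification ::
  "('c, 'd) monoid_scheme \<Rightarrow> ('x \<Rightarrow> 'c) \<Rightarrow> ('v, 'e, 'x) xgraph \<Rightarrow> ('v, 'e, 'x) xgraph \<Rightarrow> bool" where
  "idempath_identification C \<gamma> G H \<longleftrightarrow> (\<exists>u p v. idempath C \<gamma> G u p v \<and> H = identify u v G)"

definition descendant ::
  "('c, 'd) monoid_scheme \<Rightarrow> ('x \<Rightarrow> 'c) \<Rightarrow> ('v, 'e, 'x) xgraph \<Rightarrow> ('v, 'e, 'x) xgraph \<Rightarrow> bool" where
  "descendant C \<gamma> = (idempath_identification C \<gamma>)\<^sup>*\<^sup>*"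

definition idempath_identified ::
  "('c, 'd) monoid_scheme \<Rightarrow> ('x \<Rightarrow> 'c) \<Rightarrow> ('v, 'e, 'x) xgraph \<Rightarrow> bool" where
  "idempath_identified C \<gamma> G \<longleftrightarrow> (\<forall>u p v. idempath C \<gamma> G u p v \<longrightarrow> u = v)"

text \<open>The idempath identified descendant; the choice only affects the names of merged vertices.\<close>
definition closure ::
  "('c, 'd) monoid_scheme \<Rightarrow> ('x \<Rightarrow> 'c) \<Rightarrow> ('v, 'e, 'x) xgraph \<Rightarrow> ('v, 'e, 'x) xgraph" where
  "closure C \<gamma> G = (SOME H. descendant C \<gamma> G H \<and> idempath_identified C \<gamma> H)"


section \<open>The pretzel monoid\<close>

definition xsum ::
  "('v, 'e, 'x) xgraph \<Rightarrow> ('w, 'f, 'x) xgraph \<Rightarrow> ('v + 'w, 'e + 'f, 'x) xgraph" where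
  "xsum G H =
     \<lparr>dg = \<lparr>verts = Verts G <+> Verts H, arcs = Arcs G <+> Arcs H,
            tail = map_sum (tail (dg G)) (tail (dg H)), head = map_sum (head (dg G)) (head (dg H))\<rparr>,
      label = case_sum (label G) (label H), start = Inl (start G), finish = Inr (finish H)\<rparr>"

definition xproduct ::
  "('v, 'e, 'x) xgraph \<Rightarrow> ('w, 'f, 'x) xgraph \<Rightarrow> ('v + 'w, 'e + 'f, 'x) xgraph" where
  "xproduct G H = identify (Inl (finish G)) (Inr (start H)) (xsum G H)"

definition xplus :: "('v, 'e, 'x) xgraph \<Rightarrow> ('v, 'e, 'x) xgraph" where
  "xplus G = G\<lparr>finish := start G\<rparr>"

definition xone :: "(unit, unit, 'x) xgraph" where
  "xone =
     \<lparr>dg = \<lparr>verts = {()}, arcs = {}, tail = (\<lambda>_. ()), head = (\<lambda>_. ())\<rparr>,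
      label = undefined, start = (), finish = ()\<rparr>"

definition FLAd :: "'x set \<Rightarrow> (nat, nat, 'x) xgraph set set" where
  "FLAd X = {iso_class (T :: (nat, nat, 'x) xgraph) | T. is_xtree X T \<and> retracted T}"

definition rep :: "(nat, nat, 'x) xgraph set \<Rightarrow> (nat, nat, 'x) xgraph" where
  "rep S = (SOME G. G \<in> S)"

definition pretzel ::
  "('c, 'd) monoid_scheme \<Rightarrow> ('x \<Rightarrow> 'c) \<Rightarrow> ('v, 'e, 'x) xgraph \<Rightarrow> (nat, nat, 'x) xgraph set" where
  "pretzel C \<gamma> G = iso_class (core (closure C \<gamma> G))"

definition PT ::
  "('c, 'd) monoid_scheme \<Rightarrow> ('x \<Rightarrow> 'c) \<Rightarrow> 'x set \<Rightarrow> (nat, nat, 'x) xgraph set alg210" where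
  "PT C \<gamma> X =
     \<lparr>carrier = (\<lambda>S. pretzel C \<gamma> (rep S)) ` FLAd X,
      mult = (\<lambda>S T. pretzel C \<gamma> (xproduct (rep S) (rep T))),
      one = iso_class xone,
      plus_op = (\<lambda>S. pretzel C \<gamma> (xplus (rep S)))\<rparr>"

end

theory Submission
  imports Defs
begin

text \<open>
  Both algebras are images of the algebra of \<open>(2,1,0)\<close>-terms over \<open>X\<close>: a term is sent to the
  presented monoid by evaluation, and to the pretzel monoid by drawing its tree, identifying
  idempaths and passing to the retracted image. So it is enough that the two maps are onto and have
  the same kernel.

  A term is read as a binary relation on the vertices of a graph, with \<open>Plus\<close> as the restriction of
  the identity to the domain. The tree of \<open>t\<close> maps into \<open>H\<close>, with ends \<open>a\<close> and \<open>b\<close>, exactly when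
  \<open>a\<close> and \<open>b\<close> are related by \<open>t\<close> in \<open>H\<close>. Since retracted images are determined by morphisms in
  both directions, and a morphism into an identified graph factors through the closure, two terms
  have the same pretzel graph exactly when they denote the same relation in every idempath
  identified graph (\<open>pretzel_tree_eq_iff\<close>).

  Soundness: the quotient by this kernel is left adequate and satisfies the relations
  (\<open>left_adequate_of_kernel_sim\<close>, \<open>idempath_relations_sim\<close>). Most laws are identities of relations.
  The others use two facts on descendants of trees (\<open>descendant_invariants\<close>): any two vertices from
  which a third one can be reached are comparable by reachability, and the value in \<open>C\<close> of a walk
  depends only on its ends. They are preserved by an identification because a one-sided inverse in a
  right cancellative monoid is two-sided.

  Completeness: let \<open>M\<close> be a left adequate monoid in which every word of value \<open>1\<close> in \<open>C\<close> is
  idempotent. Then every product obtained from such a word by inserting idempotents is idempotent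
  too (\<open>decorated_val_idempotent\<close>). The vertices of a graph are decorated with idempotents of \<open>M\<close>
  that lie below what can be read along the edges. In a descendant of a tree the product along a
  decorated walk depends only on its ends (\<open>descendant_functional\<close>), and each descendant of the tree
  of \<open>t\<close> has a greatest decoration, for which the product from the start vertex to the finish vertex
  is the value of \<open>t\<close> in \<open>M\<close> (\<open>ex_greatest_descendant\<close>). If two terms have isomorphic retracted
  images, their greatest decorations agree there, and hence so do their values
  (\<open>mval_eq_of_sim\<close>).
\<close>

section \<open>Left adequate monoids\<close>

locale left_adequate_monoid =
  fixes M :: "'a alg210" (structure)
  assumes left_adequate: "left_adequate M"
begin

sublocale monoid M
  using left_adequate by (simp add: left_adequate_def)

abbreviation "E \<equiv> idempotents M"
abbreviation "pl \<equiv> plus_op M"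

lemma idem_carrier: "e \<in> E \<Longrightarrow> e \<in> carrier M"
  by (simp add: idempotents_def)

lemma idem_sq: "e \<in> E \<Longrightarrow> e \<otimes> e = e"
  by (simp add: idempotents_def)

lemma idem_comm: "e \<in> E \<Longrightarrow> f \<in> E \<Longrightarrow> e \<otimes> f = f \<otimes> e"
  using left_adequate by (simp add: left_adequate_def)

lemma plus_in_idem: "a \<in> carrier M \<Longrightarrow> pl a \<in> E"
  using left_adequate by (simp add: left_adequate_def)

lemma plus_carrier: "a \<in> carrier M \<Longrightarrow> pl a \<in> carrier M"
  by (simp add: plus_in_idem idem_carrier)

lemma Rstar_plus: "a \<in> carrier M \<Longrightarrow> Rstar M a (pl a)"
  using left_adequate by (simp add: left_adequate_def)

lemma one_idem: "\<one> \<in> E"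
  by (simp add: idempotents_def)

lemma idem_mult: "e \<in> E \<Longrightarrow> f \<in> E \<Longrightarrow> e \<otimes> f \<in> E"
  using idem_comm[of e f] idem_comm[of f "e \<otimes> f"]
  apply (simp add: idempotents_def m_assoc)
  apply (metis m_assoc)
  done

lemma idem_mult_absorb: "e \<in> E \<Longrightarrow> a \<in> carrier M \<Longrightarrow> e \<otimes> (e \<otimes> a) = e \<otimes> a"
  by (metis idem_carrier idem_sq m_assoc)

lemma RstarD:
  "Rstar M a b \<Longrightarrow> x \<in> carrier M \<Longrightarrow> y \<in> carrier M \<Longrightarrow> x \<otimes> a = y \<otimes> a \<longleftrightarrow> x \<otimes> b = y \<otimes> b"
  by (simp add: Rstar_def)

lemma plus_left: "a \<in> carrier M \<Longrightarrow> pl a \<otimes> a = a"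
  using RstarD[OF Rstar_plus[of a], of "pl a" \<one>] idem_sq[OF plus_in_idem, of a] plus_carrier[of a]
  by simp

lemma Rstar_idem_unique:
  assumes "e \<in> E" "f \<in> E" "Rstar M e f" shows "e = f"
proof -
  have c: "e \<in> carrier M" "f \<in> carrier M" using assms by (auto simp: idem_carrier)
  have "e \<otimes> f = \<one> \<otimes> f" using RstarD[OF assms(3), of e \<one>] c assms idem_sq[of e] by simp
  moreover have "f \<otimes> e = \<one> \<otimes> e" using RstarD[OF assms(3), of f \<one>] c assms idem_sq[of f] by simp
  ultimately show ?thesis using idem_comm[of e f] assms c by simp
qed

lemma plus_eqI:
  assumes "a \<in> carrier M" "b \<in> carrier M" "Rstar M a b" shows "pl a = pl b"
  using assms Rstar_plus[of a] Rstar_plus[of b]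
  by (intro Rstar_idem_unique) (auto simp: plus_in_idem Rstar_def)

lemma plus_idem: "e \<in> E \<Longrightarrow> pl e = e"
  using Rstar_plus[of e] by (intro Rstar_idem_unique) (auto simp: plus_in_idem idem_carrier Rstar_def)

lemma plus_mult:
  assumes "a \<in> carrier M" "b \<in> carrier M" shows "pl (a \<otimes> b) = pl (a \<otimes> pl b)"
proof (rule plus_eqI)
  show "Rstar M (a \<otimes> b) (a \<otimes> pl b)"
    using Rstar_plus[of b] assms plus_carrier[of b]
    by (simp add: Rstar_def m_assoc[symmetric])
qed (use assms plus_carrier in auto)

lemma plus_idem_mult:
  assumes "e \<in> E" "a \<in> carrier M" shows "pl (e \<otimes> a) = e \<otimes> pl a"
  using plus_mult[of e a] plus_idem[of "e \<otimes> pl a"] idem_mult plus_in_idem assms idem_carrier by auto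

text \<open>
  For an idempotent \<open>e\<close>, the inequality \<open>a\<^sup>+ \<le> e\<close> in the semilattice of idempotents says that \<open>e\<close>
  fixes \<open>a\<close> from the left; inequalities between idempotents are stated in this form below, so that
  they can be used for rewriting.
\<close>
lemma absorb_iff_plus:
  assumes "e \<in> E" "a \<in> carrier M" shows "e \<otimes> a = a \<longleftrightarrow> e \<otimes> pl a = pl a"
proof
  assume "e \<otimes> a = a"
  then show "e \<otimes> pl a = pl a" using plus_idem_mult[OF assms] by simp
next
  assume "e \<otimes> pl a = pl a"
  then show "e \<otimes> a = a" using plus_left[of a] assms m_assoc[of e "pl a" a]
    by (simp add: idem_carrier plus_carrier)
qed

lemma absorb_trans:
  assumes "e \<in> E" "f \<in> E" "a \<in> carrier M" "e \<otimes> f = f" "f \<otimes> a = a" shows "e \<otimes> a = a"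
  using assms by (metis idem_carrier m_assoc)

lemma absorb_mult_right:
  assumes "e \<in> E" "a \<in> carrier M" "b \<in> carrier M" "e \<otimes> a = a" shows "e \<otimes> (a \<otimes> b) = a \<otimes> b"
  using assms by (metis idem_carrier m_assoc)

lemma plus_absorb_mult:
  assumes "a \<in> carrier M" "b \<in> carrier M" shows "pl a \<otimes> pl (a \<otimes> b) = pl (a \<otimes> b)"
  using absorb_iff_plus[of "pl a" "a \<otimes> b"] absorb_mult_right[of "pl a" a b] assms
  by (simp add: plus_in_idem plus_left)

lemma plus_mono:
  assumes "a \<in> carrier M" "e \<in> E" "f \<in> E" "e \<otimes> f = f"
  shows "pl (a \<otimes> e) \<otimes> pl (a \<otimes> f) = pl (a \<otimes> f)"
  using plus_absorb_mult[of "a \<otimes> e" f] assms by (simp add: idem_carrier m_assoc)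

lemma idem_antisym:
  assumes "e \<in> E" "f \<in> E" "e \<otimes> f = f" "f \<otimes> e = e" shows "e = f"
  using assms idem_comm by metis

end


section \<open>Quotients and homomorphisms\<close>

definition alg_hom :: "'a alg210 \<Rightarrow> 'b alg210 \<Rightarrow> ('a \<Rightarrow> 'b) \<Rightarrow> bool" where
  "alg_hom A B h \<longleftrightarrow> h ` carrier A \<subseteq> carrier B \<and> h \<one>\<^bsub>A\<^esub> = \<one>\<^bsub>B\<^esub> \<and>
     (\<forall>a\<in>carrier A. \<forall>b\<in>carrier A. h (a \<otimes>\<^bsub>A\<^esub> b) = h a \<otimes>\<^bsub>B\<^esub> h b) \<and>
     (\<forall>a\<in>carrier A. h (plus_op A a) = plus_op B (h a))"

lemma alg_hom_comp:
  assumes "alg_hom A B g" "alg_hom B C h" shows "alg_hom A C (\<lambda>a. h (g a))"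
  using assms unfolding alg_hom_def by (auto simp: image_subset_iff)

lemma alg_hom_quotient:
  assumes A: "closed_alg A" and r: "congruence A r"
  shows "alg_hom A (quotient_alg A r) (\<lambda>a. r `` {a})"
    and "(\<lambda>a. r `` {a}) ` carrier A = carrier (quotient_alg A r)"
    and "a \<in> carrier A \<Longrightarrow> b \<in> carrier A \<Longrightarrow> r `` {a} = r `` {b} \<longleftrightarrow> (a, b) \<in> r"
proof -
  have eq: "equiv (carrier A) r" using r by (simp add: congruence_def)
  note cls = equiv_class_eq_iff[OF eq]
  have sub: "x \<in> carrier A" "y \<in> carrier A" if "(x, y) \<in> r" for x y
    using that eq by (auto dest: equiv_type)
  show "(\<lambda>a. r `` {a}) ` carrier A = carrier (quotient_alg A r)"
    by (auto simp: quotient_alg_def quotient_def)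
  show "a \<in> carrier A \<Longrightarrow> b \<in> carrier A \<Longrightarrow> r `` {a} = r `` {b} \<longleftrightarrow> (a, b) \<in> r"
    using eq by (simp add: eq_equiv_class_iff)
  have const: "(\<Union>x\<in>r `` {a}. r `` {f x}) = r `` {f a}"
    if "a \<in> carrier A" "\<And>x. (a, x) \<in> r \<Longrightarrow> (f a, f x) \<in> r" for f a
  proof -
    have "r `` {f x} = r `` {f a}" if "x \<in> r `` {a}" for x
      using that \<open>\<And>x. (a, x) \<in> r \<Longrightarrow> (f a, f x) \<in> r\<close> cls by blast
    moreover have "a \<in> r `` {a}" using equiv_class_self[OF eq that(1)] .
    ultimately show ?thesis by blast
  qed
  have pl: "(plus_op A a, plus_op A x) \<in> r" if "(a, x) \<in> r" for a x
    using that r by (auto simp: congruence_def)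
  have mu: "(a \<otimes>\<^bsub>A\<^esub> b, x \<otimes>\<^bsub>A\<^esub> y) \<in> r" if "(a, x) \<in> r" "(b, y) \<in> r" for a b x y
    using that r by (fastforce simp: congruence_def)
  have refl: "(a, a) \<in> r" if "a \<in> carrier A" for a
    using that eq by (auto simp: equiv_def refl_on_def)
  have "(\<Union>x\<in>r `` {a}. \<Union>y\<in>r `` {b}. r `` {x \<otimes>\<^bsub>A\<^esub> y}) = r `` {a \<otimes>\<^bsub>A\<^esub> b}"
    if ab: "a \<in> carrier A" "b \<in> carrier A" for a b
  proof -
    have "(\<Union>y\<in>r `` {b}. r `` {x \<otimes>\<^bsub>A\<^esub> y}) = r `` {x \<otimes>\<^bsub>A\<^esub> b}" if "x \<in> r `` {a}" for x
      using that ab by (intro const) (auto intro: mu refl sub)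
    then have "(\<Union>x\<in>r `` {a}. \<Union>y\<in>r `` {b}. r `` {x \<otimes>\<^bsub>A\<^esub> y}) = (\<Union>x\<in>r `` {a}. r `` {x \<otimes>\<^bsub>A\<^esub> b})"
      by simp
    also have "\<dots> = r `` {a \<otimes>\<^bsub>A\<^esub> b}" using ab by (intro const) (auto intro: mu refl)
    finally show ?thesis .
  qed
  moreover have "(\<Union>x\<in>r `` {a}. r `` {plus_op A x}) = r `` {plus_op A a}" if "a \<in> carrier A" for a
    using that pl by (intro const) auto
  ultimately show "alg_hom A (quotient_alg A r) (\<lambda>a. r `` {a})"
    unfolding alg_hom_def by (auto simp: quotient_alg_def quotientI)
qed

lemma closed_hom_image:
  assumes "closed_alg A" "alg_hom A B h" "h ` carrier A = carrier B" shows "closed_alg B"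
proof -
  have B: "carrier B = h ` carrier A" using assms(3) by simp
  show ?thesis using assms(1,2) unfolding closed_alg_def alg_hom_def B
    by (auto simp flip: alg_hom_def) (metis image_eqI)+
qed

text \<open>A single member of the intersected family is needed, to keep the intersection inside the carrier.\<close>
lemma lad_congruence_congruence:
  assumes "congruence A r" "R \<subseteq> r" "left_adequate (quotient_alg A r)"
  shows "congruence A (lad_congruence A R)" "lad_congruence A R \<subseteq> r" "R \<subseteq> lad_congruence A R"
proof -
  let ?F = "{r. congruence A r \<and> R \<subseteq> r \<and> left_adequate (quotient_alg A r)}"
  have r: "r \<in> ?F" using assms by simp
  show "lad_congruence A R \<subseteq> r" unfolding lad_congruence_def by (rule Inter_lower[OF r])
  show "R \<subseteq> lad_congruence A R" unfolding lad_congruence_def by (rule Inter_greatest) simp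
  have c: "\<And>s. s \<in> ?F \<Longrightarrow> congruence A s" by simp
  have "equiv (carrier A) (\<Inter>?F)"
  proof (rule equivI)
    show "refl_on (carrier A) (\<Inter>?F)"
      using c by (auto simp: refl_on_def congruence_def equiv_def)
    show "\<Inter>?F \<subseteq> carrier A \<times> carrier A"
      using r c[OF r] by (intro order_trans[OF Inter_lower[OF r]]) (auto simp: congruence_def dest: equiv_type)
    show "sym (\<Inter>?F)" using c by (auto simp: sym_def congruence_def equiv_def)
    show "trans (\<Inter>?F)" using c unfolding trans_def congruence_def equiv_def by blast
  qed
  moreover have "(a \<otimes>\<^bsub>A\<^esub> b, a' \<otimes>\<^bsub>A\<^esub> b') \<in> \<Inter>?F" if "(a, a') \<in> \<Inter>?F" "(b, b') \<in> \<Inter>?F" for a a' b b'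
  proof (rule InterI)
    fix s assume s: "s \<in> ?F"
    then have "(a, a') \<in> s" "(b, b') \<in> s" using that by blast+
    then show "(a \<otimes>\<^bsub>A\<^esub> b, a' \<otimes>\<^bsub>A\<^esub> b') \<in> s"
      using c[OF s] unfolding congruence_def by blast
  qed
  moreover have "(plus_op A a, plus_op A a') \<in> \<Inter>?F" if "(a, a') \<in> \<Inter>?F" for a a'
  proof (rule InterI)
    fix s assume s: "s \<in> ?F"
    then have "(a, a') \<in> s" using that by blast
    then show "(plus_op A a, plus_op A a') \<in> s"
      using c[OF s] unfolding congruence_def by blast
  qed
  ultimately show "congruence A (lad_congruence A R)"
    unfolding lad_congruence_def[symmetric] congruence_def[of A "lad_congruence A R"] by blast
qed

text \<open>
  The pretzel monoid and the presented monoid are both images of the term algebra, so comparing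
  kernels there avoids constructing a map between them.
\<close>
lemma alg_isomorphic_same_kernel:
  assumes A: "closed_alg A"
    and g: "alg_hom A B g" "g ` carrier A = carrier B"
    and h: "alg_hom A C h" "h ` carrier A = carrier C"
    and ker: "\<And>a b. a \<in> carrier A \<Longrightarrow> b \<in> carrier A \<Longrightarrow> g a = g b \<longleftrightarrow> h a = h b"
  shows "alg_isomorphic B C"
proof -
  define k where "k = (\<lambda>y. h (inv_into (carrier A) g y))"
  have kg: "k (g a) = h a" if "a \<in> carrier A" for a
  proof -
    have "inv_into (carrier A) g (g a) \<in> carrier A" "g (inv_into (carrier A) g (g a)) = g a"
      using that by (auto intro: inv_into_into f_inv_into_f)
    then show ?thesis unfolding k_def using ker that by blast
  qed
  have B: "carrier B = g ` carrier A" and C: "carrier C = h ` carrier A" using g h by auto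
  have "inj_on k (carrier B)" unfolding B by (auto simp: inj_on_def kg ker)
  moreover have "k ` carrier B = carrier C" unfolding B C by (auto simp: kg image_iff)
  moreover have "k (x \<otimes>\<^bsub>B\<^esub> y) = k x \<otimes>\<^bsub>C\<^esub> k y" if xy: "x \<in> carrier B" "y \<in> carrier B" for x y
  proof -
    obtain a b where ab: "a \<in> carrier A" "b \<in> carrier A" "x = g a" "y = g b" using xy unfolding B by blast
    then have "x \<otimes>\<^bsub>B\<^esub> y = g (a \<otimes>\<^bsub>A\<^esub> b)" using g by (simp add: alg_hom_def)
    then show ?thesis using ab A h by (simp add: kg alg_hom_def closed_alg_def)
  qed
  moreover have "k (plus_op B x) = plus_op C (k x)" if xy: "x \<in> carrier B" for x
  proof -
    obtain a where ab: "a \<in> carrier A" "x = g a" using xy unfolding B by blast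
    then have "plus_op B x = g (plus_op A a)" using g by (simp add: alg_hom_def)
    then show ?thesis using ab A h by (simp add: kg alg_hom_def closed_alg_def)
  qed
  moreover have "k \<one>\<^bsub>B\<^esub> = \<one>\<^bsub>C\<^esub>"
    using kg[of "\<one>\<^bsub>A\<^esub>"] A g h by (simp add: alg_hom_def closed_alg_def)
  moreover have "closed_alg B" "closed_alg C" using closed_hom_image A g h by blast+
  ultimately show ?thesis unfolding alg_isomorphic_def iso_def hom_def bij_betw_def
    by (intro conjI bexI[of _ k]) auto
qed

text \<open>
  Left adequacy is stated on representatives, so that it can be checked for terms instead of
  congruence classes.
\<close>
lemma left_adequate_hom_image:
  assumes A: "closed_alg A"
    and h: "alg_hom A B h" "h ` carrier A = carrier B"
    and assoc: "\<And>a b c. a \<in> carrier A \<Longrightarrow> b \<in> carrier A \<Longrightarrow> c \<in> carrier A \<Longrightarrow>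
      h ((a \<otimes>\<^bsub>A\<^esub> b) \<otimes>\<^bsub>A\<^esub> c) = h (a \<otimes>\<^bsub>A\<^esub> (b \<otimes>\<^bsub>A\<^esub> c))"
    and unit: "\<And>a. a \<in> carrier A \<Longrightarrow> h (\<one>\<^bsub>A\<^esub> \<otimes>\<^bsub>A\<^esub> a) = h a"
      "\<And>a. a \<in> carrier A \<Longrightarrow> h (a \<otimes>\<^bsub>A\<^esub> \<one>\<^bsub>A\<^esub>) = h a"
    and idem: "\<And>a. a \<in> carrier A \<Longrightarrow> h (plus_op A a \<otimes>\<^bsub>A\<^esub> plus_op A a) = h (plus_op A a)"
    and comm: "\<And>a b. a \<in> carrier A \<Longrightarrow> b \<in> carrier A \<Longrightarrow> h (a \<otimes>\<^bsub>A\<^esub> a) = h a \<Longrightarrow>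
      h (b \<otimes>\<^bsub>A\<^esub> b) = h b \<Longrightarrow> h (a \<otimes>\<^bsub>A\<^esub> b) = h (b \<otimes>\<^bsub>A\<^esub> a)"
    and rstar: "\<And>a x y. a \<in> carrier A \<Longrightarrow> x \<in> carrier A \<Longrightarrow> y \<in> carrier A \<Longrightarrow>
      h (x \<otimes>\<^bsub>A\<^esub> a) = h (y \<otimes>\<^bsub>A\<^esub> a) \<longleftrightarrow> h (x \<otimes>\<^bsub>A\<^esub> plus_op A a) = h (y \<otimes>\<^bsub>A\<^esub> plus_op A a)"
  shows "left_adequate B"
proof -
  have c: "\<one>\<^bsub>A\<^esub> \<in> carrier A" "\<And>a. a \<in> carrier A \<Longrightarrow> plus_op A a \<in> carrier A"
    "\<And>a b. a \<in> carrier A \<Longrightarrow> b \<in> carrier A \<Longrightarrow> a \<otimes>\<^bsub>A\<^esub> b \<in> carrier A"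
    using A by (auto simp: closed_alg_def)
  have B: "carrier B = h ` carrier A" using h by simp
  have hm: "h a \<otimes>\<^bsub>B\<^esub> h b = h (a \<otimes>\<^bsub>A\<^esub> b)" "plus_op B (h a) = h (plus_op A a)" "\<one>\<^bsub>B\<^esub> = h \<one>\<^bsub>A\<^esub>"
    if "a \<in> carrier A" "b \<in> carrier A" for a b
    using that h by (simp_all add: alg_hom_def)
  have one: "\<one>\<^bsub>B\<^esub> = h \<one>\<^bsub>A\<^esub>" using h by (simp add: alg_hom_def)
  have mon: "monoid B"
    by unfold_locales (auto simp: B hm one c assoc unit)
  have pl: "plus_op B a \<in> idempotents B \<and> Rstar B a (plus_op B a)" if "a \<in> carrier B" for a
    using that by (auto simp: B hm c idem rstar idempotents_def Rstar_def)
  have "e \<otimes>\<^bsub>B\<^esub> f = f \<otimes>\<^bsub>B\<^esub> e" if "e \<in> idempotents B" "f \<in> idempotents B" for e f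
    using that by (auto simp: idempotents_def B hm c intro!: comm)
  then show ?thesis using mon pl unfolding left_adequate_def by blast
qed


section \<open>Morphisms of labelled graphs and the relational meaning of terms\<close>

abbreviation "wfg G \<equiv> wf_digraph (dg G)"
abbreviation "reach G \<equiv> reachable (dg G)"
abbreviation "src G \<equiv> tail (dg G)"
abbreviation "tgt G \<equiv> head (dg G)"

definition maps_to :: "('v, 'e, 'x) xgraph \<Rightarrow> ('w, 'f, 'x) xgraph \<Rightarrow> bool" where
  "maps_to G H \<longleftrightarrow> (\<exists>f g. morphism G H f g)"

definition ends :: "('v, 'e, 'x) xgraph \<Rightarrow> 'v \<Rightarrow> 'v \<Rightarrow> ('v, 'e, 'x) xgraph" where
  "ends G a b = G\<lparr>start := a, finish := b\<rparr>"

lemma ends_simps [simp]: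
  "dg (ends G a b) = dg G" "label (ends G a b) = label G"
  "start (ends G a b) = a" "finish (ends G a b) = b"
  by (simp_all add: ends_def)

lemma is_xgraphD:
  assumes "is_xgraph X G"
  shows "wfg G" "finite (Verts G)" "finite (Arcs G)" "start G \<in> Verts G" "finish G \<in> Verts G"
    "label G ` Arcs G \<subseteq> X" "\<And>v. v \<in> Verts G \<Longrightarrow> reach G (start G) v"
  using assms unfolding is_xgraph_def fin_digraph_def fin_digraph_axioms_def by auto

lemma morphismD:
  assumes "morphism G H f g"
  shows "v \<in> Verts G \<Longrightarrow> f v \<in> Verts H" "e \<in> Arcs G \<Longrightarrow> g e \<in> Arcs H"
    "f (start G) = start H" "f (finish G) = finish H"
    "e \<in> Arcs G \<Longrightarrow> label H (g e) = label G e"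
    "e \<in> Arcs G \<Longrightarrow> src H (g e) = f (src G e)"
    "e \<in> Arcs G \<Longrightarrow> tgt H (g e) = f (tgt G e)"
  using assms unfolding morphism_def by auto

lemma morphism_comp:
  assumes "morphism G H f g" "morphism H K f' g'"
  shows "morphism G K (f' \<circ> f) (g' \<circ> g)"
  using assms unfolding morphism_def by (simp add: image_subset_iff)

lemma maps_to_trans: "maps_to G H \<Longrightarrow> maps_to H K \<Longrightarrow> maps_to G K"
  unfolding maps_to_def using morphism_comp by blast

lemma maps_to_refl: "maps_to G G"
  unfolding maps_to_def morphism_def by (intro exI[of _ id]) auto

lemma reach_morphism:
  assumes "morphism G H f g" "wfg G" "wfg H" "reach G a b"
  shows "reach H (f a) (f b)"
proof -
  interpret G: wf_digraph "dg G" by fact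
  interpret H: wf_digraph "dg H" by fact
  show ?thesis using assms(4)
  proof (induction rule: G.reachable_induct)
    case base
    then show ?case using morphismD(1)[OF assms(1)] by auto
  next
    case (step x y)
    then obtain e where "e \<in> Arcs G" "src G e = x" "tgt G e = y" by auto
    then have "(f x, f y) \<in> arcs_ends (dg H)"
      using morphismD(2,5-7)[OF assms(1)] H.in_arcs_imp_in_arcs_ends[of "g e"] by auto
    with step show ?case by (meson H.reachable_adj_trans)
  qed
qed

text \<open>
  Subgraphs onto which a graph retracts, quotients by identifying vertices and isomorphic copies are
  all images of the original graph, so one argument shows that they are again graphs of the
  required kind.
\<close>
lemma is_xgraph_image:
  assumes "is_xgraph X G" "morphism G H f g" "f ` Verts G = Verts H" "g ` Arcs G = Arcs H"
  shows "is_xgraph X H"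
proof -
  note G = is_xgraphD[OF assms(1)] and m = morphismD[OF assms(2)]
  interpret G: wf_digraph "dg G" by fact
  have ar: "\<exists>e'\<in>Arcs G. e = g e'" if "e \<in> Arcs H" for e using that assms(4) by auto
  have wf: "wfg H"
  proof
    fix e assume "e \<in> Arcs H"
    then obtain e' where "e' \<in> Arcs G" "e = g e'" using ar by blast
    then show "src H e \<in> Verts H" "tgt H e \<in> Verts H" using m by auto
  qed
  moreover have "finite (Verts H)" "finite (Arcs H)" using assms(3,4) G(2,3) by (metis finite_imageI)+
  moreover have "label H ` Arcs H \<subseteq> X" using G(6) m(5) ar by fastforce
  moreover have "reach H (start H) v" if v: "v \<in> Verts H" for v
  proof -
    obtain w where "w \<in> Verts G" "v = f w" using v assms(3) by blast
    then show ?thesis using reach_morphism[OF assms(2) G(1) wf G(7)] m(3) by metis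
  qed
  moreover have "start H \<in> Verts H" "finish H \<in> Verts H" using m(1)[OF G(4)] m(1)[OF G(5)] m(3,4) by auto
  ultimately show ?thesis unfolding is_xgraph_def by (auto intro: wf_digraph.fin_digraphI)
qed

lemma xisomorphic_maps_to: "xisomorphic G H \<Longrightarrow> maps_to G H"
  unfolding xisomorphic_def maps_to_def by blast

lemma xisomorphic_is_xgraph: "xisomorphic G H \<Longrightarrow> is_xgraph X G \<Longrightarrow> is_xgraph X H"
  unfolding xisomorphic_def bij_betw_def by (auto intro: is_xgraph_image)

lemma xisomorphic_trans: "xisomorphic G H \<Longrightarrow> xisomorphic H K \<Longrightarrow> xisomorphic G K"
  unfolding xisomorphic_def by (meson morphism_comp bij_betw_trans)

lemma xisomorphic_inverse:
  assumes "morphism G H f g" "bij_betw f (Verts G) (Verts H)" "bij_betw g (Arcs G) (Arcs H)" "is_xgraph X G"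
  shows "morphism H G (inv_into (Verts G) f) (inv_into (Arcs G) g)"
proof -
  note m = morphismD[OF assms(1)] and G = is_xgraphD[OF assms(4)]
  interpret G: wf_digraph "dg G" by (rule G)
  have f: "inv_into (Verts G) f (f v) = v" if "v \<in> Verts G" for v
    using assms(2) that by (simp add: bij_betw_inv_into_left)
  have g: "inv_into (Arcs G) g (g e) = e" if "e \<in> Arcs G" for e
    using assms(3) that by (simp add: bij_betw_inv_into_left)
  have V: "Verts H = f ` Verts G" and A: "Arcs H = g ` Arcs G"
    using assms(2,3) by (auto simp: bij_betw_def)
  show ?thesis unfolding morphism_def V A
    using m(5-7) f[OF G(4)] f[OF G(5)] by (auto simp: f g m(3,4))
qed

lemma xisomorphic_sym:
  assumes "xisomorphic G H" "is_xgraph X G" shows "xisomorphic H G"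
proof -
  obtain f g where "morphism G H f g" "bij_betw f (Verts G) (Verts H)" "bij_betw g (Arcs G) (Arcs H)"
    using assms(1) by (auto simp: xisomorphic_def)
  then show ?thesis unfolding xisomorphic_def
    using xisomorphic_inverse[OF _ _ _ assms(2)] bij_betw_inv_into by metis
qed

lemma xisomorphic_nat:
  fixes G :: "('v, 'e, 'x) xgraph"
  assumes "is_xgraph X G" obtains H :: "(nat, nat, 'x) xgraph" where "xisomorphic G H"
proof -
  note G = is_xgraphD[OF assms]
  interpret G: wf_digraph "dg G" by (rule G)
  obtain f :: "'v \<Rightarrow> nat" where f: "inj_on f (Verts G)"
    using finite_imp_inj_to_nat_seg[OF G(2)] by blast
  obtain g :: "'e \<Rightarrow> nat" where g: "inj_on g (Arcs G)"
    using finite_imp_inj_to_nat_seg[OF G(3)] by blast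
  let ?i = "inv_into (Arcs G) g"
  let ?H = "\<lparr>dg = \<lparr>verts = f ` Verts G, arcs = g ` Arcs G, tail = f \<circ> src G \<circ> ?i,
    head = f \<circ> tgt G \<circ> ?i\<rparr>, label = label G \<circ> ?i, start = f (start G), finish = f (finish G)\<rparr>"
  have "morphism G ?H f g" unfolding morphism_def using g by (auto simp: inv_into_f_f)
  then have "xisomorphic G ?H" unfolding xisomorphic_def using f g
    by (intro exI[of _ f] exI[of _ g]) (auto simp: bij_betw_def)
  then show ?thesis by (rule that)
qed

lemma iso_class_eqI:
  assumes "xisomorphic G H" "is_xgraph X G" shows "iso_class G = iso_class H"
  using xisomorphic_trans[OF assms(1)] xisomorphic_trans[OF xisomorphic_sym[OF assms]]
  unfolding iso_class_def by blast

lemma iso_class_eqD: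
  fixes G :: "('v, 'e, 'x) xgraph" and H :: "('w, 'f, 'x) xgraph"
  assumes "iso_class G = iso_class H" "is_xgraph X G" "is_xgraph X H" shows "xisomorphic G H"
proof -
  obtain K :: "(nat, nat, 'x) xgraph" where K: "xisomorphic G K" using xisomorphic_nat[OF assms(2)] .
  then have "xisomorphic H K" using assms(1) unfolding iso_class_def by auto
  then show ?thesis using xisomorphic_trans[OF K] xisomorphic_sym[OF _ assms(3)] by blast
qed

lemma xisomorphic_rep:
  fixes G :: "('v, 'e, 'x) xgraph"
  assumes "is_xgraph X G" shows "xisomorphic G (rep (iso_class G))"
proof -
  obtain K :: "(nat, nat, 'x) xgraph" where "xisomorphic G K" using xisomorphic_nat[OF assms] .
  then have "rep (iso_class G) \<in> iso_class G" unfolding rep_def iso_class_def by (auto intro: someI)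
  then show ?thesis by (simp add: iso_class_def)
qed

text \<open>
  A term is read as a binary relation on the vertices of a graph: the generators are the edges,
  multiplication is composition, and \<open>Plus\<close> restricts the identity to the domain of a relation.
  A pair of vertices lies in the meaning of a term exactly when the tree of the term maps into the
  graph with this pair as ends, which turns most questions on morphisms into computations with
  relations.
\<close>
primrec sem :: "('v, 'e, 'x) xgraph \<Rightarrow> 'x lad_term \<Rightarrow> 'v \<Rightarrow> 'v \<Rightarrow> bool" where
  "sem G (Gen x) = (\<lambda>a b. \<exists>e\<in>Arcs G. src G e = a \<and> tgt G e = b \<and> label G e = x)"
| "sem G Unit = (\<lambda>a b. a \<in> Verts G \<and> a = b)"
| "sem G (Mul s t) = (\<lambda>a b. \<exists>c. sem G s a c \<and> sem G t c b)"
| "sem G (Plus s) = (\<lambda>a b. a = b \<and> (\<exists>c. sem G s a c))"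

lemma sem_ends [simp]: "sem (ends G a b) t = sem G t"
  by (induction t) auto

lemma sem_in_verts:
  assumes "wfg G" "sem G t a b" shows "a \<in> Verts G" "b \<in> Verts G"
proof -
  have "a \<in> Verts G \<and> b \<in> Verts G" using assms(2)
    by (induction t arbitrary: a b) (auto simp: wf_digraph.wellformed[OF assms(1)])
  then show "a \<in> Verts G" "b \<in> Verts G" by auto
qed

lemma sem_morphism:
  assumes "morphism G H f g" "sem G t a b" shows "sem H t (f a) (f b)"
  using assms(2)
proof (induction t arbitrary: a b)
  case (Gen x)
  then obtain e where "e \<in> Arcs G" "src G e = a" "tgt G e = b" "label G e = x" by auto
  then show ?case using morphismD(2,5-7)[OF assms(1)] by (auto intro!: bexI[of _ "g e"])
next
  case (Mul s t)
  then show ?case by (metis sem.simps(3))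
qed (use morphismD[OF assms(1)] in auto)


section \<open>Retracted images\<close>

lemma idempotent_power:
  assumes "finite S" "\<phi> ` S \<subseteq> S"
  obtains k where "k > 0" "\<And>s. s \<in> S \<Longrightarrow> (\<phi> ^^ k) ((\<phi> ^^ k) s) = (\<phi> ^^ k) s"
proof -
  have clo: "(\<phi> ^^ i) s \<in> S" if "s \<in> S" for i s
    using that assms(2) by (induction i) auto
  have "(\<lambda>i. restrict (\<phi> ^^ i) S) ` UNIV \<subseteq> S \<rightarrow>\<^sub>E S" using clo by auto
  then have "finite ((\<lambda>i::nat. restrict (\<phi> ^^ i) S) ` UNIV)"
    by (rule finite_subset) (simp add: finite_PiE assms(1))
  then have "\<not> inj (\<lambda>i::nat. restrict (\<phi> ^^ i) S)" using finite_imageD infinite_UNIV_nat by blast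
  then obtain i j :: nat where "restrict (\<phi> ^^ i) S = restrict (\<phi> ^^ j) S" "i \<noteq> j" by (auto simp: inj_def)
  then obtain i j :: nat where ij: "restrict (\<phi> ^^ i) S = restrict (\<phi> ^^ j) S" "i < j"
    by (metis linorder_neqE_nat)
  define p where "p = j - i"
  have per: "(\<phi> ^^ (n + m * p)) s = (\<phi> ^^ n) s" if "s \<in> S" "n \<ge> i" for n m s
  proof (induction m)
    case (Suc m)
    have ji: "(\<phi> ^^ j) t = (\<phi> ^^ i) t" if "t \<in> S" for t
      using fun_cong[OF ij(1), of t] that by simp
    have "n + Suc m * p = (n + m * p - i) + j" using ij(2) that(2) by (simp add: p_def)
    then have "(\<phi> ^^ (n + Suc m * p)) s = (\<phi> ^^ (n + m * p - i)) ((\<phi> ^^ j) s)"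
      by (simp only: funpow_add o_def)
    also have "\<dots> = (\<phi> ^^ (n + m * p - i)) ((\<phi> ^^ i) s)" using ji that by simp
    also have "\<dots> = (\<phi> ^^ (n + m * p - i + i)) s" by (simp only: funpow_add o_def)
    also have "\<dots> = (\<phi> ^^ n) s" using Suc that(2) by simp
    finally show ?case .
  qed simp
  \<comment> \<open>A multiple of the period that is long enough to lie in the periodic part.\<close>
  let ?k = "Suc i * p"
  have "?k > 0" "?k \<ge> i" using ij(2) mult_le_mono[of i "Suc i" 1 p] by (auto simp: p_def)
  moreover have "(\<phi> ^^ ?k) ((\<phi> ^^ ?k) s) = (\<phi> ^^ ?k) s" if "s \<in> S" for s
    using per[OF that \<open>?k \<ge> i\<close>, of "Suc i"] by (simp only: funpow_add o_def)
  ultimately show ?thesis using that by blast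
qed

lemma morphism_funpow: "morphism G G f g \<Longrightarrow> morphism G G (f ^^ k) (g ^^ k)"
  by (induction k) (auto simp: morphism_comp simp flip: id_def intro: morphism_comp, auto simp: morphism_def)

text \<open>
  The composite of the two morphisms has an idempotent power, which is the identity because the
  graph is retracted; so both morphisms are bijective.
\<close>
lemma retracted_xisomorphic:
  fixes G :: "('v, 'e, 'x) xgraph" and H :: "('w, 'f, 'x) xgraph"
  assumes G: "is_xgraph X G" "retracted G" and H: "is_xgraph X H" "retracted H"
    and "maps_to G H" "maps_to H G"
  shows "xisomorphic G H"
proof -
  obtain f g f' g' where m: "morphism G H f g" and m': "morphism H G f' g'"
    using assms by (auto simp: maps_to_def)
  have inverse: "\<exists>j. (\<forall>v\<in>Verts K. (u ^^ j) (u v) = v \<and> u ((u ^^ j) v) = v) \<and>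
      (\<forall>e\<in>Arcs K. (w ^^ j) (w e) = e \<and> w ((w ^^ j) e) = e)"
    if K: "is_xgraph X K" "retracted K" "morphism K K u w" for K :: "('m, 'n, 'x) xgraph" and u w
  proof -
    have mp: "morphism K K (u ^^ i) (w ^^ i)" for i using K(3) by (rule morphism_funpow)
    have fin: "finite (Verts K <+> Arcs K)" using is_xgraphD[OF K(1)] by simp
    have "map_sum u w ` (Verts K <+> Arcs K) \<subseteq> Verts K <+> Arcs K"
      using morphismD(1,2)[OF K(3)] by auto
    then obtain k where k: "k > 0"
      "\<And>s. s \<in> Verts K <+> Arcs K \<Longrightarrow> (map_sum u w ^^ k) ((map_sum u w ^^ k) s) = (map_sum u w ^^ k) s"
      using idempotent_power[OF fin] by metis
    have pw: "(map_sum u w ^^ i) (Inl v) = Inl ((u ^^ i) v)" "(map_sum u w ^^ i) (Inr e) = Inr ((w ^^ i) e)"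
      for i v e by (induction i) auto
    have "retract K (u ^^ k) (w ^^ k)" unfolding retract_def
      using mp[of k] k(2)[OF InlI] k(2)[OF InrI] by (auto simp: pw)
    then have "\<forall>v\<in>Verts K. (u ^^ k) v = v" "\<forall>e\<in>Arcs K. (w ^^ k) e = e"
      using K(2) unfolding retracted_def by blast+
    moreover obtain j where "k = Suc j" using k(1) by (cases k) auto
    ultimately show ?thesis by (intro exI[of _ j]) (simp flip: funpow_swap1)
  qed
  have e1: "morphism G G (f' \<circ> f) (g' \<circ> g)" and e2: "morphism H H (f \<circ> f') (g \<circ> g')"
    using m m' morphism_comp by blast+
  obtain j1 where j1: "\<forall>v\<in>Verts G. ((f' \<circ> f) ^^ j1) (f' (f v)) = v" "\<forall>e\<in>Arcs G. ((g' \<circ> g) ^^ j1) (g' (g e)) = e"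
    using inverse[OF G e1] by auto
  obtain j2 where j2: "\<forall>v\<in>Verts H. f (f' (((f \<circ> f') ^^ j2) v)) = v" "\<forall>e\<in>Arcs H. g (g' (((g \<circ> g') ^^ j2) e)) = e"
    using inverse[OF H e2] by auto
  have "inj_on f (Verts G)" "inj_on g (Arcs G)" using j1 by (metis inj_onI)+
  moreover have "Verts H \<subseteq> f ` Verts G"
  proof
    fix v assume v: "v \<in> Verts H"
    have "f' (((f \<circ> f') ^^ j2) v) \<in> Verts G"
      using morphismD(1)[OF morphism_funpow[OF e2, of j2] v] morphismD(1)[OF m'] by blast
    then show "v \<in> f ` Verts G" using j2(1) v by (metis imageI)
  qed
  moreover have "Arcs H \<subseteq> g ` Arcs G"
  proof
    fix v assume v: "v \<in> Arcs H"
    have "g' (((g \<circ> g') ^^ j2) v) \<in> Arcs G"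
      using morphismD(2)[OF morphism_funpow[OF e2, of j2] v] morphismD(2)[OF m'] by blast
    then show "v \<in> g ` Arcs G" using j2(2) v by (metis imageI)
  qed
  ultimately show ?thesis using m morphismD(1,2)[OF m] unfolding xisomorphic_def bij_betw_def by blast
qed

lemma image_graph_morphisms:
  assumes "retract G f g"
  shows "morphism G (image_graph G f g) f g" "morphism (image_graph G f g) G id id"
proof -
  have m: "morphism G G f g" using assms by (simp add: retract_def)
  note md = morphismD[OF m]
  show "morphism G (image_graph G f g) f g"
    using m unfolding morphism_def image_graph_def by auto
  show "morphism (image_graph G f g) G id id"
    using md(1,2) unfolding morphism_def image_graph_def by auto
qed

lemma image_graph_simps [simp]:
  "Verts (image_graph G f g) = f ` Verts G" "Arcs (image_graph G f g) = g ` Arcs G"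
  "start (image_graph G f g) = start G" "finish (image_graph G f g) = finish G"
  "src (image_graph G f g) = src G" "tgt (image_graph G f g) = tgt G"
  "label (image_graph G f g) = label G"
  by (simp_all add: image_graph_def)

lemma is_xgraph_image_graph: "is_xgraph X G \<Longrightarrow> retract G f g \<Longrightarrow> is_xgraph X (image_graph G f g)"
  using is_xgraph_image[OF _ image_graph_morphisms(1)] by (metis image_graph_simps(1,2))

text \<open>A retract with the least possible image is retracted, as retracts of retracts compose.\<close>
lemma core_retract:
  assumes G: "is_xgraph X G"
  obtains f g where "retract G f g" "core G = image_graph G f g" "retracted (core G)"
proof -
  note fin = is_xgraphD(2,3)[OF G]
  let ?size = "\<lambda>(f, g). card (f ` Verts G) + card (g ` Arcs G)"
  define P where "P = (\<lambda>(f, g). retract G f g)"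
  have "P (id, id)" by (auto simp: P_def retract_def morphism_def)
  then obtain fg where fg: "P fg" "\<And>fg'. P fg' \<Longrightarrow> ?size fg \<le> ?size fg'"
    using ex_has_least_nat[of P "(id, id)" ?size] by blast
  obtain f g where fg_eq: "fg = (f, g)" by (cases fg)
  have r: "retract G f g" using fg(1) by (simp add: fg_eq P_def)
  have least: "card (f ` Verts G) + card (g ` Arcs G) \<le> card (f' ` Verts G) + card (g' ` Arcs G)"
    if "retract G f' g'" for f' g'
    using fg(2)[of "(f', g')"] that by (simp add: fg_eq P_def)
  have "retracted (image_graph G f g)" unfolding retracted_def
  proof (intro allI impI)
    fix f' g' assume r': "retract (image_graph G f g) f' g'"
    have m': "morphism (image_graph G f g) (image_graph G f g) f' g'" using r' by (simp add: retract_def)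
    have fixf: "f v = v" if "v \<in> f ` Verts G" for v using r that by (auto simp: retract_def)
    have fixg: "g v = v" if "v \<in> g ` Arcs G" for v using r that by (auto simp: retract_def)
    have intof: "f' v \<in> f ` Verts G" if "v \<in> f ` Verts G" for v using morphismD(1)[OF m'] that by auto
    have intog: "g' e \<in> g ` Arcs G" if "e \<in> g ` Arcs G" for e using morphismD(2)[OF m'] that by auto
    have "morphism G G (id \<circ> (f' \<circ> f)) (id \<circ> (g' \<circ> g))"
      by (intro morphism_comp[of _ "image_graph G f g"] image_graph_morphisms r m')
    moreover have "f' (f (f' (f v))) = f' (f v)" if "v \<in> Verts G" for v
      using fixf[OF intof[OF imageI[OF that]]] r' that by (simp add: retract_def)
    moreover have "g' (g (g' (g e))) = g' (g e)" if "e \<in> Arcs G" for e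
      using fixg[OF intog[OF imageI[OF that]]] r' that by (simp add: retract_def)
    ultimately have "retract G (f' \<circ> f) (g' \<circ> g)" by (simp add: retract_def)
    from least[OF this]
    have le: "card (f ` Verts G) + card (g ` Arcs G) \<le> card (f' ` f ` Verts G) + card (g' ` g ` Arcs G)"
      by (simp add: image_comp)
    have sub: "f' ` f ` Verts G \<subseteq> f ` Verts G" "g' ` g ` Arcs G \<subseteq> g ` Arcs G"
      using intof intog by auto
    have cle: "card (f' ` f ` Verts G) \<le> card (f ` Verts G)" "card (g' ` g ` Arcs G) \<le> card (g ` Arcs G)"
      using sub fin by (auto intro: card_mono)
    have "f' ` f ` Verts G = f ` Verts G" "g' ` g ` Arcs G = g ` Arcs G"
      using sub le cle fin by (simp_all add: card_subset_eq)
    then have fr: "\<forall>v\<in>f ` Verts G. \<exists>w\<in>f ` Verts G. v = f' w" "\<forall>e\<in>g ` Arcs G. \<exists>w\<in>g ` Arcs G. e = g' w"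
      by blast+
    have "f' v = v" if "v \<in> f ` Verts G" for v
      using fr(1) that r' unfolding retract_def by fastforce
    moreover have "g' e = e" if "e \<in> g ` Arcs G" for e
      using fr(2) that r' unfolding retract_def by fastforce
    ultimately show "(\<forall>v\<in>Verts (image_graph G f g). f' v = v) \<and> (\<forall>e\<in>Arcs (image_graph G f g). g' e = e)"
      by simp
  qed
  then have "\<exists>H. \<exists>f g. retract G f g \<and> H = image_graph G f g \<and> retracted H" using r by blast
  then have "\<exists>f g. retract G f g \<and> core G = image_graph G f g \<and> retracted (core G)"
    unfolding core_def by (rule someI_ex)
  then show ?thesis using that by blast
qed

lemma core_props:
  assumes "is_xgraph X G"
  shows "is_xgraph X (core G)" "retracted (core G)" "maps_to G (core G)" "maps_to (core G) G"
proof -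
  obtain f g where "retract G f g" "core G = image_graph G f g" "retracted (core G)"
    using core_retract[OF assms] .
  then show "is_xgraph X (core G)" "retracted (core G)" "maps_to G (core G)" "maps_to (core G) G"
    using is_xgraph_image_graph[OF assms] image_graph_morphisms[of G f g] by (auto simp: maps_to_def)
qed


section \<open>Idempath identification\<close>

lemma identify_simps [simp]:
  "Verts (identify u v G) = id(v := u) ` Verts G" "Arcs (identify u v G) = Arcs G"
  "src (identify u v G) = id(v := u) \<circ> src G"
  "tgt (identify u v G) = id(v := u) \<circ> tgt G"
  "label (identify u v G) = label G"
  "start (identify u v G) = (id(v := u)) (start G)" "finish (identify u v G) = (id(v := u)) (finish G)"
  by (simp_all add: identify_def Let_def)

lemma morphism_identify: "morphism G (identify u v G) (id(v := u)) id"
  unfolding morphism_def by auto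

lemma is_xgraph_identify: "is_xgraph X G \<Longrightarrow> is_xgraph X (identify u v G)"
  using is_xgraph_image[OF _ morphism_identify[of G u v], of X] by simp

text \<open>
  The vertex that survives is one of the merged ones, so the vertex map of a morphism needs no
  change to become a map on the quotient.
\<close>
lemma morphism_from_identify:
  assumes "morphism G K f g" "f u = f v"
  shows "morphism (identify u v G) K f g"
proof -
  have q: "f ((id(v := u)) w) = f w" for w using assms(2) by simp
  have "f ` id(v := u) ` Verts G \<subseteq> Verts K"
    using assms(1) by (simp add: image_subset_iff q morphism_def del: fun_upd_apply)
  then show ?thesis using assms(1) unfolding morphism_def by (simp add: q del: fun_upd_apply)
qed

lemma idempath_morphism:
  assumes "morphism G K f g" "idempath C \<gamma> G u p v"
  shows "idempath C \<gamma> K (f u) (map g p) (f v)"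
proof -
  have "pre_digraph.awalk (dg G) u p v" using assms(2) by (simp add: idempath_def)
  then have "u \<in> Verts G" and arcs: "set p \<subseteq> Arcs G" and "pre_digraph.cas (dg G) u p v"
    by (auto simp: pre_digraph.awalk_def)
  have "pre_digraph.cas (dg K) (f u) (map g p) (f v)"
    using \<open>pre_digraph.cas (dg G) u p v\<close> arcs
    by (induction p arbitrary: u) (auto simp: pre_digraph.cas.simps morphismD[OF assms(1)])
  moreover have "map (label K) (map g p) = map (label G) p" using arcs morphismD(5)[OF assms(1)] by auto
  ultimately show ?thesis
    using assms(2) arcs \<open>u \<in> Verts G\<close> morphismD(1,2)[OF assms(1)]
    by (auto simp: idempath_def pre_digraph.awalk_def simp del: map_map)
qed

text \<open>
  An idempath is sent to an idempath, hence to a closed path of an identified graph, so the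
  morphism survives every identification with its vertex and edge maps unchanged.
\<close>
lemma morphism_from_descendant:
  assumes "descendant C \<gamma> G H" "morphism G K f g" "idempath_identified C \<gamma> K"
  shows "morphism H K f g"
  using assms(1) unfolding descendant_def
proof (induction rule: rtranclp_induct)
  case (step H H')
  then obtain u p v where p: "idempath C \<gamma> H u p v" "H' = identify u v H"
    by (auto simp: idempath_identification_def)
  have "f u = f v"
    using idempath_morphism[OF step.IH p(1)] assms(3) by (auto simp: idempath_identified_def)
  then show ?case unfolding p(2)
    by (intro morphism_from_identify step.IH)
qed (rule assms)

lemma descendant_induct [consumes 2, case_names base step]:
  assumes "descendant C \<gamma> G H" "is_xgraph X G" "P G"
    and "\<And>H u p v. descendant C \<gamma> G H \<Longrightarrow> is_xgraph X H \<Longrightarrow> P H \<Longrightarrow> idempath C \<gamma> H u p v \<Longrightarrow> P (identify u v H)"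
  shows "P H"
proof -
  have "is_xgraph X H \<and> P H" using assms(1) unfolding descendant_def
  proof (induction rule: rtranclp_induct)
    case (step H H')
    then obtain u p v where "idempath C \<gamma> H u p v" "H' = identify u v H"
      by (auto simp: idempath_identification_def)
    then show ?case using step assms(4)[of H u p v] is_xgraph_identify[of X H u v] by (auto simp: descendant_def)
  qed (use assms in simp)
  then show ?thesis ..
qed

lemma descendant_maps_to:
  assumes "descendant C \<gamma> G H" "is_xgraph X G" shows "maps_to G H"
  using assms
proof (induction rule: descendant_induct)
  case (step H u p v)
  have "maps_to H (identify u v H)" unfolding maps_to_def by (intro exI) (rule morphism_identify)
  with step show ?case using maps_to_trans by blast
qed (rule maps_to_refl)

lemma descendant_is_xgraph:
  assumes "descendant C \<gamma> G H" "is_xgraph X G" shows "is_xgraph X H"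
  using assms(1,2,2) by (induction rule: descendant_induct) (auto intro: is_xgraph_identify)

lemma ex_identified_descendant:
  assumes "is_xgraph X G" shows "\<exists>H. descendant C \<gamma> G H \<and> idempath_identified C \<gamma> H"
  using assms
proof (induction "card (Verts G)" arbitrary: G rule: less_induct)
  case less
  note G = is_xgraphD[OF less.prems]
  show ?case
  proof (cases "idempath_identified C \<gamma> G")
    case True
    then show ?thesis by (auto simp: descendant_def)
  next
    case False
    then obtain u p v where p: "idempath C \<gamma> G u p v" "u \<noteq> v" by (auto simp: idempath_identified_def)
    then have uv: "u \<in> Verts G" "v \<in> Verts G"
      using wf_digraph.awalk_last_in_verts[OF G(1)] wf_digraph.awalk_hd_in_verts[OF G(1)] by (auto simp: idempath_def)
    have "Verts (identify u v G) \<subseteq> Verts G - {v}" using uv p(2) by auto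
    then have "card (Verts (identify u v G)) \<le> card (Verts G - {v})" using G(2) by (intro card_mono) auto
    then have "card (Verts (identify u v G)) < card (Verts G)"
      using G(2) uv(2) card_Diff1_less[of "Verts G" v] by linarith
    then obtain H where "descendant C \<gamma> (identify u v G) H" "idempath_identified C \<gamma> H"
      using less.hyps[OF _ is_xgraph_identify[OF less.prems]] by blast
    moreover have "idempath_identification C \<gamma> G (identify u v G)"
      using p(1) unfolding idempath_identification_def by blast
    ultimately show ?thesis unfolding descendant_def by (meson converse_rtranclp_into_rtranclp)
  qed
qed

lemma closure_descendant:
  assumes "is_xgraph X G"
  shows "descendant C \<gamma> G (closure C \<gamma> G)" "idempath_identified C \<gamma> (closure C \<gamma> G)"
  using someI_ex[OF ex_identified_descendant[OF assms, of C \<gamma>]] unfolding closure_def by auto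

lemma closure_props:
  assumes "is_xgraph X G"
  shows "is_xgraph X (closure C \<gamma> G)" "maps_to G (closure C \<gamma> G)"
  using closure_descendant[OF assms] descendant_is_xgraph descendant_maps_to assms by blast+

lemma maps_to_closure_lift:
  assumes "is_xgraph X G" "maps_to G K" "idempath_identified C \<gamma> K"
  shows "maps_to (closure C \<gamma> G) K"
  using assms closure_descendant(1)[OF assms(1), of C \<gamma>] morphism_from_descendant unfolding maps_to_def by metis

text \<open>
  By the universal property of the closure and the uniqueness of retracted images, only morphisms
  from the original graphs have to be found to compare two elements of the pretzel monoid.
\<close>
lemma pretzel_eqI:
  assumes G: "is_xgraph X G" and H: "is_xgraph X H"
    and "maps_to G (closure C \<gamma> H)" "maps_to H (closure C \<gamma> G)"
  shows "pretzel C \<gamma> G = pretzel C \<gamma> H"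
proof -
  let ?G = "closure C \<gamma> G" and ?H = "closure C \<gamma> H"
  note cG = closure_props(1)[OF G, of C \<gamma>] and cH = closure_props(1)[OF H, of C \<gamma>]
  have "maps_to ?G ?H" "maps_to ?H ?G"
    using assms maps_to_closure_lift[OF _ _ closure_descendant(2)[OF G]]
      maps_to_closure_lift[OF _ _ closure_descendant(2)[OF H]] by blast+
  then have "maps_to (core ?G) (core ?H)" "maps_to (core ?H) (core ?G)"
    using core_props(3,4)[OF cG] core_props(3,4)[OF cH] by (meson maps_to_trans)+
  then have "xisomorphic (core ?G) (core ?H)"
    using retracted_xisomorphic core_props(1,2)[OF cG] core_props(1,2)[OF cH] by metis
  then show ?thesis unfolding pretzel_def by (rule iso_class_eqI) (rule core_props(1)[OF cG])
qed

lemma pretzel_eqD: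
  assumes G: "is_xgraph X G" and H: "is_xgraph X H" and "pretzel C \<gamma> G = pretzel C \<gamma> H"
  shows "xisomorphic (core (closure C \<gamma> G)) (core (closure C \<gamma> H))"
  using assms(3) unfolding pretzel_def
  by (rule iso_class_eqD) (rule core_props(1) closure_props(1) G H)+


section \<open>Weighted walks\<close>

text \<open>
  With trivial vertex weights the value of a walk is the value of its label. Idempotent vertex
  weights record what is attached to the vertices; they are part of the value at both ends, so that
  the product of the values of composable walks counts the common vertex twice without harm.
\<close>
inductive wwalk ::
  "('k, 'm) monoid_scheme \<Rightarrow> ('x \<Rightarrow> 'k) \<Rightarrow> ('v \<Rightarrow> 'k) \<Rightarrow> ('v, 'e, 'x) xgraph \<Rightarrow> 'v \<Rightarrow> 'k \<Rightarrow> 'v \<Rightarrow> bool"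
  for K \<rho> \<sigma> G a where
  start: "a \<in> Verts G \<Longrightarrow> wwalk K \<rho> \<sigma> G a (\<sigma> a) a"
| step: "wwalk K \<rho> \<sigma> G a m (src G e) \<Longrightarrow> e \<in> Arcs G \<Longrightarrow>
    wwalk K \<rho> \<sigma> G a (m \<otimes>\<^bsub>K\<^esub> \<rho> (label G e) \<otimes>\<^bsub>K\<^esub> \<sigma> (tgt G e)) (tgt G e)"

definition functional ::
  "('k, 'm) monoid_scheme \<Rightarrow> ('x \<Rightarrow> 'k) \<Rightarrow> ('v \<Rightarrow> 'k) \<Rightarrow> ('v, 'e, 'x) xgraph \<Rightarrow> bool" where
  "functional K \<rho> \<sigma> G \<longleftrightarrow> (\<forall>a b m n. wwalk K \<rho> \<sigma> G a m b \<longrightarrow> wwalk K \<rho> \<sigma> G a n b \<longrightarrow> m = n)"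

definition ancestors_comparable :: "('v, 'e, 'x) xgraph \<Rightarrow> bool" where
  "ancestors_comparable G \<longleftrightarrow> (\<forall>a b v. reach G a v \<longrightarrow> reach G b v \<longrightarrow> reach G a b \<or> reach G b a)"

lemma wwalk_cong:
  assumes "wwalk K \<rho> \<sigma> G a m b" "wfg G" "\<And>v. v \<in> Verts G \<Longrightarrow> \<sigma> v = \<tau> v"
  shows "wwalk K \<rho> \<tau> G a m b"
  using assms(1)
proof induction
  case start
  then show ?case using wwalk.start[of a G K \<rho> \<tau>] assms(3) by simp
next
  case (step m e)
  then show ?case using wwalk.step[of K \<rho> \<tau> G a m e] assms(3) wf_digraph.head_in_verts[OF assms(2)] by simp
qed

locale weighted = monoid K for K :: "('k, 'm) monoid_scheme" (structure) +
  fixes \<rho> :: "'x \<Rightarrow> 'k" and \<sigma> :: "'v \<Rightarrow> 'k" and G :: "('v, 'e, 'x) xgraph"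
  assumes wf: "wfg G"
    and rho: "e \<in> Arcs G \<Longrightarrow> \<rho> (label G e) \<in> carrier K"
    and sigma: "v \<in> Verts G \<Longrightarrow> \<sigma> v \<in> carrier K"
    and sigma_idem: "v \<in> Verts G \<Longrightarrow> \<sigma> v \<otimes> \<sigma> v = \<sigma> v"
begin

sublocale G: wf_digraph "dg G" by (rule wf)

abbreviation "W \<equiv> wwalk K \<rho> \<sigma> G"

lemma W_closed: "W a m b \<Longrightarrow> a \<in> Verts G \<and> m \<in> carrier K \<and> b \<in> Verts G"
  by (induction rule: wwalk.induct) (auto simp: sigma rho)

lemma W_left: "W a m b \<Longrightarrow> \<sigma> a \<otimes> m = m"
  by (induction rule: wwalk.induct) (auto simp: sigma_idem sigma rho m_assoc[symmetric] dest!: W_closed)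

lemma W_right: "W a m b \<Longrightarrow> m \<otimes> \<sigma> b = m"
  by (induction rule: wwalk.induct) (auto simp: sigma_idem sigma rho m_assoc dest!: W_closed)

lemma W_trans:
  assumes "W a m b" "W b n c" shows "W a (m \<otimes> n) c"
  using assms(2)
proof induction
  case start
  then show ?case using assms(1) W_right by simp
next
  case (step n e)
  have c: "n \<in> carrier K" "m \<in> carrier K" using W_closed[OF step.hyps(1)] W_closed[OF assms(1)] by auto
  show ?case using wwalk.step[OF step.IH step.hyps(2)] step.hyps(2) c
    by (simp add: m_assoc rho sigma)
qed

lemma W_reach: "W a m b \<Longrightarrow> reach G a b"
proof (induction rule: wwalk.induct)
  case (step m e)
  then show ?case using G.in_arcs_imp_in_arcs_ends[of e] by (meson G.reachable_adj_trans)
qed auto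

lemma reach_W:
  assumes "reach G a b" obtains m where "W a m b"
proof -
  have "\<exists>m. W a m b" using assms
  proof (induction rule: G.reachable_induct)
    case base
    then show ?case by (intro exI) (rule wwalk.start)
  next
    case (step x y)
    then obtain m where m: "W a m x" by blast
    from step(2) obtain e where "e \<in> Arcs G" "src G e = x" "tgt G e = y" by auto
    then show ?case using wwalk.step[of K \<rho> \<sigma> G a m e] m by auto
  qed
  then show ?thesis using that by blast
qed

lemma functionalD: "functional K \<rho> \<sigma> G \<Longrightarrow> W a m b \<Longrightarrow> W a n b \<Longrightarrow> m = n"
  by (auto simp: functional_def)

text \<open>
  Identifying \<open>x\<close> with \<open>y\<close>, where \<open>y\<close> is reachable from \<open>x\<close>, amounts to allowing a jump from \<open>y\<close>
  back to \<open>x\<close>. One jump is always enough, because the part of a walk between two jumps is a closed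
  walk of trivial value.
\<close>
lemma wwalk_identify_cases:
  assumes xy: "W x (\<sigma> x) y" "\<sigma> x = \<sigma> y" and f: "functional K \<rho> \<sigma> G"
    and "wwalk K \<rho> \<sigma> (identify x y G) a' m b'"
    and "a \<in> Verts G" "b \<in> Verts G" "(id(y := x)) a = a'" "(id(y := x)) b = b'"
  shows "W a m b \<or> (\<exists>m1 m2. W a m1 y \<and> W x m2 b \<and> m = m1 \<otimes> m2)"
proof -
  define D where "D = (\<lambda>a m b. W a m b \<or> (\<exists>m1 m2. W a m1 y \<and> W x m2 b \<and> m = m1 \<otimes> m2))"
  define q where "q = (id(y := x))"
  have x: "x \<in> Verts G" using W_closed xy by blast
  have qs: "\<sigma> (q v) = \<sigma> v" for v using xy(2) by (simp add: q_def)
  have leave: "D a m x" if d: "D a m y" for a m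
  proof -
    have my: "W a m y" using d unfolding D_def
    proof
      assume "\<exists>m1 m2. W a m1 y \<and> W x m2 y \<and> m = m1 \<otimes> m2"
      then obtain m1 m2 where "W a m1 y" "W x m2 y" "m = m1 \<otimes> m2" by blast
      moreover have "m2 = \<sigma> y" using functionalD[OF f calculation(2) xy(1)] xy(2) by simp
      ultimately show ?thesis using W_right by simp
    qed
    then have "m = m \<otimes> \<sigma> x" using W_right xy(2) by simp
    then show ?thesis unfolding D_def using my wwalk.start[OF x] by blast
  qed
  have forth: "D a m y" if "D a m x" for a m
    using that unfolding D_def
  proof (elim disjE exE conjE)
    assume "W a m x"
    then show "W a m y \<or> (\<exists>m1 m2. W a m1 y \<and> W x m2 y \<and> m = m1 \<otimes> m2)"
      using W_trans[OF _ xy(1)] W_right by fastforce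
  next
    fix m1 m2 assume "W a m1 y" "W x m2 x" "m = m1 \<otimes> m2"
    then show "W a m y \<or> (\<exists>m1 m2. W a m1 y \<and> W x m2 y \<and> m = m1 \<otimes> m2)"
      using W_trans[OF _ xy(1)] W_right by fastforce
  qed
  have same: "D a m b" if "D a m c" "q c = q b" for a m b c
    using that leave forth by (auto simp: q_def split: if_splits)
  have arc: "D a (m \<otimes> \<rho> (label G e) \<otimes> \<sigma> (tgt G e)) (tgt G e)"
    if d: "D a m (src G e)" "e \<in> Arcs G" for a m e
    using d(1) unfolding D_def
  proof (elim disjE exE conjE)
    fix m1 m2 assume m: "W a m1 y" "W x m2 (src G e)" "m = m1 \<otimes> m2"
    then have "m \<otimes> \<rho> (label G e) \<otimes> \<sigma> (tgt G e) = m1 \<otimes> (m2 \<otimes> \<rho> (label G e) \<otimes> \<sigma> (tgt G e))"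
      using d(2) by (auto simp: m_assoc rho sigma dest!: W_closed)
    then show "W a (m \<otimes> \<rho> (label G e) \<otimes> \<sigma> (tgt G e)) (tgt G e) \<or>
      (\<exists>m1 m2. W a m1 y \<and> W x m2 (tgt G e) \<and> m \<otimes> \<rho> (label G e) \<otimes> \<sigma> (tgt G e) = m1 \<otimes> m2)"
      using m(1) wwalk.step[OF m(2) d(2)] by blast
  qed (use wwalk.step[OF _ d(2), of K \<rho> \<sigma> a m] in simp)
  have "\<forall>a b. a \<in> Verts G \<longrightarrow> b \<in> Verts G \<longrightarrow> q a = a' \<longrightarrow> q b = b' \<longrightarrow> D a m b"
    using assms(4)
  proof (induction rule: wwalk.induct)
    case start
    show ?case
    proof (intro allI impI)
      fix a b assume ab: "a \<in> Verts G" "b \<in> Verts G" "q a = a'" "q b = a'"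
      have "D a (\<sigma> a) a" unfolding D_def using wwalk.start[OF ab(1)] by blast
      then show "D a (\<sigma> a') b" using same[of a "\<sigma> a" a b] ab qs[of a] by simp
    qed
  next
    case (step m e)
    show ?case
    proof (intro allI impI)
      fix a b assume ab: "a \<in> Verts G" "b \<in> Verts G" "q a = a'" "q b = tgt (identify x y G) e"
      have e: "e \<in> Arcs G" using step.hyps(2) by simp
      have "D a m (src G e)" using step.IH ab e by (simp add: q_def)
      from same[OF arc[OF this e], of b] ab(4)
      show "D a (m \<otimes> \<rho> (label (identify x y G) e) \<otimes> \<sigma> (tgt (identify x y G) e)) b"
        using qs[of "tgt G e"] by (simp add: q_def)
    qed
  qed
  then show ?thesis using assms(5-8) by (simp add: D_def q_def)
qed

text \<open>
  A walk with a jump is compared with one without: the start \<open>a\<close> of both is comparable with \<open>x\<close>. If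
  \<open>x\<close> can be reached from \<open>a\<close>, the jump can be avoided by walking to \<open>x\<close> directly. Otherwise \<open>a\<close>
  can be reached from \<open>x\<close>, and going from \<open>a\<close> to \<open>y\<close>, jumping to \<open>x\<close> and returning to \<open>a\<close> is a closed
  walk of trivial value.
\<close>
lemma functional_identify:
  assumes xy: "W x (\<sigma> x) y" "\<sigma> x = \<sigma> y" and f: "functional K \<rho> \<sigma> G"
    and comparable: "ancestors_comparable G"
    and closed_walk: "\<And>a d s. W a d y \<Longrightarrow> W x s a \<Longrightarrow> d \<otimes> s = \<sigma> a"
  shows "functional K \<rho> \<sigma> (identify x y G)"
  unfolding functional_def
proof (intro allI impI)
  fix a' b' m n assume w: "wwalk K \<rho> \<sigma> (identify x y G) a' m b'" "wwalk K \<rho> \<sigma> (identify x y G) a' n b'"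
  have mixed: "m = m1 \<otimes> m2" if m: "W a m b" "W a m1 y" "W x m2 b" for a b m m1 m2
  proof -
    have "reach G a x \<or> reach G x a"
      using comparable W_reach[OF m(1)] W_reach[OF m(3)] unfolding ancestors_comparable_def by blast
    then show ?thesis
    proof
      assume "reach G a x"
      then obtain s where s: "W a s x" by (rule reach_W)
      have "W a s y" using W_trans[OF s xy(1)] W_right[OF s] by simp
      then have "s = m1" using functionalD[OF f] m(2) by blast
      then show ?thesis using functionalD[OF f m(1) W_trans[OF s m(3)]] by simp
    next
      assume "reach G x a"
      then obtain s where s: "W x s a" by (rule reach_W)
      have "m2 = s \<otimes> m" using functionalD[OF f m(3) W_trans[OF s m(1)]] .
      then have "m1 \<otimes> m2 = (m1 \<otimes> s) \<otimes> m"
        using W_closed[OF m(2)] W_closed[OF s] W_closed[OF m(1)] by (simp add: m_assoc)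
      then show ?thesis using closed_walk[OF m(2) s] W_left[OF m(1)] by simp
    qed
  qed
  have "a' \<in> Verts (identify x y G)" using w(1) by (induction rule: wwalk.induct)
  then obtain a where a: "a \<in> Verts G" "(id(y := x)) a = a'" by auto
  have "b' \<in> Verts (identify x y G)" using w(1) by (induction rule: wwalk.induct) auto
  then obtain b where b: "b \<in> Verts G" "(id(y := x)) b = b'" by auto
  note cases = wwalk_identify_cases[OF xy f _ a(1) b(1) a(2) b(2)]
  from cases[OF w(1)] cases[OF w(2)] show "m = n"
    using functionalD[OF f] mixed by (elim disjE exE conjE) (metis+)
qed

lemma ancestors_comparable_identify:
  assumes xy: "W x (\<sigma> x) y" "\<sigma> x = \<sigma> y" and f: "functional K \<rho> \<sigma> G"
    and comparable: "ancestors_comparable G"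
  shows "ancestors_comparable (identify x y G)"
proof -
  let ?G = "identify x y G" and ?q = "id(y := x)"
  have wf': "wfg ?G" by unfold_locales auto
  interpret G': weighted K \<rho> \<sigma> ?G
    using wf' xy by unfold_locales (auto simp: rho sigma sigma_idem dest: W_closed)
  have xr: "reach G x y" using W_reach xy by blast
  have xV: "x \<in> Verts G" "y \<in> Verts G" using W_closed xy by blast+
  have down: "reach G a b \<or> (reach G a y \<and> reach G x b)"
    if r: "reach ?G (?q a) (?q b)" "a \<in> Verts G" "b \<in> Verts G" for a b
  proof -
    obtain m where "wwalk K \<rho> \<sigma> ?G (?q a) m (?q b)" using G'.reach_W[OF r(1)] .
    from wwalk_identify_cases[OF xy f this r(2,3)] show ?thesis using W_reach by blast
  qed
  have up: "reach ?G (?q a) (?q b)" if "reach G a b" for a b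
    using reach_morphism[OF morphism_identify wf wf' that] .
  have up2: "reach ?G (?q a) (?q b)" if "reach G a y" "reach G x b" for a b
  proof -
    have "?q y = ?q x" by simp
    then show ?thesis using up[OF that(1)] up[OF that(2)] by (metis G'.G.reachable_trans)
  qed
  show ?thesis unfolding ancestors_comparable_def
  proof (intro allI impI)
    fix a' b' v' assume r: "reach ?G a' v'" "reach ?G b' v'"
    then have "a' \<in> ?q ` Verts G" "b' \<in> ?q ` Verts G" "v' \<in> ?q ` Verts G"
      using G'.G.reachable_in_verts by fastforce+
    then obtain a b v where abv: "a \<in> Verts G" "b \<in> Verts G" "v \<in> Verts G"
      "a' = ?q a" "b' = ?q b" "v' = ?q v" by blast
    have c: "\<And>a b v. reach G a v \<Longrightarrow> reach G b v \<Longrightarrow> reach G a b \<or> reach G b a"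
      using comparable unfolding ancestors_comparable_def by blast
    have t: "\<And>a b v. reach G a b \<Longrightarrow> reach G b v \<Longrightarrow> reach G a v" by (rule G.reachable_trans)
    have "reach G a b \<or> reach G b a \<or> (reach G a y \<and> reach G x b) \<or> (reach G b y \<and> reach G x a)"
    proof -
      consider "reach G a v" "reach G b v" | "reach G a v" "reach G b y" "reach G x v"
        | "reach G b v" "reach G a y" "reach G x v" | "reach G a y" "reach G b y"
        using down[of a v] down[of b v] r abv by blast
      then show ?thesis
      proof cases
        case 2
        then have "reach G a x \<or> reach G x a" using c by blast
        then show ?thesis using 2 c[of a y b] t[of a x y] xr by blast
      next
        case 3
        then have "reach G b x \<or> reach G x b" using c by blast
        then show ?thesis using 3 c[of b y a] t[of b x y] xr by blast
      qed (use c in blast)+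
    qed
    then show "reach ?G a' b' \<or> reach ?G b' a'" unfolding abv using up up2 by blast
  qed
qed

end


section \<open>Trees\<close>

text \<open>
  Together with reachability from the root these conditions exclude all cycles, and they allow walks
  to be traced backwards.
\<close>
definition treelike :: "'x set \<Rightarrow> ('v, 'e, 'x) xgraph \<Rightarrow> bool" where
  "treelike X G \<longleftrightarrow> is_xgraph X G \<and> inj_on (tgt G) (Arcs G) \<and> (\<forall>e\<in>Arcs G. tgt G e \<noteq> start G)"

lemma treelike_rank:
  assumes "treelike X G"
  obtains r :: "'v \<Rightarrow> nat" where "\<And>e. e \<in> Arcs G \<Longrightarrow> r (tgt G e) = Suc (r (src G e))"
proof -
  note G = is_xgraphD[of X G]
  have x: "is_xgraph X G" and inj: "inj_on (tgt G) (Arcs G)"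
    and root: "\<And>e. e \<in> Arcs G \<Longrightarrow> tgt G e \<noteq> start G"
    using assms by (auto simp: treelike_def)
  interpret G: wf_digraph "dg G" using G x by blast
  define P where "P = (\<lambda>v n. \<exists>p. G.awalk (start G) p v \<and> length p = n)"
  define r where "r = (\<lambda>v. LEAST n. P v n)"
  have ex: "\<exists>n. P v n" if "v \<in> Verts G" for v
    using G(7)[OF x that] unfolding P_def G.reachable_awalk by blast
  have Pr: "P v (r v)" if "v \<in> Verts G" for v
    unfolding r_def using ex[OF that] by (rule LeastI_ex)
  have "r (tgt G e) = Suc (r (src G e))" if e: "e \<in> Arcs G" for e
  proof (rule antisym)
    obtain p where "G.awalk (start G) p (src G e)" "length p = r (src G e)"
      using Pr[of "src G e"] e unfolding P_def by auto
    then have "G.awalk (start G) (p @ [e]) (tgt G e)" "length (p @ [e]) = Suc (r (src G e))"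
      using e by (auto intro!: G.awalk_appendI G.arc_implies_awalk)
    then show "r (tgt G e) \<le> Suc (r (src G e))" unfolding r_def P_def
      by (intro Least_le) blast
    obtain p where p: "G.awalk (start G) p (tgt G e)" "length p = r (tgt G e)"
      using Pr[of "tgt G e"] e unfolding P_def by auto
    then have "p \<noteq> []" using root[OF e] by (auto simp: G.awalk_Nil_iff)
    then obtain p' e' where p': "p = p' @ [e']" by (metis append_butlast_last_id)
    then have "G.awalk (start G) p' (src G e')" "tgt G e' = tgt G e" "e' \<in> Arcs G"
      using p(1) by (auto simp: G.awalk_simps)
    then have "P (src G e) (length p')" using inj e unfolding P_def by (metis inj_onD)
    then have "r (src G e) \<le> length p'" unfolding r_def by (rule Least_le)
    then show "Suc (r (src G e)) \<le> r (tgt G e)" using p(2) p' by simp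
  qed
  then show ?thesis by (rule that)
qed

text \<open>Walks in a tree with given ends are equal, as they can be traced back edge by edge.\<close>
lemma treelike_functional:
  assumes T: "treelike X G" and w: "weighted K \<rho> \<sigma> G"
  shows "functional K \<rho> \<sigma> G"
proof -
  interpret weighted K \<rho> \<sigma> G by (rule w)
  obtain r :: "_ \<Rightarrow> nat" where r: "\<And>e. e \<in> Arcs G \<Longrightarrow> r (tgt G e) = Suc (r (src G e))"
    using treelike_rank[OF T] by metis
  have mono: "r a \<le> r b" if "W a m b" for a m b
    using that by (induction rule: wwalk.induct) (auto simp: r)
  have "m = n" if "W a m b" "W a n b" for a b m n
    using that
  proof (induction arbitrary: n rule: wwalk.induct)
    case start
    from start.prems show ?case
      by (cases rule: wwalk.cases) (use mono r in fastforce)+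
  next
    case (step m e)
    from step.prems show ?case
    proof (cases rule: wwalk.cases)
      case start
      then show ?thesis using mono[OF step.hyps(1)] r[OF step.hyps(2)] by simp
    next
      case (step n' e')
      then have "e' = e" using T \<open>e \<in> Arcs G\<close> unfolding treelike_def by (metis inj_onD)
      then show ?thesis using step \<open>\<And>n. W a n (src G e) \<Longrightarrow> m = n\<close> by blast
    qed
  qed
  then show ?thesis unfolding functional_def by blast
qed

lemma treelike_ancestors_comparable:
  assumes T: "treelike X G" shows "ancestors_comparable G"
proof -
  interpret wf_digraph "dg G" using T is_xgraphD by (auto simp: treelike_def)
  have "reach G a b \<or> reach G b a" if "reach G a v" "reach G b v" for a b v
    using that
  proof (induction rule: reachable_induct)
    case (step x y)
    from step(2) obtain e where e: "e \<in> Arcs G" "src G e = x" "tgt G e = y" by auto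
    show ?case
    proof (cases "b = y")
      case True
      then show ?thesis using step reachable_adj_trans by blast
    next
      case False
      then obtain z where z: "reach G b z" "z \<rightarrow>\<^bsub>dg G\<^esub> y"
        using step.prems reachable_in_verts by (metis rtrancl_on.cases reachable_def)
      from z(2) obtain e' where e': "e' \<in> Arcs G" "src G e' = z" "tgt G e' = y" by auto
      then have "e' = e" using T e unfolding treelike_def by (metis inj_onD)
      then show ?thesis using step.IH z(1) e e' by simp
    qed
  qed blast
  then show ?thesis unfolding ancestors_comparable_def by blast
qed


lemma undirected_simps [simp]:
  "verts (undirected D) = verts D" "arcs (undirected D) = arcs D \<times> UNIV"
  "tail (undirected D) (e, b) = (if b then tail D e else head D e)"
  "head (undirected D) (e, b) = (if b then head D e else tail D e)"
  by (simp_all add: undirected_def)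

lemma wf_undirected: "wf_digraph D \<Longrightarrow> wf_digraph (undirected D)"
  by (auto simp: wf_digraph_def undirected_def)

lemma awalk_undirected_forward:
  assumes "wf_digraph D"
  shows "pre_digraph.awalk (undirected D) u (map (\<lambda>e. (e, True)) p) v \<longleftrightarrow> pre_digraph.awalk D u p v"
    and "pre_digraph.awalk_verts (undirected D) u (map (\<lambda>e. (e, True)) p) = pre_digraph.awalk_verts D u p"
proof -
  interpret wf_digraph D by fact
  interpret U: wf_digraph "undirected D" using assms by (rule wf_undirected)
  show "U.awalk u (map (\<lambda>e. (e, True)) p) v \<longleftrightarrow> awalk u p v"
    by (induction p arbitrary: u) (auto simp: awalk_simps U.awalk_simps)
  show "U.awalk_verts u (map (\<lambda>e. (e, True)) p) = awalk_verts u p"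
    by (induction p arbitrary: u) auto
qed

text \<open>
  If a second edge entered the end of a directed path from the root, walking it backwards would
  either close an undirected cycle or continue the path by a backward step.
\<close>
lemma is_xtree_treelike:
  assumes T: "is_xtree X G" shows "treelike X G"
proof -
  have x: "is_xgraph X G" using T by (simp add: is_xtree_def)
  interpret wf_digraph "dg G" using is_xgraphD[OF x] by simp
  interpret U: wf_digraph "undirected (dg G)" by (rule wf_undirected) (rule wf_digraph)
  note fw = awalk_undirected_forward[OF wf_digraph]
  let ?F = "map (\<lambda>e. (e, True))"
  have no_cycle: "\<not> (U.cycle p \<and> distinct (map fst p))" for p using T by (auto simp: is_xtree_def)
  have forward: "list_all snd p" if "U.apath (start G) p v" for p v using T that by (auto simp: is_xtree_def)
  have acyclic: "p = []" if closed: "awalk u p u" for u p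
  proof (rule ccontr)
    assume "p \<noteq> []"
    then obtain c where "cycle c" using closed closed_w_imp_cycle unfolding closed_w_def by blast
    then obtain v where c: "awalk v c v" "distinct (tl (awalk_verts v c))" "distinct c" "c \<noteq> []"
      unfolding cycle_conv by blast
    then have "U.cycle (?F c)" unfolding U.cycle_def using fw by (intro exI[of _ v]) auto
    moreover have "distinct (map fst (?F c))" using c(3) by (simp add: comp_def)
    ultimately show False using no_cycle by blast
  qed
  have reach: "\<exists>p. apath (start G) p v" if "v \<in> Verts G" for v
    using is_xgraphD(7)[OF x that] by (simp add: reachable_apath)
  have root: "tgt G e \<noteq> start G" if e: "e \<in> Arcs G" for e
  proof
    assume "tgt G e = start G"
    moreover obtain p where "apath (start G) p (src G e)" using reach e by fastforce
    ultimately have "awalk (start G) (p @ [e]) (start G)"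
      using e awalk_appendI[OF awalkI_apath arc_implies_awalk[OF e]] by metis
    then show False using acyclic by blast
  qed
  moreover have "e = f" if e: "e \<in> Arcs G" and f: "f \<in> Arcs G" and ef: "tgt G e = tgt G f" for e f
  proof (rule ccontr)
    assume "e \<noteq> f"
    let ?v = "tgt G e" and ?w = "src G f"
    obtain p where p: "apath (start G) p (src G e)" using reach e by fastforce
    have "?v \<notin> set (awalk_verts (start G) p)"
    proof
      assume "?v \<in> set (awalk_verts (start G) p)"
      then obtain r where "awalk ?v r (src G e)" using awalk_decomp awalkI_apath[OF p] by blast
      then show False using acyclic awalk_appendI[OF _ arc_implies_awalk[OF e]] by blast
    qed
    moreover have aw: "awalk (start G) (p @ [e]) ?v"
      using awalk_appendI[OF awalkI_apath[OF p] arc_implies_awalk[OF e]] .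
    moreover have av: "awalk_verts (start G) (p @ [e]) = awalk_verts (start G) p @ [?v]"
      using awalk_verts_append[OF aw] by simp
    ultimately have q: "apath (start G) (p @ [e]) ?v" using p by (auto simp: apath_def)
    have uw: "U.awalk (start G) (?F (p @ [e])) ?v" using aw fw(1) by blast
    have step: "U.awalk ?v [(f, False)] ?w" using f ef by (simp add: U.awalk_simps)
    show False
    proof (cases "?w \<in> set (awalk_verts (start G) (p @ [e]))")
      case False
      have uw2: "U.awalk (start G) (?F (p @ [e]) @ [(f, False)]) ?w"
        using U.awalk_appendI[OF uw step] .
      have "U.awalk_verts (start G) (?F (p @ [e]) @ [(f, False)]) = awalk_verts (start G) (p @ [e]) @ [?w]"
        using U.awalk_verts_append[OF uw2] fw(2)[of "start G" "p @ [e]"] by simp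
      then have "U.apath (start G) (?F (p @ [e]) @ [(f, False)]) ?w"
        using uw2 q False unfolding U.apath_def apath_def by simp
      then show False using forward by fastforce
    next
      case True
      then obtain q1 q2 where dec: "p @ [e] = q1 @ q2" "awalk (start G) q1 ?w" "awalk ?w q2 ?v"
        using awalk_decomp[OF aw] by blast
      have "?w \<noteq> ?v"
        using acyclic[of ?w "[f]"] arc_implies_awalk[OF f] ef by auto
      then have "q2 \<noteq> []" using dec(3) by (auto simp: awalk_Nil_iff)
      then have last: "last q2 = e" using dec(1) by (metis last_appendR last_snoc)
      have "apath (start G) (q1 @ q2) ?v" using q dec(1) by simp
      then have ap: "apath ?w q2 ?v"
        unfolding apath_append_iff using dec(2) by (metis awlast_of_awalk awalkE')
      have dq: "distinct q2" using ap distinct_verts_imp_distinct unfolding apath_def by blast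
      have fq: "f \<notin> set q2"
      proof
        assume "f \<in> set q2"
        then obtain a b where ab: "q2 = a @ f # b" by (auto simp: in_set_conv_decomp)
        then have "awalk ?v b ?v" using dec(3) ef by (auto simp: awalk_simps)
        then have "b = []" by (rule acyclic)
        then show False using last ab \<open>e \<noteq> f\<close> by simp
      qed
      have cw: "U.awalk ?w (?F q2 @ [(f, False)]) ?w" using U.awalk_appendI[OF _ step] fw(1) dec(3) by blast
      have "U.awalk_verts ?w (?F q2 @ [(f, False)]) = awalk_verts ?w q2 @ [?w]"
        using U.awalk_verts_append[OF cw] fw(2) by simp
      moreover have "distinct (tl (awalk_verts ?w q2 @ [?w]))"
      proof -
        obtain vs where "awalk_verts ?w q2 = ?w # vs" using dec(3) by (cases q2) (auto simp: awalk_simps)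
        then show ?thesis using ap unfolding apath_def by simp
      qed
      ultimately have "U.cycle (?F q2 @ [(f, False)])" unfolding U.cycle_def using cw by auto
      moreover have "distinct (map fst (?F q2 @ [(f, False)]))" using dq fq by (simp add: comp_def)
      ultimately show False using no_cycle by blast
    qed
  qed
  ultimately show ?thesis using x by (auto simp: treelike_def inj_on_def)
qed

text \<open>
  Every vertex has at most one incoming edge, so an undirected walk that does not repeat edges can
  never turn back after a forward step: it goes down towards the root first and up afterwards.
\<close>
lemma treelike_is_xtree:
  assumes T: "treelike X G" shows "is_xtree X G"
proof -
  have x: "is_xgraph X G" and inj: "inj_on (tgt G) (Arcs G)"
    and root: "\<And>e. e \<in> Arcs G \<Longrightarrow> tgt G e \<noteq> start G"
    using T by (auto simp: treelike_def)
  interpret wf_digraph "dg G" using is_xgraphD[OF x] by simp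
  interpret U: wf_digraph "undirected (dg G)" by (rule wf_undirected) (rule wf_digraph)
  obtain r :: "_ \<Rightarrow> nat" where r: "\<And>e. e \<in> Arcs G \<Longrightarrow> r (tgt G e) = Suc (r (src G e))"
    using treelike_rank[OF T] by metis
  have "Digraph_Component.connected (dg G)"
  proof -
    let ?S = "rtrancl_on (Verts G) ((arcs_ends (dg G))\<^sup>s)"
    have down: "(start G, v) \<in> ?S" if "v \<in> Verts G" for v
      using is_xgraphD(7)[OF x that] unfolding reachable_def
      by (rule rtrancl_on_mono[OF _ subset_refl, rotated]) (auto simp: symcl_def)
    have "sym ?S" by (rule rtrancl_on_sym) (auto simp: symcl_def sym_def)
    then have up: "(v, start G) \<in> ?S" if "v \<in> Verts G" for v
      using down[OF that] by (auto dest: symD)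
    show ?thesis unfolding connected_conv
      using is_xgraphD(4)[OF x] down up by (auto intro: rtrancl_on_trans)
  qed
  moreover have "\<not> (U.cycle p \<and> distinct (map fst p))" for p
  proof
    assume "U.cycle p \<and> distinct (map fst p)"
    then obtain u where p: "U.awalk u p u" "p \<noteq> []" "distinct (map fst p)" unfolding U.cycle_def by blast
    have shape: "\<exists>a b. p = map (\<lambda>e. (e, False)) a @ map (\<lambda>e. (e, True)) b"
      if "U.awalk u p v" "distinct (map fst p)" for u v p
      using that
    proof (induction p arbitrary: u)
      case Nil
      then show ?case by simp
    next
      case (Cons eb p)
      obtain e d where eb: "eb = (e, d)" by (cases eb)
      have e: "e \<in> Arcs G" and p: "U.awalk (head (undirected (dg G)) (e, d)) p v"
        using Cons.prems(1) eb by (auto simp: U.awalk_simps)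
      obtain a b where ab: "p = map (\<lambda>e. (e, False)) a @ map (\<lambda>e. (e, True)) b"
        using Cons.IH[OF p] Cons.prems(2) by auto
      show ?case
      proof (cases d)
        case False
        then show ?thesis using ab eb by (intro exI[of _ "e # a"] exI[of _ b]) simp
      next
        case True
        have "a = []"
        proof (cases a)
          case (Cons f a')
          then have "f \<in> Arcs G" "tgt G f = tgt G e" using p ab True by (auto simp: U.awalk_simps)
          then have "f = e" using inj e by (metis inj_onD)
          then show ?thesis using Cons.prems(2) ab eb Cons by simp
        qed simp
        then show ?thesis using ab eb True by (intro exI[of _ "[]"] exI[of _ "e # b"]) simp
      qed
    qed
    have rT: "r v = r u + length b" if "U.awalk u (map (\<lambda>e. (e, True)) b) v" for u v b
      using that by (induction b arbitrary: u) (auto simp: U.awalk_simps r)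
    have rF: "r u = r v + length b" if "U.awalk u (map (\<lambda>e. (e, False)) b) v" for u v b
      using that by (induction b arbitrary: u) (auto simp: U.awalk_simps r)
    obtain a b where ab: "p = map (\<lambda>e. (e, False)) a @ map (\<lambda>e. (e, True)) b"
      using shape[OF p(1,3)] by blast
    then obtain w where w: "U.awalk u (map (\<lambda>e. (e, False)) a) w" "U.awalk w (map (\<lambda>e. (e, True)) b) u"
      using p(1) by auto
    have "length a = length b" using rT[OF w(2)] rF[OF w(1)] by simp
    then obtain e a' f b' where ab': "a = e # a'" "b = b' @ [f]" using p(2) ab
      by (metis length_0_conv list.exhaust map_is_Nil_conv rev_exhaust append_Nil2)
    have e: "e \<in> Arcs G" "tgt G e = u" using w(1) ab' by (auto simp: U.awalk_simps)
    have f: "f \<in> Arcs G" "tgt G f = u" using w(2) ab' by (auto simp: U.awalk_simps)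
    have "e = f" using e f inj by (metis inj_onD)
    then show False using p(3) ab ab' by simp
  qed
  moreover have "list_all snd p" if "U.apath (start G) p v" for p v
    using that
  proof (induction p arbitrary: v rule: rev_induct)
    case (snoc eb p)
    obtain e d where eb: "eb = (e, d)" by (cases eb)
    have aw: "U.awalk (start G) (p @ [eb]) v" and dist: "distinct (U.awalk_verts (start G) (p @ [eb]))"
      using snoc.prems by (auto simp: U.apath_def)
    obtain w where w: "U.awalk (start G) p w" "U.awalk w [(e, d)] v" using aw eb by auto
    have vs: "U.awalk_verts (start G) (p @ [eb]) = U.awalk_verts (start G) p @ [v]"
      using U.awalk_verts_append[OF aw] w eb by (auto simp: U.awalk_simps)
    have "U.apath (start G) p w" using dist vs w(1) by (auto simp: U.apath_def)
    then have fw: "list_all snd p" by (rule snoc.IH)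
    have d
    proof (rule ccontr)
      assume "\<not> d"
      then have e: "e \<in> Arcs G" "tgt G e = w" "src G e = v" using w(2) by (auto simp: U.awalk_simps)
      have "p \<noteq> []" using w(1) e(2) root[OF e(1)] by (auto simp: U.awalk_Nil_iff)
      then obtain p' f c where p': "p = p' @ [(f, c)]" by (metis append_butlast_last_id prod.exhaust)
      then have c using fw by simp
      then have f: "f \<in> Arcs G" "tgt G f = w" using w(1) p' by (auto simp: U.awalk_simps)
      then have "f = e" using e inj by (metis inj_onD)
      then have "v \<in> set (U.awalk_verts (start G) p)"
        using U.awalk_verts_arc1[of "(f, c)" p "start G"] p' e \<open>c\<close> by simp
      then show False using dist vs by simp
    qed
    then show ?case using fw eb by simp
  qed simp
  ultimately show ?thesis using x by (auto simp: is_xtree_def)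
qed


subsection \<open>The tree of a term\<close>

text \<open>
  The vertices of the tree of a term are numbered so that \<open>0\<close> is the root and the only edge into
  the vertex \<open>i > 0\<close> is called \<open>i\<close> too. In a product the root of the second tree becomes the finish
  vertex of the first one, and its other vertices are numbered after those of the first tree.
\<close>
primrec gens :: "'x lad_term \<Rightarrow> nat" where
  "gens (Gen x) = 1"
| "gens Unit = 0"
| "gens (Mul s t) = gens s + gens t"
| "gens (Plus s) = gens s"

primrec fin :: "'x lad_term \<Rightarrow> nat" where
  "fin (Gen x) = 1"
| "fin Unit = 0"
| "fin (Mul s t) = (if fin t = 0 then fin s else gens s + fin t)"
| "fin (Plus s) = 0"

definition shift :: "'x lad_term \<Rightarrow> nat \<Rightarrow> nat" where
  "shift s i = (if i = 0 then fin s else gens s + i)"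

primrec parent :: "'x lad_term \<Rightarrow> nat \<Rightarrow> nat" where
  "parent (Gen x) = (\<lambda>i. 0)"
| "parent Unit = (\<lambda>i. 0)"
| "parent (Mul s t) = (\<lambda>i. if i \<le> gens s then parent s i else shift s (parent t (i - gens s)))"
| "parent (Plus s) = parent s"

primrec letter :: "'x lad_term \<Rightarrow> nat \<Rightarrow> 'x" where
  "letter (Gen x) = (\<lambda>i. x)"
| "letter Unit = (\<lambda>i. undefined)"
| "letter (Mul s t) = (\<lambda>i. if i \<le> gens s then letter s i else letter t (i - gens s))"
| "letter (Plus s) = letter s"

definition tree :: "'x lad_term \<Rightarrow> (nat, nat, 'x) xgraph" where
  "tree t = \<lparr>dg = \<lparr>verts = {..gens t}, arcs = {1..gens t}, tail = parent t, head = (\<lambda>i. i)\<rparr>,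
     label = letter t, start = 0, finish = fin t\<rparr>"

lemma tree_simps [simp]:
  "Verts (tree t) = {..gens t}" "Arcs (tree t) = {1..gens t}" "src (tree t) = parent t"
  "tgt (tree t) = (\<lambda>i. i)" "label (tree t) = letter t" "start (tree t) = 0" "finish (tree t) = fin t"
  by (simp_all add: tree_def)

lemma fin_Mul: "fin (Mul s t) = shift s (fin t)"
  by (simp add: shift_def)

lemma fin_le: "fin t \<le> gens t"
  by (induction t) (auto intro: trans_le_add1)

lemma parent_less: "0 < i \<Longrightarrow> i \<le> gens t \<Longrightarrow> parent t i < i"
proof (induction t arbitrary: i)
  case (Mul s t)
  show ?case
  proof (cases "i \<le> gens s")
    case False
    then have "parent t (i - gens s) < i - gens s" using Mul by simp
    then show ?thesis using False fin_le[of s] by (auto simp: shift_def)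
  qed (use Mul in simp)
qed auto

lemma letter_in: "0 < i \<Longrightarrow> i \<le> gens t \<Longrightarrow> letter t i \<in> set_lad_term t"
  by (induction t arbitrary: i) (auto simp: not_le)

lemma tree_treelike:
  assumes "set_lad_term t \<subseteq> X" shows "treelike X (tree t)"
proof -
  interpret wf_digraph "dg (tree t)"
    using parent_less[of _ t] by unfold_locales (auto intro!: less_imp_le less_le_trans[OF parent_less])
  have "reach (tree t) 0 v" if "v \<le> gens t" for v
    using that
  proof (induction v rule: less_induct)
    case (less v)
    show ?case
    proof (cases "v = 0")
      case True
      then show ?thesis by (auto intro!: reachable_refl)
    next
      case False
      then have "parent t v < v" using less.prems parent_less by blast
      then have "reach (tree t) 0 (parent t v)" using less by simp
      moreover have "(parent t v, v) \<in> arcs_ends (dg (tree t))"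
        using in_arcs_imp_in_arcs_ends[of v] False less.prems by simp
      ultimately show ?thesis by (meson reachable_adj_trans)
    qed
  qed
  then have "is_xgraph X (tree t)" unfolding is_xgraph_def
    using assms letter_in[of _ t] fin_le[of t] wf_digraph
    by (auto intro!: fin_digraphI)
  then show ?thesis by (simp add: treelike_def)
qed

lemma is_xgraph_tree: "set_lad_term t \<subseteq> X \<Longrightarrow> is_xgraph X (tree t)"
  using tree_treelike by (auto simp: treelike_def)

lemma wf_tree: "wfg (tree t)"
  using is_xgraphD(1)[OF is_xgraph_tree[of t UNIV]] by simp

lemma tree_Plus: "tree (Plus s) = ends (tree s) 0 0"
  by (simp add: tree_def ends_def)

lemma morphism_tree_left:
  "morphism (ends (tree s) a b) (ends (tree (Mul s t)) a b) id id"
  unfolding morphism_def by auto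

lemma morphism_tree_right:
  "morphism (ends (tree t) a b) (ends (tree (Mul s t)) (shift s a) (shift s b)) (shift s) (shift s)"
  using fin_le[of s] unfolding morphism_def by (auto simp: shift_def)

lemma sem_tree: "sem (tree t) t 0 (fin t)"
proof (induction t)
  case (Mul s t)
  have "sem (tree (Mul s t)) s 0 (fin s)"
    using sem_morphism[OF morphism_tree_left, of s 0 "fin s" s 0 "fin s" t] Mul by simp
  moreover have "sem (tree (Mul s t)) t (shift s 0) (shift s (fin t))"
    using sem_morphism[OF morphism_tree_right[of t 0 "fin t" s], of t 0 "fin t"] Mul by simp
  ultimately show ?case unfolding fin_Mul by (auto simp: shift_def)
next
  case (Plus s)
  then show ?case by (auto simp: tree_Plus)
qed auto

lemma morphism_from_tree:
  assumes "wfg H" "sem H t a b"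
  obtains f g where "morphism (tree t) (ends H a b) f g"
proof -
  have "\<exists>f g. morphism (tree t) (ends H a b) f g" using assms(2)
  proof (induction t arbitrary: a b)
    case (Gen x)
    then obtain e where "e \<in> Arcs H" "src H e = a" "tgt H e = b" "label H e = x" by auto
    then show ?case using sem_in_verts[OF assms(1) Gen]
      by (intro exI[of _ "\<lambda>i. if i = 0 then a else b"] exI[of _ "\<lambda>_. e"]) (auto simp: morphism_def)
  next
    case Unit
    then show ?case by (intro exI[of _ "\<lambda>_. a"] exI) (auto simp: morphism_def)
  next
    case (Mul s t)
    then obtain c where c: "sem H s a c" "sem H t c b" by auto
    obtain f g where m: "morphism (tree s) (ends H a c) f g" using Mul.IH(1)[OF c(1)] by blast
    obtain f' g' where m': "morphism (tree t) (ends H c b) f' g'" using Mul.IH(2)[OF c(2)] by blast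
    note M = morphismD[OF m, simplified] and M' = morphismD[OF m', simplified]
    let ?f = "\<lambda>i. if i \<le> gens s then f i else f' (i - gens s)"
    let ?g = "\<lambda>i. if i \<le> gens s then g i else g' (i - gens s)"
    have pos: "Suc 0 \<le> i - gens s \<and> i - gens s \<le> gens t" if "\<not> i \<le> gens s" "i \<le> gens s + gens t" for i
      using that by auto
    have fs: "?f (shift s j) = f' j" for j
      using M(4) M'(3) fin_le[of s] by (auto simp: shift_def)
    have fp: "?f (parent s i) = f (parent s i)" if "0 < i" "i \<le> gens s" for i
      using parent_less[OF that] that by simp
    have "morphism (tree (Mul s t)) (ends H a b) ?f ?g"
      unfolding morphism_def
    proof (intro conjI ballI image_subsetI)
      show "?f (finish (tree (Mul s t))) = finish (ends H a b)"
        using fs[of "fin t"] M'(4) unfolding tree_simps ends_simps fin_Mul by argo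
    next
      fix i assume i: "i \<in> Arcs (tree (Mul s t))"
      show "src (ends H a b) (?g i) = ?f (src (tree (Mul s t)) i)"
      proof (cases "i \<le> gens s")
        case True
        then show ?thesis using i M(6)[of i] fp[of i] by (simp split: if_splits)
      next
        case False
        then have "Suc 0 \<le> i - gens s \<and> i - gens s \<le> gens t" using i by auto
        then show ?thesis using False M'(6)[of "i - gens s"] fs[of "parent t (i - gens s)"] by (simp split: if_splits)
      qed
    qed (use M M' pos in \<open>auto split: if_splits\<close>)
    then show ?case by blast
  next
    case (Plus s)
    then obtain c where c: "a = b" "sem H s a c" by auto
    obtain f g where m: "morphism (tree s) (ends H a c) f g" using Plus.IH[OF c(2)] by blast
    then have "morphism (tree (Plus s)) (ends H a b) f g" using c(1)
      unfolding morphism_def by auto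
    then show ?case by blast
  qed
  then show ?thesis using that by blast
qed

text \<open>
  The root and the finish vertex are related by \<open>t\<close> in the tree of \<open>t\<close> itself, and morphisms preserve
  this; conversely a morphism is assembled along the structure of \<open>t\<close>.
\<close>
lemma maps_to_tree_iff:
  assumes "wfg H" shows "maps_to (tree t) (ends H a b) \<longleftrightarrow> sem H t a b"
proof
  assume "maps_to (tree t) (ends H a b)"
  then obtain f g where m: "morphism (tree t) (ends H a b) f g" by (auto simp: maps_to_def)
  from sem_morphism[OF this sem_tree] show "sem H t a b"
    using morphismD(3,4)[OF m] by simp
next
  assume "sem H t a b"
  then show "maps_to (tree t) (ends H a b)"
    using morphism_from_tree[OF assms] unfolding maps_to_def by metis
qed

lemma ends_self [simp]: "ends H (start H) (finish H) = H"
  by (simp add: ends_def)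

lemma maps_to_tree_iff':
  "wfg H \<Longrightarrow> maps_to (tree t) H \<longleftrightarrow> sem H t (start H) (finish H)"
  using maps_to_tree_iff[of H t "start H" "finish H"] by simp


subsection \<open>Every tree comes from a term\<close>

text \<open>
  A part that has lost the finish vertex gets its root instead; the choice is immaterial because the
  term of such a part occurs under \<open>Plus\<close>.
\<close>
definition restrict_graph ::
  "('v, 'e, 'x) xgraph \<Rightarrow> 'v set \<Rightarrow> 'e set \<Rightarrow> 'v \<Rightarrow> ('v, 'e, 'x) xgraph" where
  "restrict_graph G V A r = G\<lparr>dg := (dg G)\<lparr>verts := V, arcs := A\<rparr>, start := r,
     finish := if finish G \<in> V then finish G else r\<rparr>"

lemma restrict_graph_simps [simp]:
  "Verts (restrict_graph G V A r) = V" "Arcs (restrict_graph G V A r) = A"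
  "src (restrict_graph G V A r) = src G" "tgt (restrict_graph G V A r) = tgt G"
  "label (restrict_graph G V A r) = label G" "start (restrict_graph G V A r) = r"
  "finish (restrict_graph G V A r) = (if finish G \<in> V then finish G else r)"
  by (simp_all add: restrict_graph_def)

lemma treelike_restrict:
  assumes T: "treelike X G" and sub: "V \<subseteq> Verts G" "A \<subseteq> Arcs G" "r \<in> V"
    and ends: "\<And>e. e \<in> A \<Longrightarrow> src G e \<in> V \<and> tgt G e \<in> V \<and> tgt G e \<noteq> r"
    and reach: "\<And>v. v \<in> V \<Longrightarrow> reach G r v"
    and convex: "\<And>e. e \<in> Arcs G \<Longrightarrow> reach G r (src G e) \<Longrightarrow> tgt G e \<in> V \<Longrightarrow>
      src G e \<in> V \<and> e \<in> A"
  shows "treelike X (restrict_graph G V A r)"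
proof -
  let ?R = "restrict_graph G V A r"
  have x: "is_xgraph X G" using T by (simp add: treelike_def)
  note G = is_xgraphD[OF x]
  interpret G: wf_digraph "dg G" by (rule G)
  interpret R: wf_digraph "dg ?R" by unfold_locales (use ends in auto)
  have "v \<in> V \<longrightarrow> reach ?R r v" if "reach G r v" for v
    using that
  proof (induction rule: G.reachable_induct)
    case base
    then show ?case using sub(3) by auto
  next
    case (step y z)
    from step(2) obtain e where e: "e \<in> Arcs G" "src G e = y" "tgt G e = z" by auto
    show ?case
    proof
      assume "z \<in> V"
      then have y: "y \<in> V" "e \<in> A" using convex[OF e(1)] e step(1) by auto
      then have "(y, z) \<in> arcs_ends (dg ?R)" using R.in_arcs_imp_in_arcs_ends[of e] e by simp
      then show "reach ?R r z" using step.IH y by (meson R.reachable_adj_trans)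
    qed
  qed
  then have "is_xgraph X ?R" unfolding is_xgraph_def
    using sub G(2,3,6) R.wf_digraph reach finite_subset[OF sub(1)] finite_subset[OF sub(2)]
    by (auto intro!: R.fin_digraphI) blast
  then show ?thesis using T sub(2) ends unfolding treelike_def by (auto intro: inj_on_subset)
qed

text \<open>
  An edge at the root splits a tree into the subtree above this edge and the rest; the part without
  the finish vertex contributes a factor of the form \<open>Plus\<close>.
\<close>
lemma treelike_term:
  fixes G :: "('v, 'e, 'x) xgraph"
  assumes "treelike X G"
  shows "\<exists>t. set_lad_term t \<subseteq> X \<and> sem G t (start G) (finish G) \<and>
    (\<forall>(H :: (nat, nat, 'x) xgraph) a b. wfg H \<longrightarrow> sem H t a b \<longrightarrow> maps_to G (ends H a b))"
  using assms
proof (induction "card (Arcs G)" arbitrary: G rule: less_induct)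
  case less
  have x: "is_xgraph X G" and inj: "inj_on (tgt G) (Arcs G)"
    and root: "\<And>e. e \<in> Arcs G \<Longrightarrow> tgt G e \<noteq> start G"
    using less.prems by (auto simp: treelike_def)
  note G = is_xgraphD[OF x]
  interpret G: wf_digraph "dg G" by (rule G)
  show ?case
  proof (cases "\<exists>e\<in>Arcs G. src G e = start G")
    case False
    have "v = start G" if "v \<in> Verts G" for v
      using G(7)[OF that] False by (cases rule: G.converse_reachable_cases) auto
    then have "Verts G = {start G}" "finish G = start G" using G(4) G(5) by blast+
    moreover then have "Arcs G = {}" using False G.tail_in_verts by auto
    moreover have "maps_to G (ends H a b)" if "sem H Unit a b" for H :: "(nat, nat, 'x) xgraph" and a b
      unfolding maps_to_def morphism_def using that calculation by (intro exI[of _ "\<lambda>_. a"] exI) auto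
    ultimately show ?thesis by (intro exI[of _ Unit]) auto
  next
    case True
    then obtain e where e: "e \<in> Arcs G" "src G e = start G" by blast
    define h where "h = tgt G e"
    define S where "S = {v. reach G h v}"
    define T1 where "T1 = restrict_graph G S {a \<in> Arcs G. src G a \<in> S} h"
    define T2 where "T2 = restrict_graph G (Verts G - S) {a \<in> Arcs G. src G a \<notin> S \<and> a \<noteq> e} (start G)"
    have hV: "h \<in> Verts G" using e by (simp add: h_def)
    have hS: "h \<in> S" using hV by (auto simp: S_def)
    have up: "tgt G a \<in> S" if "a \<in> Arcs G" "src G a \<in> S" for a
      using that G.in_arcs_imp_in_arcs_ends[of a] unfolding S_def by (auto intro: G.reachable_adj_trans)
    \<comment> \<open>The edge \<open>e\<close> is the only way into the upper part, since no vertex has two incoming edges.\<close>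
    have down: "src G a \<in> S" if a: "a \<in> Arcs G" "tgt G a \<in> S" "a \<noteq> e" for a
    proof -
      have "h \<noteq> tgt G a" using inj a e unfolding h_def by (metis inj_onD)
      moreover have "reach G h (tgt G a)" using a(2) by (simp add: S_def)
      ultimately obtain z where z: "reach G h z" "z \<rightarrow>\<^bsub>dg G\<^esub> tgt G a"
        by (metis rtrancl_on.cases reachable_def)
      from z(2) obtain a' where a': "a' \<in> Arcs G" "src G a' = z" "tgt G a' = tgt G a" by auto
      then have "a' = a" using inj a by (metis inj_onD)
      then show ?thesis using a' z(1) by (simp add: S_def)
    qed
    have sS: "start G \<notin> S"
    proof
      assume "start G \<in> S"
      then have "reach G h (start G)" by (simp add: S_def)
      moreover have "h \<noteq> start G" using root[OF e(1)] by (simp add: h_def)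
      ultimately obtain z where "z \<rightarrow>\<^bsub>dg G\<^esub> start G" by (metis rtrancl_on.cases reachable_def)
      then show False using root by auto
    qed
    have SV: "S \<subseteq> Verts G" using G.reachable_in_verts by (auto simp: S_def)
    obtain rk :: "'v \<Rightarrow> nat" where rk: "\<And>a. a \<in> Arcs G \<Longrightarrow> rk (tgt G a) = Suc (rk (src G a))"
      using treelike_rank[OF less.prems] by metis
    have rmono: "rk h \<le> rk v" if "reach G h v" for v
      using that by (induction rule: G.reachable_induct) (auto simp: rk)
    have t1: "treelike X T1" unfolding T1_def
    proof (rule treelike_restrict[OF less.prems SV _ hS])
      fix a assume "a \<in> {a \<in> Arcs G. src G a \<in> S}"
      then show "src G a \<in> S \<and> tgt G a \<in> S \<and> tgt G a \<noteq> h"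
        using up rmono[of "src G a"] rk[of a] by (auto simp: S_def)
    qed (auto simp: S_def)
    have t2: "treelike X T2" unfolding T2_def
    proof (rule treelike_restrict[OF less.prems])
      fix a assume "a \<in> {a \<in> Arcs G. src G a \<notin> S \<and> a \<noteq> e}"
      then show "src G a \<in> Verts G - S \<and> tgt G a \<in> Verts G - S \<and> tgt G a \<noteq> start G"
        using down root by auto
    next
      fix a assume "a \<in> Arcs G" "tgt G a \<in> Verts G - S"
      then show "src G a \<in> Verts G - S \<and> a \<in> {a \<in> Arcs G. src G a \<notin> S \<and> a \<noteq> e}"
        using up hS by (auto simp: h_def)
    qed (use G(4,7) sS in auto)
    have "e \<notin> Arcs T1" "Arcs T1 \<subseteq> Arcs G" using e sS by (auto simp: T1_def)
    then have c1: "card (Arcs T1) < card (Arcs G)"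
      using e(1) by (intro psubset_card_mono G(3)) blast
    have c2: "card (Arcs T2) < card (Arcs G)" unfolding T2_def
      using e by (intro psubset_card_mono G(3)) auto
    obtain s1 where s1: "set_lad_term s1 \<subseteq> X" "sem T1 s1 (start T1) (finish T1)"
      "\<And>(H :: (nat, nat, 'x) xgraph) a b. wfg H \<Longrightarrow> sem H s1 a b \<Longrightarrow> maps_to T1 (ends H a b)"
      using less.hyps[OF c1 t1] by blast
    obtain s2 where s2: "set_lad_term s2 \<subseteq> X" "sem T2 s2 (start T2) (finish T2)"
      "\<And>(H :: (nat, nat, 'x) xgraph) a b. wfg H \<Longrightarrow> sem H s2 a b \<Longrightarrow> maps_to T2 (ends H a b)"
      using less.hyps[OF c2 t2] by blast
    have i1: "morphism (ends T1 a b) (ends G a b) id id" for a b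
      unfolding T1_def morphism_def using SV by auto
    have i2: "morphism (ends T2 a b) (ends G a b) id id" for a b
      unfolding T2_def morphism_def by auto
    have g1: "sem G s1 h (finish T1)"
      using sem_morphism[OF i1[of h h], of s1 "start T1" "finish T1"] s1(2) by (simp add: T1_def)
    have g2: "sem G s2 (start G) (finish T2)"
      using sem_morphism[OF i2[of h h], of s2 "start T2" "finish T2"] s2(2) by (simp add: T2_def)
    have ge: "sem G (Gen (label G e)) (start G) h" using e by (auto simp: h_def)
    have glue: "maps_to G (ends H a (if finish G \<in> S then d1 else d2))"
      if H: "wfg H" "sem H (Gen (label G e)) a c" "sem H s1 c d1" "sem H s2 a d2"
      for H :: "(nat, nat, 'x) xgraph" and a c d1 d2
    proof -
      obtain f1 g1 where m1: "morphism T1 (ends H c d1) f1 g1"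
        using s1(3)[OF H(1,3)] by (auto simp: maps_to_def)
      obtain f2 g2 where m2: "morphism T2 (ends H a d2) f2 g2"
        using s2(3)[OF H(1,4)] by (auto simp: maps_to_def)
      obtain eh where eh: "eh \<in> Arcs H" "src H eh = a" "tgt H eh = c" "label H eh = label G e"
        using H(2) by auto
      note M1 = morphismD[OF m1, unfolded T1_def, simplified] and M2 = morphismD[OF m2, unfolded T2_def, simplified]
      let ?f = "\<lambda>v. if v \<in> S then f1 v else f2 v"
      let ?g = "\<lambda>a. if a = e then eh else if src G a \<in> S then g1 a else g2 a"
      have "morphism G (ends H a (if finish G \<in> S then d1 else d2)) ?f ?g"
        unfolding morphism_def
      proof (intro conjI ballI image_subsetI)
        fix b assume b: "b \<in> Arcs G"
        show "src (ends H a (if finish G \<in> S then d1 else d2)) (?g b) = ?f (src G b)"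
          using b M1(6) M2(6) eh e sS M2(3) by auto
        show "tgt (ends H a (if finish G \<in> S then d1 else d2)) (?g b) = ?f (tgt G b)"
          using b M1(7)[of b] M2(7)[of b] eh e hS M1(3) up[of b] down[of b] by (auto simp: h_def[symmetric])
        show "?g b \<in> Arcs (ends H a (if finish G \<in> S then d1 else d2))"
          using b M1(2) M2(2) eh by auto
        show "label (ends H a (if finish G \<in> S then d1 else d2)) (?g b) = label G b"
          using b M1(5) M2(5) eh by auto
      qed (use M1 M2 sS G(5) in auto)
      then show ?thesis unfolding maps_to_def by (intro exI)
    qed
    show ?thesis
    proof (cases "finish G \<in> S")
      case True
      then have "finish T1 = finish G" by (simp add: T1_def)
      then have "sem G (Mul (Plus s2) (Mul (Gen (label G e)) s1)) (start G) (finish G)"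
        using g1 g2 ge unfolding sem.simps(3,4) by metis
      moreover have "maps_to G (ends H a b)"
        if H: "wfg H" "sem H (Mul (Plus s2) (Mul (Gen (label G e)) s1)) a b" for H :: "(nat, nat, 'x) xgraph" and a b
      proof -
        obtain c d where "sem H (Gen (label G e)) a c" "sem H s1 c b" "sem H s2 a d"
          using H(2) unfolding sem.simps(3,4) by blast
        from glue[OF H(1) this] show ?thesis using True by simp
      qed
      ultimately show ?thesis using s1(1) s2(1) G(6) e(1)
        by (intro exI[of _ "Mul (Plus s2) (Mul (Gen (label G e)) s1)"]) (auto simp del: sem.simps)
    next
      case False
      then have "finish T2 = finish G" using G(5) by (simp add: T2_def)
      then have "sem G (Mul (Plus (Mul (Gen (label G e)) s1)) s2) (start G) (finish G)"
        using g1 g2 ge unfolding sem.simps(3,4) by metis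
      moreover have "maps_to G (ends H a b)"
        if H: "wfg H" "sem H (Mul (Plus (Mul (Gen (label G e)) s1)) s2) a b" for H :: "(nat, nat, 'x) xgraph" and a b
      proof -
        obtain c d where "sem H (Gen (label G e)) a c" "sem H s1 c d" "sem H s2 a b"
          using H(2) unfolding sem.simps(3,4) by blast
        from glue[OF H(1) this] show ?thesis using False by simp
      qed
      ultimately show ?thesis using s1(1) s2(1) G(6) e(1)
        by (intro exI[of _ "Mul (Plus (Mul (Gen (label G e)) s1)) s2"]) (auto simp del: sem.simps)
    qed
  qed
qed


section \<open>Values of walks in a right cancellative monoid\<close>

locale right_cancellative_labels = monoid C for C :: "('c, 'd) monoid_scheme" (structure) +
  fixes \<gamma> :: "'x \<Rightarrow> 'c" and X :: "'x set"
  assumes gamma: "x \<in> X \<Longrightarrow> \<gamma> x \<in> carrier C"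
    and right_cancellative: "right_cancellative C"
begin

lemma right_cancel:
  "a \<in> carrier C \<Longrightarrow> b \<in> carrier C \<Longrightarrow> c \<in> carrier C \<Longrightarrow> a \<otimes> c = b \<otimes> c \<Longrightarrow> a = b"
  using right_cancellative by (auto simp: right_cancellative_def)

lemma left_inverse_right_inverse:
  assumes "a \<in> carrier C" "b \<in> carrier C" "a \<otimes> b = \<one>" shows "b \<otimes> a = \<one>"
proof (rule right_cancel[of _ _ b])
  show "b \<otimes> a \<otimes> b = \<one> \<otimes> b" using assms by (simp add: m_assoc)
qed (use assms in auto)

abbreviation "cval \<equiv> wwalk C \<gamma> (\<lambda>_. \<one>)"

lemma weighted_cval:
  assumes "wfg G" "label G ` Arcs G \<subseteq> X" shows "weighted C \<gamma> (\<lambda>_. \<one>) G"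
proof -
  interpret wf_digraph "dg G" by fact
  show ?thesis by unfold_locales (use assms gamma in auto)
qed

lemma cval_start: "a \<in> Verts G \<Longrightarrow> cval G a \<one> a"
  by (rule wwalk.start)

lemma cval_arc:
  assumes "wfg G" "label G ` Arcs G \<subseteq> X" "e \<in> Arcs G"
  shows "cval G (src G e) (\<gamma> (label G e)) (tgt G e)"
  using wwalk.step[OF cval_start assms(3)] wf_digraph.tail_in_verts[OF assms(1,3)] assms(2,3) gamma
  by (auto simp: image_subset_iff)

lemma word_val_closed: "set w \<subseteq> X \<Longrightarrow> word_val C \<gamma> w \<in> carrier C"
  by (induction w) (auto simp: word_val_def gamma)

lemma word_val_append:
  "set v \<subseteq> X \<Longrightarrow> set w \<subseteq> X \<Longrightarrow> word_val C \<gamma> (v @ w) = word_val C \<gamma> v \<otimes> word_val C \<gamma> w"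
  by (induction v) (auto simp: word_val_def gamma m_assoc word_val_closed[unfolded word_val_def])

lemma cval_iff_awalk:
  assumes "wfg G" "label G ` Arcs G \<subseteq> X"
  shows "cval G a m b \<longleftrightarrow> (\<exists>p. pre_digraph.awalk (dg G) a p b \<and> word_val C \<gamma> (map (label G) p) = m)"
proof
  interpret weighted C \<gamma> "\<lambda>_. \<one>" G by (rule weighted_cval) fact+
  assume "cval G a m b"
  then show "\<exists>p. G.awalk a p b \<and> word_val C \<gamma> (map (label G) p) = m"
  proof induction
    case start
    then show ?case by (intro exI[of _ "[]"]) (simp add: G.awalk_Nil_iff word_val_def)
  next
    case (step m e)
    then obtain p where p: "G.awalk a p (src G e)" "word_val C \<gamma> (map (label G) p) = m" by blast
    then have "set p \<subseteq> Arcs G" by (auto simp: G.awalk_def)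
    moreover have "word_val C \<gamma> [label G e] = \<gamma> (label G e)"
      using step.hyps(2) by (simp add: word_val_def rho)
    ultimately have "word_val C \<gamma> (map (label G) (p @ [e])) = m \<otimes> \<gamma> (label G e)"
      using word_val_append[of "map (label G) p" "[label G e]"] assms(2) step.hyps(2) p(2) by auto
    moreover have "G.awalk a (p @ [e]) (tgt G e)"
      using G.awalk_appendI[OF p(1) G.arc_implies_awalk[OF step.hyps(2)]] .
    ultimately show ?case
      using W_closed[OF step.hyps(1)] step.hyps(2) rho[of e] by (intro exI[of _ "p @ [e]"]) auto
  qed
next
  interpret weighted C \<gamma> "\<lambda>_. \<one>" G by (rule weighted_cval) fact+
  assume "\<exists>p. G.awalk a p b \<and> word_val C \<gamma> (map (label G) p) = m"
  then obtain p where p: "G.awalk a p b" "m = word_val C \<gamma> (map (label G) p)" by blast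
  have "cval G a (word_val C \<gamma> (map (label G) p)) b" if "G.awalk a p b" for a b p
    using that
  proof (induction p arbitrary: a)
    case Nil
    then show ?case using cval_start[of a G] by (auto simp: G.awalk_Nil_iff word_val_def)
  next
    case (Cons e p)
    then have e: "e \<in> Arcs G" "src G e = a" "G.awalk (tgt G e) p b"
      by (auto simp: G.awalk_Cons_iff)
    from W_trans[OF cval_arc[OF assms e(1)] Cons.IH[OF e(3)]] show ?case
      using e(2) by (simp add: word_val_def)
  qed
  then show "cval G a m b" using p by simp
qed

lemma idempath_cval:
  assumes "wfg G" "label G ` Arcs G \<subseteq> X"
  shows "(\<exists>p. idempath C \<gamma> G u p v) \<longleftrightarrow> cval G u \<one> v"
  using cval_iff_awalk[OF assms] by (auto simp: idempath_def)

lemma idempath_identified_cval: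
  assumes "idempath_identified C \<gamma> G" "wfg G" "label G ` Arcs G \<subseteq> X" "cval G u \<one> v" shows "u = v"
proof -
  obtain p where "idempath C \<gamma> G u p v" using assms(4) idempath_cval[OF assms(2,3)] by metis
  then show ?thesis using assms(1) unfolding idempath_identified_def by metis
qed

text \<open>
  Right cancellativity enters here: the value of a walk in a descendant of a tree depends only on
  the ends of the walk, since a one-sided inverse created by an identification is two-sided.
\<close>
lemma descendant_invariants:
  assumes T: "treelike X T" and d: "descendant C \<gamma> T G"
  shows "functional C \<gamma> (\<lambda>_. \<one>) G \<and> ancestors_comparable G"
proof -
  have x: "is_xgraph X T" using T by (simp add: treelike_def)
  show ?thesis using d x
  proof (induction rule: descendant_induct)
    case base
    have "weighted C \<gamma> (\<lambda>_. \<one>) T" using is_xgraphD[OF x] by (intro weighted_cval)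
    then show ?case using treelike_functional[OF T] treelike_ancestors_comparable[OF T] by simp
  next
    case (step H u p v)
    note H = is_xgraphD[OF step(2)]
    interpret weighted C \<gamma> "\<lambda>_. \<one>" H using H by (intro weighted_cval)
    have uv: "W u \<one> v" using idempath_cval[OF H(1,6)] step.hyps(3) by metis
    have f: "functional C \<gamma> (\<lambda>_. \<one>) H" and c: "ancestors_comparable H" using step.IH by auto
    have "m \<otimes> n = \<one>" if "W a m v" "W u n a" for a m n
    proof (rule left_inverse_right_inverse)
      show "n \<otimes> m = \<one>" using functionalD[OF f W_trans[OF that(2,1)] uv] .
    qed (use W_closed that in auto)
    then show ?case
      using functional_identify[OF uv refl f c] ancestors_comparable_identify[OF uv refl f c] by simp
  qed
qed

text \<open>The value of the label of the path from the start vertex to the finish vertex.\<close>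
primrec trunk_val :: "'x lad_term \<Rightarrow> 'c" where
  "trunk_val (Gen x) = \<gamma> x"
| "trunk_val Unit = \<one>"
| "trunk_val (Mul s t) = trunk_val s \<otimes> trunk_val t"
| "trunk_val (Plus s) = \<one>"

lemma trunk_val_closed: "set_lad_term t \<subseteq> X \<Longrightarrow> trunk_val t \<in> carrier C"
  by (induction t) (auto simp: gamma)

lemma sem_cval:
  assumes "wfg G" "label G ` Arcs G \<subseteq> X" "sem G t a b"
  shows "cval G a (trunk_val t) b"
  using assms(3)
proof (induction t arbitrary: a b)
  case (Gen x)
  then show ?case using cval_arc[OF assms(1,2)] by auto
next
  case Unit
  then show ?case using cval_start by auto
next
  case (Mul s t)
  interpret weighted C \<gamma> "\<lambda>_. \<one>" G by (rule weighted_cval) fact+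
  from Mul obtain c where "sem G s a c" "sem G t c b" by auto
  then show ?case using W_trans[OF Mul.IH(1) Mul.IH(2)] by simp
next
  case (Plus s)
  then have "a \<in> Verts G" "b = a" using sem_in_verts[OF assms(1) Plus.prems] by auto
  then show ?case using cval_start by simp
qed


section \<open>Equality of terms in the pretzel monoid\<close>

definition good :: "('v, 'e, 'x) xgraph \<Rightarrow> bool" where
  "good H \<longleftrightarrow> wfg H \<and> label H ` Arcs H \<subseteq> X \<and> idempath_identified C \<gamma> H"

abbreviation "cl t \<equiv> closure C \<gamma> (tree t)"

abbreviation "terms \<equiv> carrier (term_alg X)"

lemma terms_iff [simp]: "t \<in> terms \<longleftrightarrow> set_lad_term t \<subseteq> X"
  by (simp add: term_alg_def)

lemma cl_props:
  assumes "t \<in> terms"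
  shows "is_xgraph X (cl t)" "maps_to (tree t) (cl t)" "idempath_identified C \<gamma> (cl t)" "good (cl t)"
    "sem (cl t) t (start (cl t)) (finish (cl t))"
    "functional C \<gamma> (\<lambda>_. \<one>) (cl t)" "ancestors_comparable (cl t)"
proof -
  have tr: "treelike X (tree t)" and x: "is_xgraph X (tree t)"
    using assms tree_treelike is_xgraph_tree by auto
  show c: "is_xgraph X (cl t)" "maps_to (tree t) (cl t)" "idempath_identified C \<gamma> (cl t)"
    using closure_props[OF x] closure_descendant[OF x] by auto
  then show "good (cl t)" using is_xgraphD[OF c(1)] by (simp add: good_def)
  show "sem (cl t) t (start (cl t)) (finish (cl t))"
    using maps_to_tree_iff' is_xgraphD[OF c(1)] c(2) by blast
  show "functional C \<gamma> (\<lambda>_. \<one>) (cl t)" "ancestors_comparable (cl t)"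
    using descendant_invariants[OF tr closure_descendant(1)[OF x]] by auto
qed

text \<open>
  By its universal property, the closure of the tree of \<open>t\<close> is the generic identified graph with a
  pair of vertices related by \<open>t\<close>.
\<close>
lemma maps_to_cl:
  assumes "t \<in> terms" "good H" "sem H t a b" shows "maps_to (cl t) (ends H a b)"
proof -
  have "maps_to (tree t) (ends H a b)" using maps_to_tree_iff[of H t a b] assms by (simp add: good_def)
  moreover have "idempath_identified C \<gamma> (ends H a b)"
    using assms(2) by (simp add: good_def idempath_identified_def idempath_def)
  ultimately show ?thesis using maps_to_closure_lift is_xgraph_tree assms(1) terms_iff by blast
qed

text \<open>
  Graphs on natural numbers are enough here, because the closure of the tree of a term is one of
  them.
\<close>
definition sub :: "'x lad_term \<Rightarrow> 'x lad_term \<Rightarrow> bool" where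
  "sub t s \<longleftrightarrow> (\<forall>(H :: (nat, nat, 'x) xgraph) a b. good H \<longrightarrow> sem H t a b \<longrightarrow> sem H s a b)"

lemma sub_iff:
  assumes "t \<in> terms" shows "sub t s \<longleftrightarrow> sem (cl t) s (start (cl t)) (finish (cl t))"
proof
  assume "sub t s"
  then show "sem (cl t) s (start (cl t)) (finish (cl t))"
    using cl_props(4,5)[OF assms] unfolding sub_def by blast
next
  assume s: "sem (cl t) s (start (cl t)) (finish (cl t))"
  have "sem H s a b" if H: "good H" "sem H t a b" for H :: "(nat, nat, 'x) xgraph" and a b
  proof -
    obtain f g where m: "morphism (cl t) (ends H a b) f g"
      using maps_to_cl[OF assms H] by (auto simp: maps_to_def)
    show ?thesis using sem_morphism[OF m s] morphismD(3,4)[OF m] by simp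
  qed
  then show "sub t s" by (simp add: sub_def)
qed

definition sim :: "'x lad_term \<Rightarrow> 'x lad_term \<Rightarrow> bool" where
  "sim t s \<longleftrightarrow> (\<forall>H :: (nat, nat, 'x) xgraph. good H \<longrightarrow> sem H t = sem H s)"

lemma sim_iff_sub: "sim t s \<longleftrightarrow> sub t s \<and> sub s t"
  unfolding sim_def sub_def by (auto simp: fun_eq_iff)

lemma pretzel_tree_eq_iff:
  assumes "t \<in> terms" "s \<in> terms"
  shows "pretzel C \<gamma> (tree t) = pretzel C \<gamma> (tree s) \<longleftrightarrow> sim t s"
proof -
  have xt: "is_xgraph X (tree t)" and xs: "is_xgraph X (tree s)" using assms is_xgraph_tree by auto
  note ct = cl_props[OF assms(1)] and cs = cl_props[OF assms(2)]
  show ?thesis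
  proof
    assume "pretzel C \<gamma> (tree t) = pretzel C \<gamma> (tree s)"
    then have iso: "xisomorphic (core (cl t)) (core (cl s))" by (rule pretzel_eqD[OF xt xs])
    have "maps_to (tree t) (cl s)"
      using maps_to_trans[OF ct(2)] core_props(3)[OF ct(1)] core_props(4)[OF cs(1)]
        xisomorphic_maps_to[OF iso] maps_to_trans by blast
    moreover have "maps_to (tree s) (cl t)"
      using maps_to_trans[OF cs(2)] core_props(3)[OF cs(1)] core_props(4)[OF ct(1)]
        xisomorphic_maps_to[OF xisomorphic_sym[OF iso core_props(1)[OF ct(1)]]] maps_to_trans by blast
    ultimately show "sim t s" unfolding sim_iff_sub sub_iff[OF assms(1)] sub_iff[OF assms(2)]
      using maps_to_tree_iff' is_xgraphD(1)[OF ct(1)] is_xgraphD(1)[OF cs(1)] by blast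
  next
    assume "sim t s"
    then have "maps_to (tree t) (cl s)" "maps_to (tree s) (cl t)"
      unfolding sim_iff_sub sub_iff[OF assms(1)] sub_iff[OF assms(2)]
      using maps_to_tree_iff' is_xgraphD(1)[OF ct(1)] is_xgraphD(1)[OF cs(1)] by blast+
    then show "pretzel C \<gamma> (tree t) = pretzel C \<gamma> (tree s)" by (rule pretzel_eqI[OF xt xs])
  qed
qed


subsection \<open>The pretzel monoid is left adequate\<close>

lemma sim_trunk_val:
  assumes "t \<in> terms" "s \<in> terms" "sim t s" shows "trunk_val t = trunk_val s"
proof -
  note c = cl_props[OF assms(1)] and X = is_xgraphD[OF cl_props(1)[OF assms(1)]]
  have "sem (cl t) s (start (cl t)) (finish (cl t))"
    using c(5) assms(3) c(4) by (auto simp: sim_def)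
  then have "cval (cl t) (start (cl t)) (trunk_val t) (finish (cl t))"
    "cval (cl t) (start (cl t)) (trunk_val s) (finish (cl t))"
    using sem_cval[OF X(1,6)] c(5) by blast+
  then show ?thesis using c(6) unfolding functional_def by blast
qed

lemma sim_Plus_of_trunk_val_one:
  assumes "trunk_val t = \<one>" shows "sim t (Plus t)"
proof -
  have "sem H t = sem H (Plus t)" if "good H" for H :: "(nat, nat, 'x) xgraph"
  proof -
    have "a = b" if "sem H t a b" for a b
      using sem_cval[OF _ _ that] idempath_identified_cval[of H a b] \<open>good H\<close> assms by (auto simp: good_def)
    then show ?thesis by (fastforce simp: fun_eq_iff)
  qed
  then show ?thesis by (simp add: sim_def)
qed

text \<open>
  An idempotent of the pretzel monoid has trivial trunk value by right cancellation, so its graph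
  has the same start and finish vertex.
\<close>
lemma sim_Plus_of_idempotent:
  assumes "t \<in> terms" "sim (Mul t t) t" shows "sim t (Plus t)"
proof (rule sim_Plus_of_trunk_val_one)
  have c: "trunk_val t \<in> carrier C" using assms trunk_val_closed by simp
  have "trunk_val t \<otimes> trunk_val t = \<one> \<otimes> trunk_val t"
    using sim_trunk_val[of "Mul t t" t] assms c by simp
  then show "trunk_val t = \<one>" using right_cancel[OF c _ c] by simp
qed

text \<open>
  In the closure of the tree of \<open>x t\<^sup>+\<close> the finish vertex is the only one from which \<open>t\<close> leads to a
  given vertex: two such vertices are comparable, and the value of a path between them can be
  cancelled.
\<close>
lemma sub_cancel:
  assumes "t \<in> terms" "x \<in> terms" "y \<in> terms" "sim (Mul x t) (Mul y t)"
  shows "sub (Mul x (Plus t)) (Mul y (Plus t))"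
proof -
  let ?u = "Mul x (Plus t)"
  have u: "?u \<in> terms" using assms by simp
  note c = cl_props[OF u] and G = is_xgraphD[OF cl_props(1)[OF u]]
  let ?G = "cl ?u" and ?a = "start (cl ?u)" and ?b = "finish (cl ?u)"
  interpret weighted C \<gamma> "\<lambda>_. \<one>" ?G using G by (intro weighted_cval)
  obtain w where w: "sem ?G x ?a ?b" "sem ?G t ?b w" using c(5) by auto
  then have "sem ?G (Mul x t) ?a w" by auto
  then have "sem ?G (Mul y t) ?a w" using assms(4) c(4) unfolding sim_def by metis
  then obtain b where b: "sem ?G y ?a b" "sem ?G t b w" by auto
  have w': "W ?b (trunk_val t) w" "W b (trunk_val t) w" using sem_cval[OF G(1,6)] w b by blast+
  have tc: "trunk_val t \<in> carrier C" using assms trunk_val_closed by simp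
  have eq: "p = q" if r: "reach ?G p q" "W p (trunk_val t) w" "W q (trunk_val t) w" for p q
  proof -
    obtain m where m: "W p m q" using reach_W[OF r(1)] .
    have "m \<otimes> trunk_val t = \<one> \<otimes> trunk_val t" using functionalD[OF c(6) W_trans[OF m r(3)] r(2)] tc by simp
    then have "m = \<one>" using right_cancel tc W_closed[OF m] by blast
    then show ?thesis using m idempath_identified_cval[OF c(3) G(1,6)] by simp
  qed
  have "reach ?G ?b b \<or> reach ?G b ?b"
    using c(7) W_reach[OF w'(1)] W_reach[OF w'(2)] unfolding ancestors_comparable_def by blast
  then have "b = ?b" using eq w' by metis
  then show ?thesis unfolding sub_iff[OF u] using b w(2) by auto
qed

text \<open>
  Apart from the commutation of idempotents and right cancellation modulo \<open>Plus\<close>, the laws hold for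
  the denoted relations in every graph.
\<close>
lemma left_adequate_of_kernel_sim:
  assumes h: "alg_hom (term_alg X) B h" "h ` terms = carrier B"
    and ker: "\<And>s t. s \<in> terms \<Longrightarrow> t \<in> terms \<Longrightarrow> h s = h t \<longleftrightarrow> sim s t"
  shows "left_adequate B"
proof -
  have ops: "a \<otimes>\<^bsub>term_alg X\<^esub> b = Mul a b" "plus_op (term_alg X) a = Plus a" "\<one>\<^bsub>term_alg X\<^esub> = Unit" for a b
    by (simp_all add: term_alg_def)
  have "closed_alg (term_alg X)" by (simp add: closed_alg_def ops)
  then show ?thesis
  proof (rule left_adequate_hom_image[OF _ h], unfold ops)
    fix a assume a: "a \<in> terms"
    show "h (Mul Unit a) = h a" "h (Mul a Unit) = h a" "h (Mul (Plus a) (Plus a)) = h (Plus a)"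
      using a ker sem_in_verts by (auto simp: sim_def good_def fun_eq_iff)
    fix b assume b: "b \<in> terms"
    show "h (Mul a b) = h (Mul b a)" if "h (Mul a a) = h a" "h (Mul b b) = h b"
    proof -
      have "sim a (Plus a)" "sim b (Plus b)" using that a b ker sim_Plus_of_idempotent by auto
      then have "sem H (Mul a b) = sem H (Mul b a)" if "good H" for H :: "(nat, nat, 'x) xgraph"
        using that unfolding sim_def by (auto simp: fun_eq_iff)
      then show ?thesis using a b ker by (simp add: sim_def)
    qed
    fix c assume c: "c \<in> terms"
    show "h (Mul (Mul a b) c) = h (Mul a (Mul b c))"
      using a b c ker by (auto simp: sim_def fun_eq_iff)
    show "h (Mul b a) = h (Mul c a) \<longleftrightarrow> h (Mul b (Plus a)) = h (Mul c (Plus a))"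
    proof
      assume "h (Mul b a) = h (Mul c a)"
      then have "sim (Mul b a) (Mul c a)" using a b c ker by simp
      moreover then have "sim (Mul c a) (Mul b a)" by (simp add: sim_def)
      ultimately have "sim (Mul b (Plus a)) (Mul c (Plus a))"
        using sub_cancel a b c sim_iff_sub by blast
      then show "h (Mul b (Plus a)) = h (Mul c (Plus a))" using a b c ker by simp
    next
      assume "h (Mul b (Plus a)) = h (Mul c (Plus a))"
      then have s: "sim (Mul b (Plus a)) (Mul c (Plus a))" using a b c ker by simp
      have dec: "sem H (Mul u a) p q \<longleftrightarrow> (\<exists>r. sem H (Mul u (Plus a)) p r \<and> sem H a r q)"
        for H :: "(nat, nat, 'x) xgraph" and u p q by auto
      have "sim (Mul b a) (Mul c a)" unfolding sim_def fun_eq_iff dec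
        using s unfolding sim_def by simp
      then show "h (Mul b a) = h (Mul c a)" using a b c ker by simp
    qed
  qed
qed


subsection \<open>The operations of the pretzel monoid\<close>

text \<open>
  Asking only for a morphism into the closure makes this relation stable under products and \<open>Plus\<close>
  for all representatives, without a description of the closure of a product.
\<close>
definition represents :: "('v, 'e, 'x) xgraph \<Rightarrow> 'x lad_term \<Rightarrow> bool" where
  "represents A t \<longleftrightarrow> is_xgraph X A \<and> maps_to A (cl t) \<and> maps_to (tree t) A"

lemma represents_pretzel:
  assumes "represents A t" "t \<in> terms" shows "pretzel C \<gamma> A = pretzel C \<gamma> (tree t)"
proof -
  have A: "is_xgraph X A" "maps_to A (cl t)" "maps_to (tree t) A" using assms by (auto simp: represents_def)
  have "maps_to (tree t) (closure C \<gamma> A)" using maps_to_trans A closure_props(2)[OF A(1)] by blast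
  then show ?thesis using pretzel_eqI[OF A(1) is_xgraph_tree A(2)] assms by simp
qed

lemma represents_rep_pretzel:
  assumes "t \<in> terms" shows "represents (rep (pretzel C \<gamma> (tree t))) t"
proof -
  note c = cl_props[OF assms]
  note k = core_props[OF c(1)]
  have iso: "xisomorphic (core (cl t)) (rep (pretzel C \<gamma> (tree t)))"
    unfolding pretzel_def by (rule xisomorphic_rep[OF k(1)])
  have "maps_to (rep (pretzel C \<gamma> (tree t))) (cl t)"
    using xisomorphic_maps_to[OF xisomorphic_sym[OF iso k(1)]] k(4) maps_to_trans by blast
  moreover have "maps_to (tree t) (rep (pretzel C \<gamma> (tree t)))"
    using c(2) k(3) xisomorphic_maps_to[OF iso] maps_to_trans by blast
  ultimately show ?thesis using xisomorphic_is_xgraph[OF iso k(1)] by (simp add: represents_def)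
qed

lemma represents_maps_to:
  assumes "represents A t" "t \<in> terms" "good H" "sem H t a b" shows "maps_to A (ends H a b)"
  using maps_to_cl[OF assms(2-4)] assms(1) maps_to_trans by (auto simp: represents_def)

lemma represents_sem:
  "represents A t \<Longrightarrow> sem A t (start A) (finish A)"
  using maps_to_tree_iff' is_xgraphD(1) by (auto simp: represents_def)

lemma xproduct_morphisms:
  shows "morphism (ends A a b) (ends (xproduct A B) (Inl a) (Inl b)) Inl Inl"
    and "morphism (ends B c d) (ends (xproduct A B) ((id(Inr (start B) := Inl (finish A))) (Inr c))
      ((id(Inr (start B) := Inl (finish A))) (Inr d))) (id(Inr (start B) := Inl (finish A)) \<circ> Inr) Inr"
  by (auto simp: morphism_def xproduct_def xsum_def image_iff)

lemma xproduct_simps [simp]: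
  "start (xproduct A B) = Inl (start A)"
  "finish (xproduct A B) = (id(Inr (start B) := Inl (finish A))) (Inr (finish B))"
  by (simp_all add: xproduct_def xsum_def)

lemma is_xgraph_xproduct:
  assumes "is_xgraph X A" "is_xgraph X B" shows "is_xgraph X (xproduct A B)"
proof -
  note A = is_xgraphD[OF assms(1)] and B = is_xgraphD[OF assms(2)]
  let ?q = "id(Inr (start B) := Inl (finish A))"
  interpret A: wf_digraph "dg A" by (rule A)
  interpret B: wf_digraph "dg B" by (rule B)
  have V: "Verts (xproduct A B) = ?q ` (Verts A <+> Verts B)" "Arcs (xproduct A B) = Arcs A <+> Arcs B"
    by (simp_all add: xproduct_def xsum_def)
  have wf: "wfg (xproduct A B)"
    by unfold_locales (auto simp: xproduct_def xsum_def simp del: fun_upd_apply)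
  interpret P: wf_digraph "dg (xproduct A B)" by (rule wf)
  have rA: "reach (xproduct A B) (Inl (start A)) (Inl v)" if "v \<in> Verts A" for v
    using reach_morphism[OF xproduct_morphisms(1)[of A v v B], of "start A" v] A(1) A(7)[OF that] wf by simp
  have rB: "reach (xproduct A B) (Inl (finish A)) (?q (Inr v))" if "v \<in> Verts B" for v
    using reach_morphism[OF xproduct_morphisms(2)[of B v v A], of "start B" v] B(1) B(7)[OF that] wf
    by (simp del: fun_upd_apply) simp
  have r: "reach (xproduct A B) (Inl (start A)) v" if "v \<in> Verts (xproduct A B)" for v
  proof -
    from that obtain w where "w \<in> Verts A <+> Verts B" and v: "v = ?q w" unfolding V by blast
    then show ?thesis
    proof (elim PlusE)
      fix b assume b: "b \<in> Verts B" "w = Inr b"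
      show ?thesis using P.reachable_trans[OF rA[OF A(5)] rB[OF b(1)]] v b(2) by simp
    qed (use rA v in simp)
  qed
  have "label (xproduct A B) ` Arcs (xproduct A B) \<subseteq> X"
    using A(6) B(6) by (auto simp: xproduct_def xsum_def)
  moreover have "Inl (start A) \<in> Verts (xproduct A B)" "?q (Inr (finish B)) \<in> Verts (xproduct A B)"
    using P.reachable_in_verts rA[OF A(4)] rB[OF B(5)] by blast+
  moreover have "fin_digraph (dg (xproduct A B))"
    using A(2,3) B(2,3) by (intro P.fin_digraphI) (auto simp: V)
  ultimately show ?thesis unfolding is_xgraph_def using r by (simp del: fun_upd_apply)
qed

lemma represents_xproduct:
  assumes "represents A s" "represents B t" "s \<in> terms" "t \<in> terms"
  shows "represents (xproduct A B) (Mul s t)"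
proof -
  have A: "is_xgraph X A" and B: "is_xgraph X B" using assms by (auto simp: represents_def)
  let ?q = "id(Inr (start B) := Inl (finish A))"
  have st: "Mul s t \<in> terms" using assms by simp
  note c = cl_props[OF st]
  obtain d where d: "sem (cl (Mul s t)) s (start (cl (Mul s t))) d" "sem (cl (Mul s t)) t d (finish (cl (Mul s t)))"
    using c(5) by auto
  obtain f1 g1 where m1: "morphism A (ends (cl (Mul s t)) (start (cl (Mul s t))) d) f1 g1"
    using represents_maps_to[OF assms(1,3) c(4) d(1)] by (auto simp: maps_to_def)
  obtain f2 g2 where m2: "morphism B (ends (cl (Mul s t)) d (finish (cl (Mul s t)))) f2 g2"
    using represents_maps_to[OF assms(2,4) c(4) d(2)] by (auto simp: maps_to_def)
  have "morphism (xsum A B) (cl (Mul s t)) (case_sum f1 f2) (case_sum g1 g2)"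
    using m1 m2 unfolding morphism_def xsum_def by auto
  then have "morphism (xproduct A B) (cl (Mul s t)) (case_sum f1 f2) (case_sum g1 g2)"
    unfolding xproduct_def using morphismD(4)[OF m1] morphismD(3)[OF m2] by (intro morphism_from_identify) auto
  then have "maps_to (xproduct A B) (cl (Mul s t))" by (auto simp: maps_to_def)
  moreover have "sem (xproduct A B) s (Inl (start A)) (Inl (finish A))"
    using sem_morphism[OF xproduct_morphisms(1)[of A "start A" "start A" B], of s "start A" "finish A"]
      represents_sem[OF assms(1)] by simp
  moreover have "sem (xproduct A B) t (?q (Inr (start B))) (?q (Inr (finish B)))"
    using sem_morphism[OF xproduct_morphisms(2)[of B "start B" "finish B" A], of t "start B" "finish B"]
      represents_sem[OF assms(2)] by (simp del: fun_upd_apply)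
  ultimately show ?thesis
    using is_xgraph_xproduct[OF A B] maps_to_tree_iff'[of "xproduct A B" "Mul s t"] is_xgraphD(1)
    unfolding represents_def by fastforce
qed

lemma represents_xplus:
  assumes "represents A t" "t \<in> terms" shows "represents (xplus A) (Plus t)"
proof -
  have A: "is_xgraph X A" using assms by (simp add: represents_def)
  have xp: "xplus A = ends A (start A) (start A)" by (simp add: xplus_def ends_def)
  have Pt: "Plus t \<in> terms" using assms by simp
  note c = cl_props[OF Pt]
  obtain d where d: "start (cl (Plus t)) = finish (cl (Plus t))" "sem (cl (Plus t)) t (start (cl (Plus t))) d"
    using c(5) by auto
  obtain f g where m: "morphism A (ends (cl (Plus t)) (start (cl (Plus t))) d) f g"
    using represents_maps_to[OF assms c(4) d(2)] by (auto simp: maps_to_def)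
  have "morphism (xplus A) (cl (Plus t)) f g" using m d(1) unfolding morphism_def xp by auto
  then have "maps_to (xplus A) (cl (Plus t))" by (auto simp: maps_to_def)
  moreover have "is_xgraph X (xplus A)" using A unfolding is_xgraph_def xp by simp
  moreover have "maps_to (tree (Plus t)) (xplus A)"
    using maps_to_tree_iff'[of "xplus A" "Plus t"] is_xgraphD(1)[OF A] represents_sem[OF assms(1)]
    by (auto simp: xp)
  ultimately show ?thesis by (simp add: represents_def)
qed

lemma pretzel_Unit: "pretzel C \<gamma> (tree Unit) = iso_class xone"
proof -
  have U: "Unit \<in> terms" by simp
  note c = cl_props[OF U]
  have one: "is_xgraph X (xone :: (unit, unit, 'x) xgraph)"
    unfolding is_xgraph_def xone_def
    by (auto simp: fin_digraph_def wf_digraph_def fin_digraph_axioms_def intro!: wf_digraph.reachable_refl)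
  have ret: "retracted (xone :: (unit, unit, 'x) xgraph)" by (simp add: retracted_def xone_def)
  have idp: "idempath_identified C \<gamma> (xone :: (unit, unit, 'x) xgraph)"
    by (simp add: idempath_identified_def)
  have "maps_to (tree Unit) (xone :: (unit, unit, 'x) xgraph)"
    using maps_to_tree_iff' is_xgraphD(1,4)[OF one] by fastforce
  then have "maps_to (cl Unit) (xone :: (unit, unit, 'x) xgraph)"
    using maps_to_closure_lift[OF is_xgraph_tree _ idp] by fastforce
  then have "maps_to (core (cl Unit)) (xone :: (unit, unit, 'x) xgraph)"
    using core_props(4)[OF c(1)] maps_to_trans by blast
  moreover have "maps_to (xone :: (unit, unit, 'x) xgraph) (cl Unit)"
    unfolding maps_to_def morphism_def using c(5)
    by (intro exI[of _ "\<lambda>_. start (cl Unit)"] exI) (auto simp: xone_def)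
  then have "maps_to (xone :: (unit, unit, 'x) xgraph) (core (cl Unit))"
    using core_props(3)[OF c(1)] maps_to_trans by blast
  ultimately have "xisomorphic (core (cl Unit)) (xone :: (unit, unit, 'x) xgraph)"
    using retracted_xisomorphic core_props(1,2)[OF c(1)] one ret by blast
  then show ?thesis unfolding pretzel_def by (rule iso_class_eqI) (rule core_props(1)[OF c(1)])
qed

text \<open>
  Every tree has morphisms to and from the tree of some term, and the retracted image of the tree of
  a term is a subgraph that is again a tree.
\<close>
lemma carrier_PT: "carrier (PT C \<gamma> X) = (\<lambda>t. pretzel C \<gamma> (tree t)) ` terms"
proof (intro equalityI subsetI)
  fix S assume "S \<in> carrier (PT C \<gamma> X)"
  then obtain T :: "(nat, nat, 'x) xgraph" where T: "is_xtree X T" "S = pretzel C \<gamma> (rep (iso_class T))"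
    by (auto simp: PT_def FLAd_def)
  let ?R = "rep (iso_class T)"
  have tl: "treelike X T" by (rule is_xtree_treelike) (rule T)
  then have x: "is_xgraph X T" by (simp add: treelike_def)
  obtain t where t: "set_lad_term t \<subseteq> X" "sem T t (start T) (finish T)"
    "\<And>(H :: (nat, nat, 'x) xgraph) a b. wfg H \<Longrightarrow> sem H t a b \<Longrightarrow> maps_to T (ends H a b)"
    using treelike_term[OF tl] by blast
  have iso: "xisomorphic T ?R" by (rule xisomorphic_rep[OF x])
  have R: "is_xgraph X ?R" by (rule xisomorphic_is_xgraph[OF iso x])
  have tt: "t \<in> terms" using t(1) by simp
  have "maps_to T (cl t)"
    using t(3)[OF is_xgraphD(1)[OF cl_props(1)[OF tt]] cl_props(5)[OF tt]] by simp
  then have "maps_to ?R (cl t)" using xisomorphic_maps_to[OF xisomorphic_sym[OF iso x]] maps_to_trans by blast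
  moreover have "maps_to (tree t) ?R"
    using maps_to_tree_iff' is_xgraphD(1)[OF x] t(2) xisomorphic_maps_to[OF iso] maps_to_trans by blast
  ultimately have "represents ?R t" using R by (simp add: represents_def)
  then show "S \<in> (\<lambda>t. pretzel C \<gamma> (tree t)) ` terms" using represents_pretzel tt T(2) by blast
next
  fix S assume "S \<in> (\<lambda>t. pretzel C \<gamma> (tree t)) ` terms"
  then obtain t where t: "t \<in> terms" "S = pretzel C \<gamma> (tree t)" by blast
  have tl: "treelike X (tree t)" and x: "is_xgraph X (tree t)" using t tree_treelike is_xgraph_tree by auto
  let ?T = "core (tree t)"
  note k = core_props[OF x]
  obtain f g where r: "retract (tree t) f g" "?T = image_graph (tree t) f g" using core_retract[OF x] by metis
  have "treelike X ?T" unfolding treelike_def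
  proof (intro conjI k(1))
    have "g ` Arcs (tree t) \<subseteq> Arcs (tree t)" using r(1) by (auto simp: retract_def morphism_def)
    then show "inj_on (tgt ?T) (Arcs ?T)" "\<forall>e\<in>Arcs ?T. tgt ?T e \<noteq> start ?T"
      by (auto simp: r(2) inj_on_def)
  qed
  then have "is_xtree X ?T" by (rule treelike_is_xtree)
  then have mem: "iso_class ?T \<in> FLAd X" using k(2) by (auto simp: FLAd_def)
  let ?R = "rep (iso_class ?T)"
  have iso: "xisomorphic ?T ?R" by (rule xisomorphic_rep[OF k(1)])
  have "maps_to ?R (tree t)"
    using xisomorphic_maps_to[OF xisomorphic_sym[OF iso k(1)]] k(4) maps_to_trans by blast
  then have "maps_to ?R (cl t)" using maps_to_trans cl_props(2)[OF t(1)] by blast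
  moreover have "maps_to (tree t) ?R" using xisomorphic_maps_to[OF iso] k(3) maps_to_trans by blast
  ultimately have "represents ?R t"
    using xisomorphic_is_xgraph[OF iso k(1)] by (simp add: represents_def)
  then have "S = pretzel C \<gamma> ?R" using represents_pretzel t by metis
  then show "S \<in> carrier (PT C \<gamma> X)" using mem by (auto simp: PT_def)
qed

lemma alg_hom_pretzel: "alg_hom (term_alg X) (PT C \<gamma> X) (\<lambda>t. pretzel C \<gamma> (tree t))"
proof -
  let ?h = "\<lambda>t. pretzel C \<gamma> (tree t)"
  have "?h (Mul s t) = pretzel C \<gamma> (xproduct (rep (?h s)) (rep (?h t)))" if "s \<in> terms" "t \<in> terms" for s t
    using represents_pretzel[OF represents_xproduct[OF represents_rep_pretzel represents_rep_pretzel]] that by simp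
  moreover have "?h (Plus t) = pretzel C \<gamma> (xplus (rep (?h t)))" if "t \<in> terms" for t
    using represents_pretzel[OF represents_xplus[OF represents_rep_pretzel]] that by simp
  ultimately show ?thesis unfolding alg_hom_def using carrier_PT pretzel_Unit
    by (auto simp: PT_def term_alg_def)
qed

end


section \<open>Decorated products\<close>

text \<open>
  The square of \<open>p f q\<close> contains the idempotent \<open>q p\<close>, which commutes with \<open>f\<close>; this leaves a factor
  \<open>p q\<close> in front, and \<open>p q = (p q)\<^sup>+\<close> lies above \<open>(p f q)\<^sup>+\<close>.
\<close>
lemma (in left_adequate_monoid) idem_insert:
  assumes "p \<in> carrier M" "q \<in> carrier M" "f \<in> E" "p \<otimes> q \<in> E" "q \<otimes> p \<in> E"
  shows "p \<otimes> f \<otimes> q \<in> E"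
proof -
  note c = assms(1,2) idem_carrier[OF assms(3)] plus_carrier[OF assms(2)]
  have "pl (p \<otimes> q) \<otimes> pl (p \<otimes> (f \<otimes> q)) = pl (p \<otimes> (f \<otimes> q))"
    using plus_mono[OF assms(1) plus_in_idem[OF assms(2)] idem_mult[OF plus_in_idem[OF assms(2)] assms(3)]
        idem_mult_absorb[OF plus_in_idem[OF assms(2)] c(3)]]
      idem_comm[OF assms(3) plus_in_idem[OF assms(2)]] plus_mult[of p q] plus_mult[of p "f \<otimes> q"]
      plus_idem_mult[OF assms(3,2)] c by simp
  then have ab: "(p \<otimes> q) \<otimes> (p \<otimes> (f \<otimes> q)) = p \<otimes> (f \<otimes> q)"
    using absorb_iff_plus[OF assms(4)] plus_idem[OF assms(4)] c by simp
  have "(p \<otimes> f \<otimes> q) \<otimes> (p \<otimes> f \<otimes> q) = p \<otimes> (f \<otimes> (q \<otimes> p)) \<otimes> (f \<otimes> q)"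
    using c by (simp add: m_assoc)
  also have "\<dots> = p \<otimes> ((q \<otimes> p) \<otimes> f) \<otimes> (f \<otimes> q)" using idem_comm[OF assms(3,5)] by simp
  also have "\<dots> = (p \<otimes> q) \<otimes> (p \<otimes> (f \<otimes> (f \<otimes> q)))" using c by (simp add: m_assoc)
  also have "\<dots> = p \<otimes> f \<otimes> q" using ab c idem_mult_absorb[OF assms(3,2)] by (simp add: m_assoc)
  finally show ?thesis using c by (simp add: idempotents_def)
qed

locale idempath_model = right_cancellative_labels C \<gamma> X + M: left_adequate_monoid M
  for C :: "('c, 'd) monoid_scheme" (structure) and \<gamma> :: "'x \<Rightarrow> 'c" and X :: "'x set" and M :: "'m alg210" +
  fixes g :: "'x \<Rightarrow> 'm"
  assumes g: "x \<in> X \<Longrightarrow> g x \<in> carrier M"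
    and idempotent_words: "set w \<subseteq> X \<Longrightarrow> word_val C \<gamma> w = \<one> \<Longrightarrow> word_val M g w \<in> idempotents M"
begin

abbreviation M_mult (infixl \<open>\<cdot>\<close> 70) where "a \<cdot> b \<equiv> a \<otimes>\<^bsub>M\<^esub> b"
abbreviation "E \<equiv> idempotents M"
abbreviation "pl \<equiv> plus_op M"

text \<open>A list over \<open>'x + 'm\<close> stands for a word in which idempotents of \<open>M\<close> are inserted at arbitrary places.\<close>
primrec letters :: "('x + 'm) list \<Rightarrow> 'x list" where
  "letters [] = []"
| "letters (i # L) = (case i of Inl x \<Rightarrow> x # letters L | Inr e \<Rightarrow> letters L)"

primrec decorated_val :: "('x + 'm) list \<Rightarrow> 'm" where
  "decorated_val [] = \<one>\<^bsub>M\<^esub>"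
| "decorated_val (i # L) = (case i of Inl x \<Rightarrow> g x | Inr e \<Rightarrow> e) \<cdot> decorated_val L"

definition decorated :: "'m \<Rightarrow> 'c \<Rightarrow> bool" where
  "decorated m c \<longleftrightarrow> (\<exists>L. set L \<subseteq> X <+> E \<and> decorated_val L = m \<and> word_val C \<gamma> (letters L) = c)"

lemma decorated_val_closed: "set L \<subseteq> X <+> E \<Longrightarrow> decorated_val L \<in> carrier M"
  by (induction L) (auto simp: g M.idem_carrier)

lemma decorated_val_append:
  "set L \<subseteq> X <+> E \<Longrightarrow> set L' \<subseteq> X <+> E \<Longrightarrow> decorated_val (L @ L') = decorated_val L \<cdot> decorated_val L'"
  by (induction L) (auto simp: g M.idem_carrier M.m_assoc decorated_val_closed)

lemma letters_append: "letters (L @ L') = letters L @ letters L'"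
  by (induction L) (auto split: sum.splits)

lemma letters_in: "set L \<subseteq> X <+> E \<Longrightarrow> set (letters L) \<subseteq> X"
  by (induction L) auto

text \<open>
  The insertions are removed one at a time. If \<open>p q\<close> has trivial value, then so has \<open>q p\<close> by right
  cancellation, so both are idempotent by induction and an idempotent may be put between them.
\<close>
lemma decorated_val_idempotent:
  assumes "set L \<subseteq> X <+> E" "word_val C \<gamma> (letters L) = \<one>"
  shows "decorated_val L \<in> E"
  using assms
proof (induction "length (filter (\<lambda>i. \<not> isl i) L)" arbitrary: L rule: less_induct)
  case less
  show ?case
  proof (cases "\<exists>f. Inr f \<in> set L")
    case False
    have "decorated_val L = word_val M g (letters L)" if "\<nexists>f. Inr f \<in> set L" for L
      using that
    proof (induction L)
      case (Cons i L)
      then show ?case by (cases i) (auto simp: word_val_def)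
    qed (simp add: word_val_def)
    then show ?thesis using False idempotent_words[OF letters_in] less.prems by simp
  next
    case True
    then obtain f p q where L: "L = p @ Inr f # q" by (meson split_list)
    have pq: "set p \<subseteq> X <+> E" "set q \<subseteq> X <+> E" "f \<in> E" using less.prems(1) by (auto simp: L)
    have w: "word_val C \<gamma> (letters p) \<otimes> word_val C \<gamma> (letters q) = \<one>"
      using less.prems(2) word_val_append[OF letters_in[OF pq(1)] letters_in[OF pq(2)]]
      by (simp add: L letters_append)
    then have w': "word_val C \<gamma> (letters q) \<otimes> word_val C \<gamma> (letters p) = \<one>"
      using left_inverse_right_inverse word_val_closed letters_in pq by metis
    have "decorated_val (p @ q) \<in> E"
      using pq w word_val_append letters_in by (intro less.hyps) (auto simp: L letters_append)
    moreover have "decorated_val (q @ p) \<in> E"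
      using pq w' word_val_append letters_in by (intro less.hyps) (auto simp: L letters_append)
    ultimately have "decorated_val p \<cdot> f \<cdot> decorated_val q \<in> E"
      using M.idem_insert decorated_val_closed pq decorated_val_append by simp
    moreover have "decorated_val L = decorated_val p \<cdot> (f \<cdot> decorated_val q)"
      unfolding L using pq by (subst decorated_val_append) auto
    ultimately show ?thesis using pq by (simp add: M.m_assoc decorated_val_closed M.idem_carrier)
  qed
qed

lemma decorated_idempotent: "decorated m \<one> \<Longrightarrow> m \<in> E"
  unfolding decorated_def using decorated_val_idempotent by blast

lemma decorated_mult:
  assumes "decorated m c" "decorated n d" shows "decorated (m \<cdot> n) (c \<otimes> d)"
proof -
  obtain L L' where "set L \<subseteq> X <+> E" "decorated_val L = m" "word_val C \<gamma> (letters L) = c"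
    "set L' \<subseteq> X <+> E" "decorated_val L' = n" "word_val C \<gamma> (letters L') = d"
    using assms by (auto simp: decorated_def)
  then show ?thesis unfolding decorated_def
    by (intro exI[of _ "L @ L'"]) (auto simp: decorated_val_append letters_append word_val_append letters_in)
qed

lemma decorated_idem: "e \<in> E \<Longrightarrow> decorated e \<one>"
  unfolding decorated_def by (intro exI[of _ "[Inr e]"]) (auto simp: word_val_def M.idem_carrier)

lemma decorated_gen: "x \<in> X \<Longrightarrow> decorated (g x) (\<gamma> x)"
  unfolding decorated_def by (intro exI[of _ "[Inl x]"]) (auto simp: word_val_def g gamma)


section \<open>Compatible decorations of graphs\<close>

text \<open>
  The idempotent at a vertex stands for everything that can be read from this vertex, so it lies
  below the idempotent read along each outgoing edge.
\<close>
definition compatible :: "('v \<Rightarrow> 'm) \<Rightarrow> ('v, 'e, 'x) xgraph \<Rightarrow> bool" where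
  "compatible \<sigma> G \<longleftrightarrow> (\<forall>v\<in>Verts G. \<sigma> v \<in> E) \<and>
     (\<forall>e\<in>Arcs G. pl (g (label G e) \<cdot> \<sigma> (tgt G e)) \<cdot> \<sigma> (src G e) = \<sigma> (src G e))"

definition below :: "('v, 'e, 'x) xgraph \<Rightarrow> ('v \<Rightarrow> 'm) \<Rightarrow> ('v \<Rightarrow> 'm) \<Rightarrow> bool" where
  "below G \<tau> \<sigma> \<longleftrightarrow> (\<forall>v\<in>Verts G. \<sigma> v \<cdot> \<tau> v = \<tau> v)"

definition greatest :: "('v \<Rightarrow> 'm) \<Rightarrow> ('v, 'e, 'x) xgraph \<Rightarrow> bool" where
  "greatest \<sigma> G \<longleftrightarrow> compatible \<sigma> G \<and> (\<forall>\<tau>. compatible \<tau> G \<longrightarrow> below G \<tau> \<sigma>)"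

abbreviation "mwalk \<equiv> wwalk M g"

lemma compatible_pullback:
  assumes "morphism G H f k" "compatible \<sigma> H" shows "compatible (\<lambda>v. \<sigma> (f v)) G"
  unfolding compatible_def
proof (intro conjI ballI)
  fix v assume "v \<in> Verts G"
  then show "\<sigma> (f v) \<in> E" using assms(2) morphismD(1)[OF assms(1)] by (simp add: compatible_def)
next
  fix e assume e: "e \<in> Arcs G"
  have "k e \<in> Arcs H" using morphismD(2)[OF assms(1) e] .
  then have "pl (g (label H (k e)) \<cdot> \<sigma> (tgt H (k e))) \<cdot> \<sigma> (src H (k e)) = \<sigma> (src H (k e))"
    using assms(2) by (simp add: compatible_def)
  then show "pl (g (label G e) \<cdot> \<sigma> (f (tgt G e))) \<cdot> \<sigma> (f (src G e)) = \<sigma> (f (src G e))"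
    unfolding morphismD(5-7)[OF assms(1) e] .
qed

lemma wwalk_morphism:
  assumes "morphism G H f k" "wfg G" "\<And>v. v \<in> Verts G \<Longrightarrow> \<sigma> (f v) = \<tau> v" "wwalk K \<rho> \<tau> G a m b"
  shows "wwalk K \<rho> \<sigma> H (f a) m (f b)"
  using assms(4)
proof induction
  case start
  from wwalk.start[of "f a" H K \<rho> \<sigma>, OF morphismD(1)[OF assms(1) start]] show ?case
    unfolding assms(3)[OF start] .
next
  case (step m e)
  note e = step.hyps(2)
  from wwalk.step[of K \<rho> \<sigma> H "f a" m "k e", OF _ morphismD(2)[OF assms(1) e]] step.IH
  show ?case
    unfolding morphismD(5-7)[OF assms(1) e] assms(3)[OF wf_digraph.head_in_verts[OF assms(2) e]] .
qed

end

locale decorated_graph = idempath_model C \<gamma> X M g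
  for C :: "('c, 'd) monoid_scheme" (structure) and \<gamma> :: "'x \<Rightarrow> 'c" and X :: "'x set" and M :: "'m alg210"
    and g :: "'x \<Rightarrow> 'm" +
  fixes G :: "('v, 'e, 'x) xgraph" and \<sigma> :: "'v \<Rightarrow> 'm"
  assumes wfG: "wfg G" and labels: "label G ` Arcs G \<subseteq> X" and compatible: "compatible \<sigma> G"
begin

lemma sigma_E: "v \<in> Verts G \<Longrightarrow> \<sigma> v \<in> E"
  using compatible by (simp add: compatible_def)

lemma g_label: "e \<in> Arcs G \<Longrightarrow> g (label G e) \<in> carrier M"
  using labels g by auto

sublocale weighted M g \<sigma> G
  by unfold_locales (auto simp: wf_digraph.wellformed[OF wfG] g_label sigma_E M.idem_carrier M.idem_sq)

sublocale cv: weighted C \<gamma> "\<lambda>_. \<one>" G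
  using wfG labels by (rule weighted_cval)

lemma sigma_arc:
  "e \<in> Arcs G \<Longrightarrow> pl (g (label G e) \<cdot> \<sigma> (tgt G e)) \<cdot> \<sigma> (src G e) = \<sigma> (src G e)"
  using compatible by (simp add: compatible_def)

text \<open>
  What can be read after an edge never restricts the idempotent before it, by compatibility; so the
  first vertex alone determines the idempotent of a walk.
\<close>
lemma plus_walk: "W a m b \<Longrightarrow> pl m = \<sigma> a"
proof (induction rule: wwalk.induct)
  case start
  then show ?case by (simp add: M.plus_idem sigma_E)
next
  case (step m e)
  let ?t = "src G e" and ?h = "tgt G e" and ?x = "g (label G e)"
  have c: "a \<in> Verts G" "m \<in> carrier M" "?x \<in> carrier M" "\<sigma> ?h \<in> carrier M" "\<sigma> ?t \<in> E" "\<sigma> a \<in> E"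
    using W_closed[OF step.hyps(1)] step.hyps(2) by (auto simp: g_label sigma sigma_E)
  have w: "W a (m \<cdot> ?x \<cdot> \<sigma> ?h) ?h" using wwalk.step[OF step.hyps] .
  have "pl (m \<cdot> pl (?x \<cdot> \<sigma> ?h)) \<cdot> pl (m \<cdot> \<sigma> ?t) = pl (m \<cdot> \<sigma> ?t)"
    using sigma_arc[OF step.hyps(2)] c by (intro M.plus_mono M.plus_in_idem M.m_closed)
  then have "pl (m \<cdot> ?x \<cdot> \<sigma> ?h) \<cdot> \<sigma> a = \<sigma> a"
    using W_right[OF step.hyps(1)] step.IH c by (simp add: M.m_assoc M.plus_mult[of m "?x \<cdot> \<sigma> ?h"])
  moreover have "\<sigma> a \<cdot> pl (m \<cdot> ?x \<cdot> \<sigma> ?h) = pl (m \<cdot> ?x \<cdot> \<sigma> ?h)"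
    using W_left[OF w] M.absorb_iff_plus[OF c(6)] W_closed[OF w] by blast
  moreover have "m \<cdot> ?x \<cdot> \<sigma> ?h \<in> carrier M" using W_closed[OF w] by simp
  ultimately show ?case using M.idem_antisym[OF M.plus_in_idem c(6)] by simp
qed

lemma walk_decorated: "W a m b \<Longrightarrow> \<exists>c. cval G a c b \<and> decorated m c"
proof (induction rule: wwalk.induct)
  case start
  show ?case by (intro exI[of _ \<one>] conjI cval_start decorated_idem sigma_E start)
next
  case (step m e)
  then obtain c where c: "cval G a c (src G e)" "decorated m c" by blast
  have "decorated (m \<cdot> g (label G e) \<cdot> \<sigma> (tgt G e)) (c \<otimes> \<gamma> (label G e) \<otimes> \<one>)"
    using c(2) step.hyps(2) labels by (intro decorated_mult decorated_gen decorated_idem sigma_E) auto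
  with wwalk.step[OF c(1) step.hyps(2)] show ?case by (intro exI conjI)
qed

end

context idempath_model
begin

text \<open>
  The product along an idempath is idempotent, so it equals its own idempotent, which is the
  decoration of the first vertex.
\<close>
lemma idempath_walk:
  assumes "decorated_graph C \<gamma> X M g G \<sigma>" "functional C \<gamma> (\<lambda>_. \<one>) G" "cval G x \<one> y"
  shows "mwalk \<sigma> G x (\<sigma> x) y"
proof -
  interpret decorated_graph C \<gamma> X M g G \<sigma> by fact
  obtain z where z: "W x z y" using reach_W[OF cv.W_reach[OF assms(3)]] .
  then have "decorated z \<one>" using walk_decorated cv.functionalD[OF assms(2,3)] by metis
  then show ?thesis using z plus_walk[OF z] M.plus_idem decorated_idempotent by metis
qed

lemma identify_fixed: "v \<in> Verts (identify x y G) \<Longrightarrow> (id(y := x)) v = v"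
  by (auto split: if_splits)

text \<open>
  The value of a decorated walk depends only on its ends, for every compatible decoration: a
  decorated product of trivial value in \<open>C\<close> is an idempotent, and it is then determined by the
  vertex where it starts.
\<close>
lemma descendant_functional:
  assumes T: "treelike X T" and d: "descendant C \<gamma> T G" and "compatible \<sigma> G"
  shows "functional M g \<sigma> G"
proof -
  have x: "is_xgraph X T" using T by (simp add: treelike_def)
  have "\<forall>\<sigma>. compatible \<sigma> G \<longrightarrow> functional M g \<sigma> G" using d x
  proof (induction rule: descendant_induct)
    case base
    show ?case
    proof (intro allI impI)
      fix \<sigma> assume c: "compatible \<sigma> T"
      interpret decorated_graph C \<gamma> X M g T \<sigma>
        by unfold_locales (use is_xgraphD[OF x] c in \<open>auto intro: wf_digraph.wellformed\<close>)
      show "functional M g \<sigma> T" by (rule treelike_functional[OF T]) unfold_locales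
    qed
  next
    case (step H x p y)
    note H = is_xgraphD[OF step.hyps(2)]
    have inv: "functional C \<gamma> (\<lambda>_. \<one>) H" "ancestors_comparable H"
      using descendant_invariants[OF T step.hyps(1)] by auto
    have xy: "cval H x \<one> y" using idempath_cval[OF H(1,6)] step.hyps(3) by metis
    let ?q = "id(y := x)"
    show ?case
    proof (intro allI impI)
      fix \<sigma>' assume c': "compatible \<sigma>' (identify x y H)"
      define \<sigma> where "\<sigma> = (\<lambda>v. \<sigma>' (?q v))"
      have c: "compatible \<sigma> H" unfolding \<sigma>_def by (rule compatible_pullback[OF morphism_identify c'])
      interpret decorated_graph C \<gamma> X M g H \<sigma>
        by unfold_locales (use H c in \<open>auto intro: wf_digraph.wellformed\<close>)
      have eq: "\<sigma> x = \<sigma> y" by (simp add: \<sigma>_def)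
      have w: "W x (\<sigma> x) y" using idempath_walk[OF _ inv(1) xy] decorated_graph_axioms by blast
      have "m \<cdot> n = \<sigma> a" if m: "W a m y" and n: "W x n a" for a m n
      proof -
        obtain c d where cd: "cval H a c y" "decorated m c" "cval H x d a" "decorated n d"
          using walk_decorated m n by blast
        have "d \<otimes> c = \<one>" using cv.functionalD[OF inv(1) cv.W_trans[OF cd(3,1)] xy] .
        then have "c \<otimes> d = \<one>" using left_inverse_right_inverse cv.W_closed cd(1,3) by blast
        then have "m \<cdot> n \<in> E" using decorated_mult[OF cd(2,4)] decorated_idempotent by simp
        then have "m \<cdot> n = pl (m \<cdot> n)" using M.plus_idem by simp
        also have "\<dots> = pl (m \<cdot> \<sigma> y)"
          using M.plus_mult[of m n] plus_walk[OF n] W_closed[OF m] W_closed[OF n] eq by simp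
        also have "\<dots> = \<sigma> a" using W_right[OF m] plus_walk[OF m] by simp
        finally show ?thesis .
      qed
      then have f: "functional M g \<sigma> (identify x y H)"
        using step.IH c by (intro functional_identify[OF w eq _ inv(2)]) auto
      have wf': "wfg (identify x y H)" using is_xgraphD(1)[OF is_xgraph_identify[OF step.hyps(2)]] .
      have "\<sigma>' v = \<sigma> v" if "v \<in> Verts (identify x y H)" for v
        using identify_fixed[OF that] by (simp add: \<sigma>_def del: fun_upd_apply)
      then show "functional M g \<sigma>' (identify x y H)"
        using f wwalk_cong[OF _ wf', of M g \<sigma>' _ _ _ \<sigma>] unfolding functional_def by metis
    qed
  qed
  then show ?thesis using assms(3) by blast
qed

end


subsection \<open>Lowering a decoration at a vertex\<close>

context decorated_graph
begin

text \<open>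
  The greatest compatible decoration below \<open>\<sigma>\<close> whose value at \<open>y\<close> lies below the idempotent \<open>f\<close>:
  only the vertices from which \<open>y\<close> can be reached are affected.
\<close>
definition lower :: "'v \<Rightarrow> 'm \<Rightarrow> 'v \<Rightarrow> 'm" where
  "lower y f v = (if reach G v y then pl ((THE m. W v m y) \<cdot> f) else \<sigma> v)"

end

locale functional_graph = decorated_graph C \<gamma> X M g G \<sigma>
  for C :: "('c, 'd) monoid_scheme" (structure) and \<gamma> :: "'x \<Rightarrow> 'c" and X :: "'x set" and M :: "'m alg210"
    and g :: "'x \<Rightarrow> 'm" and G :: "('v, 'e, 'x) xgraph" and \<sigma> :: "'v \<Rightarrow> 'm" +
  fixes y :: 'v and f :: 'm
  assumes functional: "functional M g \<sigma> G" and y: "y \<in> Verts G" and f: "f \<in> E"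
begin

abbreviation "\<kappa> \<equiv> lower y f"

lemma fc: "f \<in> carrier M"
  using f by (rule M.idem_carrier)

lemma lower_walk_eq: "W v m y \<Longrightarrow> \<kappa> v = pl (m \<cdot> f)"
  unfolding lower_def using W_reach functionalD[OF functional] by (metis (mono_tags, lifting) the_equality)

lemma lower_unreached: "\<not> reach G v y \<Longrightarrow> \<kappa> v = \<sigma> v"
  by (simp add: lower_def)

lemma lower_E: "v \<in> Verts G \<Longrightarrow> \<kappa> v \<in> E"
proof (cases "reach G v y")
  case True
  then obtain m where m: "W v m y" by (rule reach_W)
  show ?thesis unfolding lower_walk_eq[OF m] using W_closed[OF m] fc by (intro M.plus_in_idem) auto
qed (use lower_unreached sigma_E in auto)

lemma lower_below: "below G \<kappa> \<sigma>"
  unfolding below_def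
proof
  fix v assume v: "v \<in> Verts G"
  show "\<sigma> v \<cdot> \<kappa> v = \<kappa> v"
  proof (cases "reach G v y")
    case True
    then obtain m where m: "W v m y" by (rule reach_W)
    have "\<sigma> v \<cdot> (m \<cdot> f) = m \<cdot> f" using W_left[OF m] W_closed[OF m] fc sigma by (simp add: M.m_assoc[symmetric])
    then show ?thesis unfolding lower_walk_eq[OF m]
      using M.absorb_iff_plus[OF sigma_E[OF v]] W_closed[OF m] fc by simp
  qed (use lower_unreached sigma_idem v in auto)
qed

lemma walk_Cons:
  assumes "e \<in> Arcs G" "W (tgt G e) m b"
  shows "W (src G e) (\<sigma> (src G e) \<cdot> (g (label G e) \<cdot> m)) b"
proof -
  have c: "m \<in> carrier M" "\<sigma> (src G e) \<in> carrier M" "g (label G e) \<in> carrier M" "\<sigma> (tgt G e) \<in> carrier M"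
    using W_closed[OF assms(2)] assms(1) sigma g_label by auto
  have "W (src G e) (\<sigma> (src G e) \<cdot> g (label G e) \<cdot> \<sigma> (tgt G e)) (tgt G e)"
    by (rule wwalk.step[OF wwalk.start]) (use assms(1) in auto)
  from W_trans[OF this assms(2)] show ?thesis using c W_left[OF assms(2)] by (simp add: M.m_assoc)
qed

lemma lower_tail:
  assumes e: "e \<in> Arcs G" and r: "reach G (tgt G e) y"
  shows "\<kappa> (src G e) = \<sigma> (src G e) \<cdot> pl (g (label G e) \<cdot> \<kappa> (tgt G e))"
proof -
  obtain m where m: "W (tgt G e) m y" using reach_W[OF r] .
  have c: "m \<in> carrier M" "g (label G e) \<in> carrier M" "\<sigma> (src G e) \<in> carrier M" "m \<cdot> f \<in> carrier M"
    using W_closed[OF m] e g_label fc sigma by auto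
  have "\<kappa> (src G e) = pl (\<sigma> (src G e) \<cdot> (g (label G e) \<cdot> (m \<cdot> f)))"
    unfolding lower_walk_eq[OF walk_Cons[OF e m]] using c fc by (simp add: M.m_assoc)
  also have "\<dots> = \<sigma> (src G e) \<cdot> pl (g (label G e) \<cdot> pl (m \<cdot> f))"
    using M.plus_idem_mult[OF sigma_E] M.plus_mult[of "g (label G e)" "m \<cdot> f"] c e by simp
  finally show ?thesis unfolding lower_walk_eq[OF m] .
qed

lemma lower_compatible: "compatible \<kappa> G"
  unfolding compatible_def
proof (intro conjI ballI lower_E)
  fix e assume e: "e \<in> Arcs G"
  let ?t = "src G e" and ?h = "tgt G e" and ?x = "g (label G e)"
  have E: "\<sigma> ?t \<in> E" "\<kappa> ?t \<in> E" "\<kappa> ?h \<in> E" "\<sigma> ?h \<in> E" using e sigma_E lower_E by auto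
  have c: "?x \<in> carrier M" "\<sigma> ?t \<in> carrier M" "?x \<cdot> \<kappa> ?h \<in> carrier M" "?x \<cdot> \<sigma> ?h \<in> carrier M" "\<kappa> ?t \<in> carrier M"
    using E e g_label M.idem_carrier by auto
  show "pl (?x \<cdot> \<kappa> ?h) \<cdot> \<kappa> ?t = \<kappa> ?t"
  proof (cases "reach G ?h y")
    case True
    show ?thesis unfolding lower_tail[OF e True]
      using M.idem_comm[OF E(1) M.plus_in_idem[OF c(3)]] M.idem_mult_absorb[OF M.plus_in_idem[OF c(3)] c(2)] by simp
  next
    case False
    have "\<sigma> ?t \<cdot> \<kappa> ?t = \<kappa> ?t" using lower_below e by (simp add: below_def)
    then show ?thesis unfolding lower_unreached[OF False]
      using M.absorb_trans[OF M.plus_in_idem[OF c(4)] E(1) c(5) sigma_arc[OF e]] by simp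
  qed
qed

lemma walk_below:
  assumes "W v m u" "compatible \<tau> G" "below G \<tau> \<sigma>"
  shows "pl (m \<cdot> \<tau> u) \<cdot> \<tau> v = \<tau> v"
  using assms(1)
proof induction
  case start
  then show ?case using assms(2,3) M.plus_idem M.idem_sq by (simp add: compatible_def below_def)
next
  case (step m e)
  let ?t = "src G e" and ?h = "tgt G e" and ?x = "g (label G e)"
  have E: "\<tau> ?t \<in> E" "\<tau> ?h \<in> E" "\<tau> v \<in> E"
    using assms(2) step.hyps W_closed by (auto simp: compatible_def)
  have c: "m \<in> carrier M" "?x \<in> carrier M" "\<tau> ?h \<in> carrier M" "\<tau> ?t \<in> carrier M" "\<sigma> ?h \<in> carrier M"
    "\<tau> v \<in> carrier M"
    using E W_closed[OF step.hyps(1)] step.hyps(2) g_label M.idem_carrier sigma by auto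
  have e: "pl (?x \<cdot> \<tau> ?h) \<in> E" using c by (simp add: M.plus_in_idem)
  have "m \<cdot> ?x \<cdot> \<sigma> ?h \<cdot> \<tau> ?h = m \<cdot> (?x \<cdot> \<tau> ?h)"
    using assms(3) step.hyps(2) c by (simp add: below_def M.m_assoc)
  then have "pl (m \<cdot> ?x \<cdot> \<sigma> ?h \<cdot> \<tau> ?h) = pl (m \<cdot> pl (?x \<cdot> \<tau> ?h))"
    using M.plus_mult[of m "?x \<cdot> \<tau> ?h"] c by simp
  moreover have "pl (m \<cdot> pl (?x \<cdot> \<tau> ?h)) \<cdot> pl (m \<cdot> \<tau> ?t) = pl (m \<cdot> \<tau> ?t)"
    using assms(2) step.hyps(2) by (intro M.plus_mono[OF c(1) e E(1)]) (simp add: compatible_def)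
  moreover have "pl (m \<cdot> pl (?x \<cdot> \<tau> ?h)) \<in> E" "pl (m \<cdot> \<tau> ?t) \<in> E"
    using c e M.idem_carrier by (auto intro!: M.plus_in_idem)
  ultimately show ?case using M.absorb_trans[OF _ _ c(6) _ step.IH] by simp
qed

lemma lower_greatest:
  assumes "compatible \<tau> G" "below G \<tau> \<sigma>" "f \<cdot> \<tau> y = \<tau> y"
  shows "below G \<tau> \<kappa>"
  unfolding below_def
proof
  fix v assume v: "v \<in> Verts G"
  show "\<kappa> v \<cdot> \<tau> v = \<tau> v"
  proof (cases "reach G v y")
    case True
    then obtain m where m: "W v m y" by (rule reach_W)
    have E: "\<tau> y \<in> E" "\<tau> v \<in> E" using assms(1) y v by (auto simp: compatible_def)
    have c: "m \<in> carrier M" "m \<cdot> f \<in> carrier M" "m \<cdot> \<tau> y \<in> carrier M" "\<tau> v \<in> carrier M"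
      using W_closed[OF m] E fc M.idem_carrier by auto
    show ?thesis unfolding lower_walk_eq[OF m]
      using M.absorb_trans[OF M.plus_in_idem[OF c(2)] M.plus_in_idem[OF c(3)] c(4)
          M.plus_mono[OF c(1) f E(1) assms(3)] walk_below[OF m assms(1,2)]] .
  qed (use assms(2) v lower_unreached in \<open>simp add: below_def\<close>)
qed

text \<open>A walk towards \<open>y\<close> loses nothing but the factor by which its last vertex is lowered.\<close>
lemma lower_walk:
  assumes "W a m y" shows "mwalk \<kappa> G a (m \<cdot> f) y"
proof -
  have "mwalk \<kappa> G a (m \<cdot> \<kappa> v) v" if "W a m v" "reach G v y" for a m v
    using that
  proof (induction rule: wwalk.induct)
    case start
    then have "\<sigma> a \<cdot> \<kappa> a = \<kappa> a" using lower_below by (simp add: below_def)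
    then show ?case using wwalk.start[of a G M g \<kappa>] start by simp
  next
    case (step m e)
    let ?t = "src G e" and ?h = "tgt G e" and ?x = "g (label G e)"
    have E: "\<sigma> ?t \<in> E" "\<kappa> ?h \<in> E" using step.hyps sigma_E lower_E by auto
    have c: "m \<in> carrier M" "?x \<in> carrier M" "\<sigma> ?t \<in> carrier M" "\<kappa> ?h \<in> carrier M" "\<sigma> ?h \<in> carrier M"
      "?x \<cdot> \<kappa> ?h \<in> carrier M" "pl (?x \<cdot> \<kappa> ?h) \<in> carrier M"
      using W_closed[OF step.hyps(1)] step.hyps(2) g_label E M.idem_carrier sigma M.plus_carrier by auto
    have "reach G ?t y"
      using step.prems step.hyps(2) G.in_arcs_imp_in_arcs_ends by (meson G.adj_reachable_trans)
    then have w: "mwalk \<kappa> G a (m \<cdot> \<kappa> ?t) ?t" by (rule step.IH)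
    have mt: "m \<cdot> \<sigma> ?t = m" using W_right[OF step.hyps(1)] .
    have "m \<cdot> \<kappa> ?t \<cdot> ?x \<cdot> \<kappa> ?h = (m \<cdot> \<sigma> ?t) \<cdot> (pl (?x \<cdot> \<kappa> ?h) \<cdot> (?x \<cdot> \<kappa> ?h))"
      unfolding lower_tail[OF step.hyps(2) step.prems] using c by (simp add: M.m_assoc)
    also have "\<dots> = m \<cdot> (?x \<cdot> \<kappa> ?h)" using mt M.plus_left c by simp
    also have "\<dots> = m \<cdot> ?x \<cdot> \<sigma> ?h \<cdot> \<kappa> ?h"
      using lower_below step.hyps(2) c by (simp add: below_def M.m_assoc)
    finally show ?case using wwalk.step[OF w step.hyps(2)] by simp
  qed
  from this[OF assms G.reachable_refl[OF y]] have "mwalk \<kappa> G a (m \<cdot> \<kappa> y) y" .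
  moreover have "\<kappa> y = \<sigma> y \<cdot> f"
    using lower_walk_eq[OF wwalk.start[OF y]] M.plus_idem M.idem_mult sigma_E[OF y] f by simp
  ultimately show ?thesis using W_right[OF assms] W_closed[OF assms] sigma[OF y] fc
    by (simp add: M.m_assoc[symmetric])
qed

end


subsection \<open>The greatest decoration of the tree of a term\<close>

context idempath_model
begin

primrec mval :: "'x lad_term \<Rightarrow> 'm" where
  "mval (Gen x) = g x"
| "mval Unit = \<one>\<^bsub>M\<^esub>"
| "mval (Mul s t) = mval s \<cdot> mval t"
| "mval (Plus s) = pl (mval s)"

lemma decorated_graphI:
  assumes "is_xgraph X G" "compatible \<sigma> G" shows "decorated_graph C \<gamma> X M g G \<sigma>"
  by unfold_locales (use is_xgraphD[OF assms(1)] assms(2) in \<open>auto intro: wf_digraph.wellformed\<close>)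

lemma wwalk_ends:
  fixes G :: "('v, 'e, 'l) xgraph"
  shows "wwalk K \<rho> \<sigma> (ends G u v) a m b \<longleftrightarrow> wwalk K \<rho> \<sigma> G a m b"
proof -
  have ends: "wwalk K \<rho> \<sigma> (ends G u v) a m b" if "wwalk K \<rho> \<sigma> G a m b" for G :: "('v, 'e, 'l) xgraph" and u v
    using that
  proof (induction rule: wwalk.induct)
    case start
    then show ?case using wwalk.start[of a "ends G u v"] by simp
  next
    case (step m e)
    then show ?case using wwalk.step[of K \<rho> \<sigma> "ends G u v" a m e] by simp
  qed
  have "ends (ends G u v) (start G) (finish G) = G" by (simp add: ends_def)
  then show ?thesis using ends[of G u v] ends[of "ends G u v" "start G" "finish G"] by metis
qed

lemma greatest_ends: "greatest \<sigma> G \<Longrightarrow> greatest \<sigma> (ends G u v)"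
  by (simp add: greatest_def compatible_def below_def)

text \<open>
  In a product the root of the second tree is attached to the finish vertex of the first one, so
  the decoration of the first tree is lowered there by the decoration of this root.
\<close>
lemma ex_greatest_tree:
  assumes "t \<in> terms"
  shows "\<exists>\<sigma>. greatest \<sigma> (tree t) \<and> mwalk \<sigma> (tree t) 0 (mval t) (fin t)"
  using assms
proof (induction t)
  case (Gen x)
  then have x: "g x \<in> carrier M" using g by simp
  define \<sigma> where "\<sigma> = (\<lambda>i::nat. if i = 0 then pl (g x) else \<one>\<^bsub>M\<^esub>)"
  have "compatible \<sigma> (tree (Gen x))" unfolding compatible_def \<sigma>_def
    using x M.plus_in_idem M.one_idem M.idem_sq by auto
  moreover have "below (tree (Gen x)) \<tau> \<sigma>" if \<tau>: "compatible \<tau> (tree (Gen x))" for \<tau>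
    unfolding below_def
  proof
    fix i assume i: "i \<in> Verts (tree (Gen x))"
    have E: "\<tau> 0 \<in> E" "\<tau> 1 \<in> E" "pl (g x \<cdot> \<tau> 1) \<cdot> \<tau> 0 = \<tau> 0" using \<tau> by (auto simp: compatible_def)
    have c: "g x \<cdot> \<tau> 1 \<in> carrier M" "\<tau> 0 \<in> carrier M" "\<tau> 1 \<in> carrier M" using x E M.idem_carrier by auto
    have "pl (g x) \<cdot> \<tau> 0 = \<tau> 0"
      using M.absorb_trans[OF M.plus_in_idem[OF x] M.plus_in_idem[OF c(1)] c(2) M.plus_absorb_mult[OF x c(3)] E(3)] .
    then show "\<sigma> i \<cdot> \<tau> i = \<tau> i" using i c by (cases "i = 0") (auto simp: \<sigma>_def le_Suc_eq)
  qed
  moreover have "mwalk \<sigma> (tree (Gen x)) 0 (mval (Gen x)) (fin (Gen x))"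
    using wwalk.step[of M g \<sigma> "tree (Gen x)" 0 "\<sigma> 0" 1] wwalk.start[of 0 "tree (Gen x)" M g \<sigma>]
      x M.plus_left M.plus_carrier by (simp add: \<sigma>_def)
  ultimately show ?case unfolding greatest_def by blast
next
  case Unit
  have "greatest (\<lambda>_. \<one>\<^bsub>M\<^esub>) (tree Unit)"
    unfolding greatest_def compatible_def below_def using M.one_idem M.idem_carrier by auto
  moreover have "mwalk (\<lambda>_. \<one>\<^bsub>M\<^esub>) (tree Unit) 0 (mval Unit) (fin Unit)"
    using wwalk.start[of 0 "tree Unit" M g "\<lambda>_. \<one>\<^bsub>M\<^esub>"] by simp
  ultimately show ?case by blast
next
  case (Plus s)
  then obtain \<sigma> where \<sigma>: "greatest \<sigma> (tree s)" "mwalk \<sigma> (tree s) 0 (mval s) (fin s)" by auto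
  interpret decorated_graph C \<gamma> X M g "tree s" \<sigma>
    using Plus.prems is_xgraph_tree \<sigma>(1) by (intro decorated_graphI) (auto simp: greatest_def)
  have "mwalk \<sigma> (tree s) 0 (mval (Plus s)) (fin (Plus s))"
    using plus_walk[OF \<sigma>(2)] wwalk.start[of 0 "tree s" M g \<sigma>] by simp
  then have "mwalk \<sigma> (tree (Plus s)) 0 (mval (Plus s)) (fin (Plus s))"
    unfolding tree_Plus wwalk_ends .
  moreover have "greatest \<sigma> (tree (Plus s))" unfolding tree_Plus by (rule greatest_ends) (rule \<sigma>(1))
  ultimately show ?case by blast
next
  case (Mul s t)
  then have st: "s \<in> terms" "t \<in> terms" by auto
  obtain \<sigma>s where s: "greatest \<sigma>s (tree s)" "mwalk \<sigma>s (tree s) 0 (mval s) (fin s)" using Mul.IH(1)[OF st(1)] by blast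
  obtain \<sigma>t where t: "greatest \<sigma>t (tree t)" "mwalk \<sigma>t (tree t) 0 (mval t) (fin t)" using Mul.IH(2)[OF st(2)] by blast
  have cs: "compatible \<sigma>s (tree s)" and ct: "compatible \<sigma>t (tree t)" using s t by (auto simp: greatest_def)
  interpret T: decorated_graph C \<gamma> X M g "tree t" \<sigma>t
    using st is_xgraph_tree ct by (intro decorated_graphI) auto
  interpret S: decorated_graph C \<gamma> X M g "tree s" \<sigma>s
    using st is_xgraph_tree cs by (intro decorated_graphI) auto
  have E0: "\<sigma>t 0 \<in> E" using T.sigma_E by simp
  interpret S: functional_graph C \<gamma> X M g "tree s" \<sigma>s "fin s" "\<sigma>t 0"
    using treelike_functional[OF tree_treelike S.weighted_axioms] st fin_le[of s] E0 by unfold_locales auto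
  let ?l = "S.lower (fin s) (\<sigma>t 0)" and ?n = "gens s" and ?st = "tree (Mul s t)"
  define \<sigma> where "\<sigma> = (\<lambda>i. if i \<le> ?n then ?l i else \<sigma>t (i - ?n))"
  have c: "compatible ?l (tree s)" by (rule S.lower_compatible)
  have lf: "?l (fin s) = \<sigma>s (fin s) \<cdot> \<sigma>t 0"
    using S.lower_walk_eq[OF wwalk.start] fin_le[of s] M.plus_idem M.idem_mult S.sigma_E E0 by simp
  have Es: "\<sigma>s (fin s) \<in> E" using S.sigma_E fin_le[of s] by simp
  have shift: "\<sigma> (shift s j) = (if j = 0 then \<sigma>s (fin s) \<cdot> \<sigma>t 0 else \<sigma>t j)" for j
    using fin_le[of s] by (auto simp: \<sigma>_def shift_def lf)
  have "compatible \<sigma> ?st" unfolding compatible_def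
  proof (intro conjI ballI)
    fix i assume "i \<in> Verts ?st"
    then show "\<sigma> i \<in> E" using S.lower_E T.sigma_E by (auto simp: \<sigma>_def)
  next
    fix i assume i: "i \<in> Arcs ?st"
    show "pl (g (label ?st i) \<cdot> \<sigma> (tgt ?st i)) \<cdot> \<sigma> (src ?st i) = \<sigma> (src ?st i)"
    proof (cases "i \<le> ?n")
      case True
      then have "parent s i < i" using parent_less[of i s] i by simp
      then show ?thesis using c i True by (simp add: compatible_def \<sigma>_def)
    next
      case False
      define j where "j = i - ?n"
      have ij: "i = shift s j" "0 < j" "j \<le> gens t"
        using i False unfolding shift_def j_def tree_simps gens.simps by simp_all
      have head: "tgt ?st i = shift s j" unfolding tree_simps by (rule ij(1))
      have lab: "label ?st i = letter t j" "src ?st i = shift s (parent t j)"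
        using False by (simp_all add: j_def)
      have arc: "pl (g (letter t j) \<cdot> \<sigma>t j) \<cdot> \<sigma>t (parent t j) = \<sigma>t (parent t j)"
        using ct ij by (simp add: compatible_def)
      have gj: "g (letter t j) \<cdot> \<sigma>t j \<in> carrier M" using T.g_label[of j] T.sigma[of j] ij by simp
      show ?thesis
      proof (cases "parent t j = 0")
        case True
        have "pl (g (letter t j) \<cdot> \<sigma>t j) \<cdot> (\<sigma>s (fin s) \<cdot> \<sigma>t 0) = \<sigma>s (fin s) \<cdot> \<sigma>t 0"
          using arc True M.idem_comm[OF Es E0] M.m_assoc[of "pl (g (letter t j) \<cdot> \<sigma>t j)" "\<sigma>t 0" "\<sigma>s (fin s)"]
            M.plus_carrier[OF gj] Es E0 M.idem_carrier by simp
        then show ?thesis unfolding lab head shift using ij(2) True by simp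
      next
        case False
        then show ?thesis unfolding lab head shift using ij(2) arc by simp
      qed
    qed
  qed
  moreover have "below ?st \<tau> \<sigma>" if \<tau>: "compatible \<tau> ?st" for \<tau>
  proof -
    have \<tau>s: "compatible \<tau> (tree s)"
      using compatible_pullback[OF morphism_tree_left[of s 0 0 t], of \<tau>] \<tau>
      by (simp add: compatible_def)
    have \<tau>t: "compatible (\<lambda>i. \<tau> (shift s i)) (tree t)"
      using compatible_pullback[OF morphism_tree_right[of t 0 0 s], of \<tau>] \<tau>
      by (simp add: compatible_def)
    have bt: "below (tree t) (\<lambda>i. \<tau> (shift s i)) \<sigma>t" using t(1) \<tau>t by (simp add: greatest_def)
    have "\<sigma>t 0 \<cdot> \<tau> (fin s) = \<tau> (fin s)" using bspec[OF bt[unfolded below_def], of 0] by (simp add: shift_def)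
    then have bs: "below (tree s) \<tau> ?l" using s(1) \<tau>s by (intro S.lower_greatest) (auto simp: greatest_def)
    show ?thesis unfolding below_def
    proof
      fix i assume i: "i \<in> Verts ?st"
      show "\<sigma> i \<cdot> \<tau> i = \<tau> i"
      proof (cases "i \<le> ?n")
        case True
        then show ?thesis using bs by (simp add: below_def \<sigma>_def)
      next
        case False
        then have "shift s (i - ?n) = i" "i - ?n \<in> Verts (tree t)" using i by (auto simp: shift_def)
        then show ?thesis using bt False unfolding below_def \<sigma>_def by metis
      qed
    qed
  qed
  moreover have "mwalk \<sigma> ?st 0 (mval (Mul s t)) (fin (Mul s t))"
  proof -
    have "mwalk ?l (tree s) 0 (mval s \<cdot> \<sigma>t 0) (fin s)" using S.lower_walk s(2) by blast
    then have "mwalk ?l (ends (tree s) 0 0) 0 (mval s \<cdot> \<sigma>t 0) (fin s)" unfolding wwalk_ends .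
    from wwalk_morphism[OF morphism_tree_left[of s 0 0 t] _ _ this, of \<sigma>]
    have w1: "mwalk \<sigma> ?st 0 (mval s \<cdot> \<sigma>t 0) (fin s)"
      unfolding wwalk_ends using wf_tree[of s] by (simp add: \<sigma>_def)
    \<comment> \<open>Only the first vertex of a walk in the second tree carries more than in that tree, as no edge enters it.\<close>
    have w2: "mwalk \<sigma> ?st (fin s) (\<sigma>s (fin s) \<cdot> \<sigma>t 0 \<cdot> m) (shift s b)" if "mwalk \<sigma>t (tree t) 0 m b" for m b
      using that
    proof (induction rule: wwalk.induct)
      case start
      have "\<sigma>s (fin s) \<cdot> \<sigma>t 0 \<cdot> \<sigma>t 0 = \<sigma>s (fin s) \<cdot> \<sigma>t 0"
        using M.m_assoc Es E0 M.idem_carrier M.idem_sq by simp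
      moreover have "\<sigma> (fin s) = \<sigma>s (fin s) \<cdot> \<sigma>t 0" using shift[of 0] by (simp add: shift_def)
      ultimately show ?case using wwalk.start[of "fin s" ?st M g \<sigma>] fin_le[of s] by (simp add: shift_def)
    next
      case (step m e)
      then have e: "0 < e" "e \<le> gens t" by auto
      have lab: "label ?st (shift s e) = letter t e" "src ?st (shift s e) = shift s (parent t e)"
        "tgt ?st (shift s e) = shift s e" "shift s e \<in> Arcs ?st" "\<sigma> (shift s e) = \<sigma>t e"
        using e shift[of e] by (auto simp: shift_def)
      have cm: "m \<in> carrier M" "g (letter t e) \<in> carrier M" "\<sigma>t e \<in> carrier M" "\<sigma>s (fin s) \<cdot> \<sigma>t 0 \<in> carrier M"
        using T.W_closed[OF step.hyps(1)] T.g_label[of e] T.sigma[of e] e Es E0 M.idem_carrier by auto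
      from wwalk.step[of M g \<sigma> ?st "fin s" "\<sigma>s (fin s) \<cdot> \<sigma>t 0 \<cdot> m" "shift s e"] step.IH lab
      show ?case using cm by (simp add: M.m_assoc)
    qed
    have cst: "mval s \<in> carrier M" "mval t \<in> carrier M" using S.W_closed[OF s(2)] T.W_closed[OF t(2)] by auto
    interpret ST: decorated_graph C \<gamma> X M g ?st \<sigma>
      using Mul.prems is_xgraph_tree[of "Mul s t" X] \<open>compatible \<sigma> ?st\<close> by (intro decorated_graphI) auto
    note c4 = cst Es[THEN M.idem_carrier] E0[THEN M.idem_carrier]
    have "mval s \<cdot> \<sigma>t 0 \<cdot> (\<sigma>s (fin s) \<cdot> \<sigma>t 0 \<cdot> mval t) = mval s \<cdot> (\<sigma>t 0 \<cdot> \<sigma>s (fin s)) \<cdot> (\<sigma>t 0 \<cdot> mval t)"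
      using c4 by (simp add: M.m_assoc)
    also have "\<dots> = mval s \<cdot> \<sigma>s (fin s) \<cdot> (\<sigma>t 0 \<cdot> (\<sigma>t 0 \<cdot> mval t))"
      unfolding M.idem_comm[OF E0 Es] using c4 by (simp add: M.m_assoc)
    also have "\<dots> = mval s \<cdot> mval t" using S.W_right[OF s(2)] T.W_left[OF t(2)] by simp
    finally have "mval s \<cdot> \<sigma>t 0 \<cdot> (\<sigma>s (fin s) \<cdot> \<sigma>t 0 \<cdot> mval t) = mval s \<cdot> mval t" .
    then show ?thesis using ST.W_trans[OF w1 w2[OF t(2)]] unfolding fin_Mul mval.simps by simp
  qed
  ultimately show ?case unfolding greatest_def by blast
qed

end


subsection \<open>The greatest decoration of a descendant\<close>

context idempath_model
begin

text \<open>
  Identifying \<open>x\<close> with \<open>y\<close> lowers the decoration at \<open>y\<close> to the one at \<open>x\<close>. The value of a walk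
  from the start vertex does not change: a vertex with a new decoration lies on a walk from \<open>x\<close> to \<open>y\<close>,
  and the lowered factor is absorbed by the part of the walk that comes before it.
\<close>
lemma greatest_identify:
  assumes x: "is_xgraph X G" and inv: "functional C \<gamma> (\<lambda>_. \<one>) G" "ancestors_comparable G"
    and walks_functional: "functional M g \<sigma> G" and \<sigma>: "greatest \<sigma> G" and xy: "cval G x \<one> y"
    and walk: "mwalk \<sigma> G (start G) m b"
  shows "\<exists>\<sigma>'. greatest \<sigma>' (identify x y G) \<and>
    mwalk \<sigma>' (identify x y G) (start (identify x y G)) m ((id(y := x)) b)"
proof -
  note G = is_xgraphD[OF x]
  interpret decorated_graph C \<gamma> X M g G \<sigma> using x \<sigma> by (intro decorated_graphI) (auto simp: greatest_def)
  have wxy: "W x (\<sigma> x) y" using idempath_walk[OF decorated_graph_axioms inv(1) xy] .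
  have V: "x \<in> Verts G" "y \<in> Verts G" using W_closed[OF wxy] by auto
  interpret functional_graph C \<gamma> X M g G \<sigma> y "\<sigma> x"
    using walks_functional V sigma_E by unfold_locales auto
  let ?q = "id(y := x)" and ?H = "identify x y G"
  have Ex: "\<sigma> x \<in> E" and cx: "\<sigma> x \<in> carrier M" using sigma_E[OF V(1)] M.idem_carrier by auto
  have above: "\<kappa> v = \<sigma> v" if r: "reach G v x" for v
  proof -
    obtain n where n: "W v n x" using reach_W[OF r] .
    have "W v n y" using W_trans[OF n wxy] W_right[OF n] by simp
    then show ?thesis using lower_walk_eq W_right[OF n] plus_walk[OF n] by simp
  qed
  have "W y (\<sigma> y) y" using V(2) by (rule wwalk.start)
  then have "\<kappa> y = \<sigma> y \<cdot> \<sigma> x" using lower_walk_eq M.plus_idem M.idem_mult Ex sigma_E[OF V(2)] by simp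
  also have "\<dots> = \<sigma> x" using M.idem_comm[OF Ex sigma_E[OF V(2)]] W_right[OF wxy] by simp
  finally have ky: "\<kappa> y = \<sigma> x" .
  have kx: "\<kappa> x = \<sigma> x" using above V(1) G.reachable_refl by blast
  have kq: "\<kappa> (?q v) = \<kappa> v" for v using kx ky by simp
  \<comment> \<open>The walk \<open>p\<close> may first be continued to \<open>y\<close>, jump to \<open>x\<close> and be repeated: \<open>p = p r p\<close>, where \<open>r p\<close> is idempotent.\<close>
  have absorb: "p \<cdot> \<kappa> u = p" if p: "W x p u" and r: "reach G u y" for p u
  proof -
    obtain r where r: "W u r y" using reach_W[OF r] .
    have c: "p \<in> carrier M" "r \<in> carrier M" using W_closed p r by auto
    obtain cp where cp: "cval G x cp u" "decorated p cp" using walk_decorated[OF p] by blast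
    obtain cr where cr: "cval G u cr y" "decorated r cr" using walk_decorated[OF r] by blast
    have "cp \<otimes> cr = \<one>" using cv.functionalD[OF inv(1) cv.W_trans[OF cp(1) cr(1)] xy] .
    then have "cr \<otimes> cp = \<one>" using left_inverse_right_inverse cv.W_closed cp(1) cr(1) by blast
    then have rp: "r \<cdot> p \<in> E" using decorated_mult[OF cr(2) cp(2)] decorated_idempotent by simp
    have pr: "p \<cdot> r = \<sigma> x" using functionalD[OF walks_functional W_trans[OF p r] wxy] .
    have sp: "\<sigma> x \<cdot> p = p" using W_left[OF p] .
    have prp: "p \<cdot> (r \<cdot> p) = p" using sp c by (simp add: pr flip: M.m_assoc)
    have rsp: "r \<cdot> \<sigma> x \<cdot> p = r \<cdot> p" using sp c cx by (simp add: M.m_assoc)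
    have "pl (r \<cdot> \<sigma> x) \<cdot> (r \<cdot> p) = r \<cdot> p"
      using M.plus_absorb_mult[of "r \<cdot> \<sigma> x" p] rsp M.plus_idem[OF rp] c cx by simp
    moreover have "pl (r \<cdot> \<sigma> x) \<in> E" using c cx by (intro M.plus_in_idem) auto
    ultimately have "(r \<cdot> p) \<cdot> pl (r \<cdot> \<sigma> x) = r \<cdot> p" using M.idem_comm rp by metis
    then have "p \<cdot> (r \<cdot> p) \<cdot> pl (r \<cdot> \<sigma> x) = p \<cdot> (r \<cdot> p)"
      using c cx M.plus_carrier by (simp add: M.m_assoc)
    then show ?thesis using prp lower_walk_eq[OF r] by simp
  qed
  obtain n where n: "W (start G) n x" using reach_W[OF G(7)[OF V(1)]] .
  have keep: "m \<cdot> \<kappa> v = m" if m: "W (start G) m v" for m v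
  proof (cases "reach G v y")
    case False
    then show ?thesis using lower_unreached W_right[OF m] by simp
  next
    case True
    then have "reach G v x \<or> reach G x v"
      using inv(2) W_reach[OF wxy] unfolding ancestors_comparable_def by blast
    then show ?thesis
    proof
      assume "reach G v x"
      then show ?thesis using above W_right[OF m] by simp
    next
      assume "reach G x v"
      then obtain p where p: "W x p v" by (rule reach_W)
      have "m = n \<cdot> p" using functionalD[OF walks_functional m W_trans[OF n p]] .
      moreover have "\<kappa> v \<in> carrier M" using lower_E W_closed[OF p] M.idem_carrier by blast
      ultimately show ?thesis using absorb[OF p True] W_closed[OF n] W_closed[OF p] by (simp add: M.m_assoc)
    qed
  qed
  have "mwalk \<kappa> G (start G) m b" using walk
  proof (induction rule: wwalk.induct)
    case start
    then have "\<sigma> (start G) \<cdot> \<kappa> (start G) = \<sigma> (start G)" by (intro keep wwalk.start)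
    moreover have "\<sigma> (start G) \<cdot> \<kappa> (start G) = \<kappa> (start G)" using lower_below start by (simp add: below_def)
    ultimately show ?case using wwalk.start[OF start, of M g \<kappa>] by simp
  next
    case (step m e)
    let ?h = "tgt G e"
    have h: "?h \<in> Verts G" using step.hyps(2) by simp
    have c: "m \<in> carrier M" "g (label G e) \<in> carrier M" "\<sigma> ?h \<in> carrier M" "\<kappa> ?h \<in> carrier M"
      using W_closed[OF step.hyps(1)] step.hyps(2) g_label sigma lower_E[OF h] M.idem_carrier by auto
    have "m \<cdot> g (label G e) \<cdot> \<kappa> ?h = m \<cdot> g (label G e) \<cdot> (\<sigma> ?h \<cdot> \<kappa> ?h)"
      using lower_below h by (simp add: below_def)
    also have "\<dots> = m \<cdot> g (label G e) \<cdot> \<sigma> ?h" using keep[OF wwalk.step[OF step.hyps]] c by (simp add: M.m_assoc)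
    finally show ?case using wwalk.step[OF step.IH step.hyps(2)] by simp
  qed
  then have "mwalk \<kappa> ?H (?q (start G)) m (?q b)"
    by (rule wwalk_morphism[OF morphism_identify wf, where \<sigma> = \<kappa> and \<tau> = \<kappa>, OF kq])
  moreover have "compatible \<kappa> ?H"
    using lower_compatible unfolding compatible_def by (auto simp: kq simp del: fun_upd_apply)
  moreover have "below ?H \<tau> \<kappa>" if \<tau>: "compatible \<tau> ?H" for \<tau>
  proof -
    have c: "compatible (\<lambda>v. \<tau> (?q v)) G" by (rule compatible_pullback[OF morphism_identify \<tau>])
    have b: "below G (\<lambda>v. \<tau> (?q v)) \<sigma>" using \<sigma> c by (simp add: greatest_def)
    have "\<sigma> x \<cdot> \<tau> (?q y) = \<tau> (?q y)" using bspec[OF b[unfolded below_def] V(1)] by (simp split: if_splits)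
    then have "below G (\<lambda>v. \<tau> (?q v)) \<kappa>" by (rule lower_greatest[OF c b])
    then show ?thesis unfolding below_def using kq by (auto simp del: fun_upd_apply)
  qed
  ultimately show ?thesis unfolding greatest_def by (intro exI[of _ \<kappa>]) simp
qed

lemma ex_greatest_descendant:
  assumes t: "t \<in> terms" and d: "descendant C \<gamma> (tree t) G"
  shows "\<exists>\<sigma>. greatest \<sigma> G \<and> mwalk \<sigma> G (start G) (mval t) (finish G)"
proof -
  have x: "is_xgraph X (tree t)" using t is_xgraph_tree by simp
  show ?thesis using d x
  proof (induction rule: descendant_induct)
    case base
    then show ?case using ex_greatest_tree[OF t] by simp
  next
    case (step H u p v)
    note H = is_xgraphD[OF step.hyps(2)]
    have T: "treelike X (tree t)" using t tree_treelike by simp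
    obtain \<sigma> where \<sigma>: "greatest \<sigma> H" "mwalk \<sigma> H (start H) (mval t) (finish H)" using step.IH by blast
    have "functional M g \<sigma> H"
      using descendant_functional[OF T step.hyps(1)] \<sigma>(1) by (simp add: greatest_def)
    moreover have "cval H u \<one> v" using idempath_cval[OF H(1,6)] step.hyps(3) by metis
    ultimately show ?case
      using greatest_identify[OF step.hyps(2) _ _ _ \<sigma>(1) _ \<sigma>(2)] descendant_invariants[OF T step.hyps(1)] by simp
  qed
qed


section \<open>Completeness\<close>

text \<open>
  On the common retracted image of the two closures both greatest decorations agree, since either of
  them can be pulled back along the retraction to a compatible decoration of the other graph; and
  the value of a term is the value of any walk from the start vertex to the finish vertex, in
  particular of one in the retracted image.
\<close>
lemma mval_eq_of_sim:
  assumes s: "s \<in> terms" and t: "t \<in> terms" and "sim s t"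
  shows "mval s = mval t"
proof -
  let ?S = "cl s" and ?T = "cl t"
  note S = cl_props[OF s] and T = cl_props[OF t]
  have ts: "is_xgraph X (tree s)" "is_xgraph X (tree t)" "treelike X (tree s)" "treelike X (tree t)"
    using s t is_xgraph_tree tree_treelike by auto
  note dS = closure_descendant(1)[OF ts(1), of C \<gamma>] and dT = closure_descendant(1)[OF ts(2), of C \<gamma>]
  obtain \<sigma> where \<sigma>: "greatest \<sigma> ?S" "mwalk \<sigma> ?S (start ?S) (mval s) (finish ?S)"
    using ex_greatest_descendant[OF s dS] by blast
  obtain \<tau> where \<tau>: "greatest \<tau> ?T" "mwalk \<tau> ?T (start ?T) (mval t) (finish ?T)"
    using ex_greatest_descendant[OF t dT] by blast
  have f: "functional M g \<sigma> ?S" "functional M g \<tau> ?T"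
    using descendant_functional ts(3,4) dS dT \<sigma>(1) \<tau>(1) by (auto simp: greatest_def)
  obtain f1 g1 where r1: "retract ?S f1 g1" "core ?S = image_graph ?S f1 g1" using core_retract[OF S(1)] by metis
  obtain f2 g2 where r2: "retract ?T f2 g2" "core ?T = image_graph ?T f2 g2" using core_retract[OF T(1)] by metis
  note kS = core_props(1)[OF S(1)] and kT = core_props(1)[OF T(1)]
  note m1 = image_graph_morphisms[OF r1(1), folded r1(2)] and m2 = image_graph_morphisms[OF r2(1), folded r2(2)]
  have "pretzel C \<gamma> (tree s) = pretzel C \<gamma> (tree t)" using pretzel_tree_eq_iff assms by blast
  then have "xisomorphic (core ?S) (core ?T)" by (rule pretzel_eqD[OF ts(1,2)])
  then obtain i k where i: "morphism (core ?S) (core ?T) i k"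
    "bij_betw i (Verts (core ?S)) (Verts (core ?T))" "bij_betw k (Arcs (core ?S)) (Arcs (core ?T))"
    by (auto simp: xisomorphic_def)
  let ?j = "inv_into (Verts (core ?S)) i"
  have j: "morphism (core ?T) (core ?S) ?j (inv_into (Arcs (core ?S)) k)"
    by (rule xisomorphic_inverse[OF i kS])
  have fwd: "morphism ?S ?T (id \<circ> (i \<circ> f1)) (id \<circ> (k \<circ> g1))"
    by (intro morphism_comp[OF _ m2(2)] morphism_comp[OF m1(1)] i(1))
  have bwd: "morphism ?T ?S (id \<circ> (?j \<circ> f2)) (id \<circ> (inv_into (Arcs (core ?S)) k \<circ> g2))"
    by (intro morphism_comp[OF _ m1(2)] morphism_comp[OF m2(1)] j)
  have agree: "\<tau> (i v) = \<sigma> v" if v: "v \<in> Verts (core ?S)" for v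
  proof -
    have vS: "v \<in> Verts ?S" using morphismD(1)[OF m1(2) v] by simp
    have iv: "i v \<in> Verts (core ?T)" using morphismD(1)[OF i(1) v] .
    then have ivT: "i v \<in> Verts ?T" using morphismD(1)[OF m2(2)] by simp
    have fix1: "f1 v = v" using r1 v by (auto simp: retract_def)
    have fix2: "f2 (i v) = i v" using r2 iv by (auto simp: retract_def)
    have inv: "?j (i v) = v" using bij_betw_inv_into_left[OF i(2) v] .
    have "below ?S (\<lambda>v. \<tau> ((id \<circ> (i \<circ> f1)) v)) \<sigma>"
      using \<sigma>(1) \<tau>(1) compatible_pullback[OF fwd] unfolding greatest_def by blast
    from bspec[OF this[unfolded below_def] vS]
    have "\<sigma> v \<cdot> \<tau> (i v) = \<tau> (i v)" using fix1 by simp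
    moreover have "below ?T (\<lambda>v. \<sigma> ((id \<circ> (?j \<circ> f2)) v)) \<tau>"
      using \<sigma>(1) \<tau>(1) compatible_pullback[OF bwd] unfolding greatest_def by blast
    from bspec[OF this[unfolded below_def] ivT]
    have "\<tau> (i v) \<cdot> \<sigma> v = \<sigma> v" using fix2 inv by simp
    ultimately show ?thesis
      using M.idem_antisym \<sigma>(1) \<tau>(1) vS ivT by (auto simp: greatest_def compatible_def)
  qed
  note KS = is_xgraphD[OF kS]
  have "compatible (\<lambda>v. \<sigma> (id v)) (core ?S)"
    using compatible_pullback[OF m1(2)] \<sigma>(1) by (simp add: greatest_def)
  then interpret K: decorated_graph C \<gamma> X M g "core ?S" \<sigma> using kS by (intro decorated_graphI) auto
  obtain m where m: "mwalk \<sigma> (core ?S) (start (core ?S)) m (finish (core ?S))"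
    using K.reach_W[OF KS(7)[OF KS(5)]] .
  have "mwalk \<sigma> ?S (id (start (core ?S))) m (id (finish (core ?S)))"
    by (rule wwalk_morphism[OF m1(2) KS(1) _ m]) simp
  then have "mwalk \<sigma> ?S (start ?S) m (finish ?S)"
    using morphismD(3,4)[OF m1(2)] by simp
  then have "m = mval s" using f(1) \<sigma>(2) unfolding functional_def by blast
  moreover have "mwalk \<tau> ?T ((id \<circ> i) (start (core ?S))) m ((id \<circ> i) (finish (core ?S)))"
    by (rule wwalk_morphism[OF morphism_comp[OF i(1) m2(2)] KS(1) _ m]) (simp add: agree)
  then have "mwalk \<tau> ?T (start ?T) m (finish ?T)"
    using morphismD(3,4)[OF morphism_comp[OF i(1) m2(2)]] by simp
  then have "m = mval t" using f(2) \<tau>(2) unfolding functional_def by blast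
  ultimately show ?thesis by simp
qed

end


section \<open>The presentation of the pretzel monoid\<close>

context right_cancellative_labels
begin

definition idempath_relations :: "'x lad_term set rel" where
  "idempath_relations = {(plus_op (free_lad X) (word_val (free_lad X) (free_gen X) w),
    word_val (free_lad X) (free_gen X) w) | w. w \<in> lists X \<and> word_val C \<gamma> w = \<one>}"

abbreviation "free_class t \<equiv> lad_congruence (term_alg X) {} `` {t}"

primrec word_term :: "'x list \<Rightarrow> 'x lad_term" where
  "word_term [] = Unit"
| "word_term (x # w) = Mul (Gen x) (word_term w)"

lemma term_alg_simps [simp]:
  "a \<otimes>\<^bsub>term_alg X\<^esub> b = Mul a b" "plus_op (term_alg X) a = Plus a" "\<one>\<^bsub>term_alg X\<^esub> = Unit"
  by (simp_all add: term_alg_def)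

lemma closed_term_alg: "closed_alg (term_alg X)"
  by (simp add: closed_alg_def)

lemma sim_props: "sim s s" "sim s t \<Longrightarrow> sim t s" "sim s t \<Longrightarrow> sim t u \<Longrightarrow> sim s u"
  "sim s s' \<Longrightarrow> sim t t' \<Longrightarrow> sim (Mul s t) (Mul s' t')" "sim s s' \<Longrightarrow> sim (Plus s) (Plus s')"
  by (auto simp: sim_def)

definition sim_rel :: "'x lad_term rel" where
  "sim_rel = {(s, t). s \<in> terms \<and> t \<in> terms \<and> sim s t}"

lemma congruence_sim_rel: "congruence (term_alg X) sim_rel"
  unfolding congruence_def
proof (intro conjI)
  show "equiv terms sim_rel"
    by (rule equivI) (auto simp: refl_on_def sym_def trans_def sim_rel_def intro: sim_props)
qed (auto simp: sim_rel_def intro: sim_props)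

lemma left_adequate_term_quotient: "left_adequate (quotient_alg (term_alg X) sim_rel)"
  using alg_hom_quotient[OF closed_term_alg congruence_sim_rel]
  by (intro left_adequate_of_kernel_sim[of _ "\<lambda>t. sim_rel `` {t}"]) (auto simp: sim_rel_def)

lemma free_congruence:
  "congruence (term_alg X) (lad_congruence (term_alg X) {})" "lad_congruence (term_alg X) {} \<subseteq> sim_rel"
  using lad_congruence_congruence[OF congruence_sim_rel _ left_adequate_term_quotient, of "{}"] by auto

lemmas free_class_hom = alg_hom_quotient[OF closed_term_alg free_congruence(1), folded free_lad_def]

lemma free_class_in: "t \<in> terms \<Longrightarrow> free_class t \<in> carrier (free_lad X)"
  unfolding free_class_hom(2)[symmetric] by (rule imageI)

lemma closed_free_lad: "closed_alg (free_lad X)"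
  by (rule closed_hom_image[OF closed_term_alg free_class_hom(1,2)])

lemma word_term_in: "set w \<subseteq> X \<Longrightarrow> word_term w \<in> terms"
  by (induction w) auto

lemma free_word_val:
  assumes "set w \<subseteq> X" shows "word_val (free_lad X) (free_gen X) w = free_class (word_term w)"
  using assms
proof (induction w)
  case Nil
  then show ?case using free_class_hom(1) by (simp add: word_val_def alg_hom_def)
next
  case (Cons x w)
  then have "free_class (Mul (Gen x) (word_term w)) =
      free_class (Gen x) \<otimes>\<^bsub>free_lad X\<^esub> free_class (word_term w)"
    using free_class_hom(1) word_term_in by (simp add: alg_hom_def)
  then show ?case using Cons by (simp add: word_val_def free_gen_def)
qed

lemma trunk_val_word_term: "set w \<subseteq> X \<Longrightarrow> trunk_val (word_term w) = word_val C \<gamma> w"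
  by (induction w) (auto simp: word_val_def)

definition free_sim_rel :: "'x lad_term set rel" where
  "free_sim_rel = {(free_class s, free_class t) | s t. s \<in> terms \<and> t \<in> terms \<and> sim s t}"

lemma free_sim_rel_iff:
  assumes "s \<in> terms" "t \<in> terms" shows "(free_class s, free_class t) \<in> free_sim_rel \<longleftrightarrow> sim s t"
proof
  assume "(free_class s, free_class t) \<in> free_sim_rel"
  then obtain s' t' where st: "s' \<in> terms" "t' \<in> terms" "sim s' t'" "free_class s = free_class s'"
    "free_class t = free_class t'" by (auto simp: free_sim_rel_def)
  then have "sim s s'" "sim t t'"
    using free_class_hom(3) free_congruence(2) assms by (auto simp: sim_rel_def)
  then show "sim s t" using st(3) by (simp add: sim_def)
qed (use assms in \<open>auto simp: free_sim_rel_def\<close>)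

lemma congruence_free_sim_rel: "congruence (free_lad X) free_sim_rel"
proof -
  have car: "\<exists>t\<in>terms. a = free_class t" if "a \<in> carrier (free_lad X)" for a
    using that free_class_hom(2) by blast
  have rel: "\<exists>s t. a = free_class s \<and> b = free_class t \<and> s \<in> terms \<and> t \<in> terms \<and> sim s t"
    if "(a, b) \<in> free_sim_rel" for a b using that by (auto simp: free_sim_rel_def)
  have memI: "(free_class s, free_class t) \<in> free_sim_rel" if "s \<in> terms" "t \<in> terms" "sim s t" for s t
    using that free_sim_rel_iff by blast
  have mult: "free_class s \<otimes>\<^bsub>free_lad X\<^esub> free_class t = free_class (Mul s t)" if "s \<in> terms" "t \<in> terms" for s t
    using free_class_hom(1) that by (simp add: alg_hom_def)
  have plus: "plus_op (free_lad X) (free_class t) = free_class (Plus t)" if "t \<in> terms" for t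
    using free_class_hom(1) that by (simp add: alg_hom_def)
  show ?thesis unfolding congruence_def
  proof (intro conjI)
    show "equiv (carrier (free_lad X)) free_sim_rel"
    proof (rule equivI)
      show "free_sim_rel \<subseteq> carrier (free_lad X) \<times> carrier (free_lad X)" by (auto simp: free_sim_rel_def intro: free_class_in)
      show "refl_on (carrier (free_lad X)) free_sim_rel"
        using car memI sim_props(1) by (fastforce simp: refl_on_def)
      show "sym free_sim_rel" using rel memI sim_props(2) by (metis symI)
      show "trans free_sim_rel"
      proof (rule transI)
        fix a b c assume "(a, b) \<in> free_sim_rel" "(b, c) \<in> free_sim_rel"
        then obtain s t u v where *: "a = free_class s" "b = free_class t" "s \<in> terms" "t \<in> terms" "sim s t"
          "b = free_class u" "c = free_class v" "u \<in> terms" "v \<in> terms" "sim u v" using rel by metis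
        then have "sim t u" using free_sim_rel_iff[of t u] free_sim_rel_iff[of t t] sim_props(1) by metis
        then show "(a, c) \<in> free_sim_rel" using * memI sim_props(3) by metis
      qed
    qed
    show "\<forall>(a, a')\<in>free_sim_rel. \<forall>(b, b')\<in>free_sim_rel.
      (a \<otimes>\<^bsub>free_lad X\<^esub> b, a' \<otimes>\<^bsub>free_lad X\<^esub> b') \<in> free_sim_rel"
    proof (clarify)
      fix a a' b b' assume "(a, a') \<in> free_sim_rel" "(b, b') \<in> free_sim_rel"
      then obtain s t u v where *: "a = free_class s" "a' = free_class t" "s \<in> terms" "t \<in> terms" "sim s t"
        "b = free_class u" "b' = free_class v" "u \<in> terms" "v \<in> terms" "sim u v" using rel by metis
      have "(free_class (Mul s u), free_class (Mul t v)) \<in> free_sim_rel"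
        using * by (intro memI sim_props(4)) auto
      then show "(a \<otimes>\<^bsub>free_lad X\<^esub> b, a' \<otimes>\<^bsub>free_lad X\<^esub> b') \<in> free_sim_rel"
        using * mult by simp
    qed
    show "\<forall>(a, a')\<in>free_sim_rel. (plus_op (free_lad X) a, plus_op (free_lad X) a') \<in> free_sim_rel"
    proof (clarify)
      fix a a' assume "(a, a') \<in> free_sim_rel"
      then obtain s t where *: "a = free_class s" "a' = free_class t" "s \<in> terms" "t \<in> terms" "sim s t"
        using rel by metis
      have "(free_class (Plus s), free_class (Plus t)) \<in> free_sim_rel"
        using * by (intro memI sim_props(5)) auto
      then show "(plus_op (free_lad X) a, plus_op (free_lad X) a') \<in> free_sim_rel"
        using * plus by simp
    qed
  qed
qed

lemma idempath_relations_sim: "idempath_relations \<subseteq> free_sim_rel"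
proof
  fix r assume "r \<in> idempath_relations"
  then obtain w where w: "set w \<subseteq> X" "word_val C \<gamma> w = \<one>"
    "r = (plus_op (free_lad X) (free_class (word_term w)), free_class (word_term w))"
    using free_word_val by (auto simp: idempath_relations_def lists_eq_set)
  note t = word_term_in[OF w(1)]
  have "plus_op (free_lad X) (free_class (word_term w)) = free_class (Plus (word_term w))"
    using free_class_hom(1) t by (simp add: alg_hom_def)
  moreover have "sim (word_term w) (Plus (word_term w))"
    using sim_Plus_of_trunk_val_one trunk_val_word_term w(1,2) by simp
  ultimately show "r \<in> free_sim_rel" unfolding w(3)
    using free_sim_rel_iff[of "Plus (word_term w)" "word_term w"] t sim_props(2) by simp
qed

lemma left_adequate_free_quotient: "left_adequate (quotient_alg (free_lad X) free_sim_rel)"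
proof (rule left_adequate_of_kernel_sim)
  note q = alg_hom_quotient[OF closed_free_lad congruence_free_sim_rel]
  show "alg_hom (term_alg X) (quotient_alg (free_lad X) free_sim_rel) (\<lambda>t. free_sim_rel `` {free_class t})"
    by (rule alg_hom_comp[OF free_class_hom(1) q(1)])
  show "(\<lambda>t. free_sim_rel `` {free_class t}) ` terms = carrier (quotient_alg (free_lad X) free_sim_rel)"
    unfolding q(2)[symmetric] free_class_hom(2)[symmetric] by (simp add: image_image)
  show "free_sim_rel `` {free_class s} = free_sim_rel `` {free_class t} \<longleftrightarrow> sim s t"
    if "s \<in> terms" "t \<in> terms" for s t
    using q(3)[OF free_class_in free_class_in] free_sim_rel_iff that by simp
qed

text \<open>
  The congruences are treated one at a time: the quotient by each of them is left adequate by
  assumption, and the value of a term in it is its class.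
\<close>
lemma sim_in_left_adequate_congruence:
  assumes r: "congruence (free_lad X) r" "idempath_relations \<subseteq> r" "left_adequate (quotient_alg (free_lad X) r)"
    and st: "s \<in> terms" "t \<in> terms" "sim s t"
  shows "(free_class s, free_class t) \<in> r"
proof -
  let ?M = "quotient_alg (free_lad X) r" and ?h = "\<lambda>t. r `` {free_class t}"
  note q = alg_hom_quotient[OF closed_free_lad r(1)]
  have h: "alg_hom (term_alg X) ?M ?h" by (rule alg_hom_comp[OF free_class_hom(1) q(1)])
  interpret M: left_adequate_monoid ?M using r(3) by unfold_locales
  have inM: "?h t \<in> carrier ?M" if "t \<in> terms" for t using that h by (auto simp: alg_hom_def)
  have word: "word_val ?M (\<lambda>x. ?h (Gen x)) w = ?h (word_term w)" if "set w \<subseteq> X" for w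
    using that
  proof (induction w)
    case Nil
    then show ?case using h by (simp add: word_val_def alg_hom_def)
  next
    case (Cons x w)
    then have "?h (Mul (Gen x) (word_term w)) = ?h (Gen x) \<otimes>\<^bsub>?M\<^esub> ?h (word_term w)"
      using h word_term_in by (simp add: alg_hom_def)
    then show ?case using Cons by (simp add: word_val_def)
  qed
  interpret idempath_model C \<gamma> X ?M "\<lambda>x. ?h (Gen x)"
  proof
    show "?h (Gen x) \<in> carrier ?M" if "x \<in> X" for x using inM that by simp
    fix w assume w: "set w \<subseteq> X" "word_val C \<gamma> w = \<one>"
    note t = word_term_in[OF w(1)]
    have "(plus_op (free_lad X) (free_class (word_term w)), free_class (word_term w)) \<in> idempath_relations"
      unfolding idempath_relations_def free_word_val[OF w(1), symmetric] using w by (auto simp: lists_eq_set)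
    with r(2) have "(plus_op (free_lad X) (free_class (word_term w)), free_class (word_term w)) \<in> r" by blast
    moreover have "plus_op (free_lad X) (free_class (word_term w)) = free_class (Plus (word_term w))"
      using free_class_hom(1) t by (simp add: alg_hom_def)
    ultimately have "?h (Plus (word_term w)) = ?h (word_term w)" using q(3) free_class_in t by simp
    moreover have "?h (Plus (word_term w)) = plus_op ?M (?h (word_term w))"
      using h t by (simp add: alg_hom_def)
    ultimately show "word_val ?M (\<lambda>x. ?h (Gen x)) w \<in> idempotents ?M"
      unfolding word[OF w(1)] using M.plus_in_idem[OF inM[OF t]] by simp
  qed
  have val: "mval u = ?h u" if "u \<in> terms" for u
    using that
  proof (induction u)
    case (Mul s t)
    then show ?case using h by (simp add: alg_hom_def)
  qed (use h in \<open>auto simp: alg_hom_def\<close>)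
  have "?h s = ?h t" using mval_eq_of_sim[OF st] val st by simp
  then show ?thesis using q(3)[OF free_class_in[OF st(1)] free_class_in[OF st(2)]] by simp
qed

lemma PT_isomorphic_LAd: "alg_isomorphic (PT C \<gamma> X) (LAd X idempath_relations)"
proof -
  let ?L = "lad_congruence (free_lad X) idempath_relations"
  have L: "congruence (free_lad X) ?L" "?L \<subseteq> free_sim_rel"
    using lad_congruence_congruence[OF congruence_free_sim_rel idempath_relations_sim left_adequate_free_quotient]
    by auto
  note q = alg_hom_quotient[OF closed_free_lad L(1), folded LAd_def]
  show ?thesis
  proof (rule alg_isomorphic_same_kernel[OF closed_term_alg alg_hom_pretzel])
    show "(\<lambda>t. pretzel C \<gamma> (tree t)) ` terms = carrier (PT C \<gamma> X)" by (rule carrier_PT[symmetric])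
    show "alg_hom (term_alg X) (LAd X idempath_relations) (\<lambda>t. ?L `` {free_class t})"
      by (rule alg_hom_comp[OF free_class_hom(1) q(1)])
    show "(\<lambda>t. ?L `` {free_class t}) ` terms = carrier (LAd X idempath_relations)"
      unfolding q(2)[symmetric] free_class_hom(2)[symmetric] by (simp add: image_image)
    fix s t assume st: "s \<in> terms" "t \<in> terms"
    have "(free_class s, free_class t) \<in> ?L \<longleftrightarrow> sim s t"
    proof
      assume "(free_class s, free_class t) \<in> ?L"
      then show "sim s t" using L(2) free_sim_rel_iff st by blast
    next
      assume "sim s t"
      then show "(free_class s, free_class t) \<in> ?L"
        using sim_in_left_adequate_congruence st unfolding lad_congruence_def by blast
    qed
    then show "pretzel C \<gamma> (tree s) = pretzel C \<gamma> (tree t) \<longleftrightarrow> ?L `` {free_class s} = ?L `` {free_class t}"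
      using pretzel_tree_eq_iff[OF st] q(3)[OF free_class_in[OF st(1)] free_class_in[OF st(2)]] by simp
  qed
qed

end

theorem corollary5p10:
  fixes X :: "'x set" and C :: "('c, 'd) monoid_scheme" and \<gamma> :: "'x \<Rightarrow> 'c"
  assumes "X \<noteq> {}"
    and "generated_monoid X C \<gamma>"
    and "right_cancellative C"
  shows "alg_isomorphic (PT C \<gamma> X)
     (LAd X {(plus_op (free_lad X) (word_val (free_lad X) (free_gen X) w),
              word_val (free_lad X) (free_gen X) w) | w.
              w \<in> lists X \<and> word_val C \<gamma> w = \<one>\<^bsub>C\<^esub>})"
proof -
  interpret right_cancellative_labels C \<gamma> X
    using assms(2,3) unfolding generated_monoid_def
    by (intro right_cancellative_labels.intro right_cancellative_labels_axioms.intro) auto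
  show ?thesis using PT_isomorphic_LAd unfolding idempath_relations_def .
qed

end
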